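(* Let $G$ be a countable group, $\eta$ a sofic conjugation-invariant Borel probability measure on $\mathrm{Sub}_G$, and $(K,\kappa),(L,\lambda)$ two standard probability spaces. If the action of $G$ on $(\mathrm{Sub}_G\otimes K,\eta\otimes\kappa)$ is measurably conjugate to the action of $G$ on $(\mathrm{Sub}_G\otimes L,\eta\otimes\lambda)$ relative to the common factor $G\curvearrowright(\mathrm{Sub}_G,\eta)$, then $H(K,\kappa)=H(L,\lambda)$.
   Context: $2^G$ is the space of all subsets of $G$ with the product topology, and $\mathrm{Sub}_G\subset2^G$ is the closed subspace of subgroups; $G$ acts on it by conjugation. For a Borel space $K$, $\mathrm{Sub}_G\otimes K$ is the set of pairs $(H,\omega)$ with $H\in\mathrm{Sub}_G$ and $\omega:G/H\to K$, with the Borel structure induced from the embedding $(H,\omega)\mapsto(H,\tilde\omega)\in\mathrm{Sub}_G\times K^G$, $\tilde\omega(g)=\omega(gH)$. $G$ acts by $g(H,\omega)=(gHg^{-1},g\omega)$ where $g\omega(f\,gHg^{-1})=\omega(fgH)$. For a conjugation-invariant Borel probability measure $\eta$ on $\mathrm{Sub}_G$ and a Borel probability measure $\kappa$ on $K$, $\eta\otimes\kappa$ is the $G$-invariant probability measure $d(\eta\otimes\kappa)(H,\omega)=d\kappa^{G/H}(\omega)\,d\eta(H)$, with $\kappa^{G/H}$ the product measure. (This is the non-free Bernoulli shift with stabilizer distribution $\eta$ and base $(K,\kappa)$.) Measurably conjugate relative to the common factor $G\curvearrowright(\mathrm{Sub}_G,\eta)$ means: there are conull $G$-invariant Borel subsets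 $X\subset\mathrm{Sub}_G\otimes K$, $Y\subset\mathrm{Sub}_G\otimes L$ and a $G$-equivariant measure-space isomorphism $\phi:X\to Y$ such that $\pi_Y\phi=\pi_X$ almost everywhere, where $\pi_X,\pi_Y$ are the projections to $\mathrm{Sub}_G$. A conjugation-invariant Borel probability measure $\eta$ on $\mathrm{Sub}_G$ is sofic if for every $\delta>0$, finite $S\subset G$ and (weak* ) open neighborhood $\Omega$ of $\eta$ in the space of Borel probability measures on $2^G$ (regarding $\eta$ as a measure on $2^G$), there is an integer $d>0$ and a map $\sigma:G\to\mathrm{Sym}(\{1,\dots,d\})$ such that (1) $d^{-1}|\{q:\sigma(g)\sigma(h)q=\sigma(gh)q\}|\ge1-\delta$ for all $g,h\in S$; and (2) $(\mathrm{Stab}_\sigma)_*u_d\in\Omega$, where $u_d$ is the uniform probability measure on $\{1,\dots,d\}$ and $\mathrm{Stab}_\sigma(q)=\{g\in G:\sigma(g)q=q\}\in2^G$. $H(K,\kappa)=-\sum_{k\in K'}\kappa(\{k\})\log\kappa(\{k\})$ for any countable $K'\subset K$ with $\kappa(K')=1$, and $H(K,\kappa)=+\infty$ if no such $K'$ exists. *)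

theory Defs
  imports "HOL-Probability.Probability" "HOL-Algebra.Left_Coset"
begin

definition borel_of :: "'a topology \<Rightarrow> 'a measure" where
  "borel_of X = sigma (topspace X) {U. openin X U}"

text \<open>A standard probability space is a Borel probability measure on a standard Borel space,
  i.e. on the Borel space underlying a Polish topology; no completion is taken.\<close>

definition standard_borel_space :: "'a measure \<Rightarrow> bool" where
  "standard_borel_space M \<longleftrightarrow>
     (\<exists>X. completely_metrizable_space X \<and> second_countable X \<and>
          space M = topspace X \<and> sets M = sets (borel_of X))"

definition standard_prob_space :: "'a measure \<Rightarrow> bool" where
  "standard_prob_space M \<longleftrightarrow> prob_space M \<and> standard_borel_space M"

definition borel_prob_measures :: "'a topology \<Rightarrow> 'a measure set" where
  "borel_prob_measures X = {\<mu>. prob_space \<mu> \<and> sets \<mu> = sets (borel_of X)}"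

text \<open>The coarsest topology on the Borel probability measures for which integration against every
  continuous real function is continuous. It is only used for compact \<open>X\<close>, where
  continuous functions are bounded.\<close>

definition weak_star_topology :: "'a topology \<Rightarrow> 'a measure topology" where
  "weak_star_topology X = topology_generated_by
     {{\<mu> \<in> borel_prob_measures X. (\<integral>x. f x \<partial>\<mu>) \<in> U} | f U.
        continuous_map X euclideanreal f \<and> open (U :: real set)}"

definition subset_topology :: "('g, 'm) monoid_scheme \<Rightarrow> 'g set topology" where
  "subset_topology G = pullback_topology (Pow (carrier G)) (\<lambda>A. \<lambda>g\<in>carrier G. g \<in> A)
     (product_topology (\<lambda>_. discrete_topology (UNIV :: bool set)) (carrier G))"

definition Sub_topology :: "('g, 'm) monoid_scheme \<Rightarrow> 'g set topology" where
  "Sub_topology G = subtopology (subset_topology G) {H. subgroup H G}"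

definition conj_subgroup :: "('g, 'm) monoid_scheme \<Rightarrow> 'g \<Rightarrow> 'g set \<Rightarrow> 'g set" where
  "conj_subgroup G g H = (g <#\<^bsub>G\<^esub> H) #>\<^bsub>G\<^esub> inv\<^bsub>G\<^esub> g"

definition conj_invariant_measure :: "('g, 'm) monoid_scheme \<Rightarrow> 'g set measure \<Rightarrow> bool" where
  "conj_invariant_measure G \<eta> \<longleftrightarrow>
     \<eta> \<in> borel_prob_measures (Sub_topology G) \<and>
     (\<forall>g\<in>carrier G. distr \<eta> (borel_of (Sub_topology G)) (conj_subgroup G g) = \<eta>)"

text \<open>For a subgroup \<open>H\<close> the quotient \<open>G/H\<close> is the set \<open>lcosets\<^bsub>G\<^esub> H\<close>, and functions on it are
  extensional.\<close>

definition Sub_tensor_embed ::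
    "('g, 'm) monoid_scheme \<Rightarrow> 'g set \<times> ('g set \<Rightarrow> 'k) \<Rightarrow> 'g set \<times> ('g \<Rightarrow> 'k)" where
  "Sub_tensor_embed G = (\<lambda>(H, \<omega>). (H, \<lambda>g\<in>carrier G. \<omega> (g <#\<^bsub>G\<^esub> H)))"

definition Sub_tensor ::
    "('g, 'm) monoid_scheme \<Rightarrow> 'k measure \<Rightarrow> ('g set \<times> ('g set \<Rightarrow> 'k)) measure" where
  "Sub_tensor G K = vimage_algebra
     {(H, \<omega>). subgroup H G \<and> \<omega> \<in> (lcosets\<^bsub>G\<^esub> H) \<rightarrow>\<^sub>E space K}
     (Sub_tensor_embed G)
     (borel_of (Sub_topology G) \<Otimes>\<^sub>M (\<Pi>\<^sub>M g\<in>carrier G. K))"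

text \<open>Every coset \<open>C\<close> of \<open>gHg\<inverse>\<close> has the form \<open>f gHg\<inverse>\<close>, and then \<open>C g = f g H\<close>; hence the
  formula \<open>(g\<omega>)(C) = \<omega>(C g)\<close> below is the usual one, see \<open>Sub_tensor_act_apply\<close>.\<close>

definition Sub_tensor_act ::
    "('g, 'm) monoid_scheme \<Rightarrow> 'g \<Rightarrow> 'g set \<times> ('g set \<Rightarrow> 'k) \<Rightarrow> 'g set \<times> ('g set \<Rightarrow> 'k)" where
  "Sub_tensor_act G g = (\<lambda>(H, \<omega>).
     (conj_subgroup G g H, \<lambda>C\<in>lcosets\<^bsub>G\<^esub> (conj_subgroup G g H). \<omega> (C #>\<^bsub>G\<^esub> g)))"

text \<open>The measure \<open>\<eta> \<otimes> \<kappa>\<close>. That the set function below is countably additive,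
  so that \<open>measure_of\<close> does not degenerate, is \<open>emeasure_Sub_tensor_measure\<close>.\<close>

definition Sub_tensor_measure ::
    "('g, 'm) monoid_scheme \<Rightarrow> 'g set measure \<Rightarrow> 'k measure
      \<Rightarrow> ('g set \<times> ('g set \<Rightarrow> 'k)) measure" where
  "Sub_tensor_measure G \<eta> \<kappa> = measure_of (space (Sub_tensor G \<kappa>)) (sets (Sub_tensor G \<kappa>))
     (\<lambda>E. \<integral>\<^sup>+H. emeasure (\<Pi>\<^sub>M C\<in>lcosets\<^bsub>G\<^esub> H. \<kappa>)
                 {\<omega> \<in> space (\<Pi>\<^sub>M C\<in>lcosets\<^bsub>G\<^esub> H. \<kappa>). (H, \<omega>) \<in> E} \<partial>\<eta>)"

definition measure_space_iso :: "'a measure \<Rightarrow> 'b measure \<Rightarrow> ('a \<Rightarrow> 'b) \<Rightarrow> bool" where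
  "measure_space_iso M N \<phi> \<longleftrightarrow>
     bij_betw \<phi> (space M) (space N) \<and> \<phi> \<in> M \<rightarrow>\<^sub>M N \<and>
     the_inv_into (space M) \<phi> \<in> N \<rightarrow>\<^sub>M M \<and> distr M N \<phi> = N"

definition conull_invariant ::
    "('g, 'm) monoid_scheme \<Rightarrow> ('g \<Rightarrow> 'a \<Rightarrow> 'a) \<Rightarrow> 'a measure \<Rightarrow> 'a set \<Rightarrow> bool" where
  "conull_invariant G act M X \<longleftrightarrow>
     X \<in> sets M \<and> emeasure M (space M - X) = 0 \<and> (\<forall>g\<in>carrier G. act g ` X = X)"

definition conjugate_rel_Sub ::
    "('g, 'm) monoid_scheme \<Rightarrow> 'g set measure \<Rightarrow> 'k measure \<Rightarrow> 'l measure \<Rightarrow> bool" where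
  "conjugate_rel_Sub G \<eta> \<kappa> \<nu> \<longleftrightarrow>
     (\<exists>X Y \<phi>.
        conull_invariant G (Sub_tensor_act G) (Sub_tensor_measure G \<eta> \<kappa>) X \<and>
        conull_invariant G (Sub_tensor_act G) (Sub_tensor_measure G \<eta> \<nu>) Y \<and>
        measure_space_iso (restrict_space (Sub_tensor_measure G \<eta> \<kappa>) X)
          (restrict_space (Sub_tensor_measure G \<eta> \<nu>) Y) \<phi> \<and>
        (\<forall>g\<in>carrier G. \<forall>x\<in>X. \<phi> (Sub_tensor_act G g x) = Sub_tensor_act G g (\<phi> x)) \<and>
        (AE x in restrict_space (Sub_tensor_measure G \<eta> \<kappa>) X. fst (\<phi> x) = fst x))"

definition Stab_map :: "('g, 'm) monoid_scheme \<Rightarrow> ('g \<Rightarrow> nat \<Rightarrow> nat) \<Rightarrow> nat \<Rightarrow> 'g set" where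
  "Stab_map G \<sigma> q = {g \<in> carrier G. \<sigma> g q = q}"

definition sofic_measure :: "('g, 'm) monoid_scheme \<Rightarrow> 'g set measure \<Rightarrow> bool" where
  "sofic_measure G \<eta> \<longleftrightarrow>
     (\<forall>\<delta>>0. \<forall>S \<Omega>. finite S \<and> S \<subseteq> carrier G \<and>
        openin (weak_star_topology (subset_topology G)) \<Omega> \<and>
        distr \<eta> (borel_of (subset_topology G)) (\<lambda>H. H) \<in> \<Omega> \<longrightarrow>
        (\<exists>d>0. \<exists>\<sigma>. (\<forall>g\<in>carrier G. \<sigma> g permutes {1..d}) \<and>
           (\<forall>g\<in>S. \<forall>h\<in>S.
              real (card {q \<in> {1..d}. \<sigma> g (\<sigma> h q) = \<sigma> (g \<otimes>\<^bsub>G\<^esub> h) q}) / real d \<ge> 1 - \<delta>) \<and>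
           distr (uniform_count_measure {1..d}) (borel_of (subset_topology G)) (Stab_map G \<sigma>)
             \<in> \<Omega>))"

text \<open>The value does not depend on the choice of \<open>K'\<close>, see \<open>Shannon_entropy_eq\<close>. All summands
  are nonnegative for a probability measure, and \<open>ln 0 = 0\<close>.\<close>

definition Shannon_entropy :: "'k measure \<Rightarrow> ennreal" where
  "Shannon_entropy \<kappa> =
     (if \<exists>K'. countable K' \<and> K' \<subseteq> space \<kappa> \<and> measure \<kappa> K' = 1
      then \<Sum>\<^sub>\<infinity>k\<in>(SOME K'. countable K' \<and> K' \<subseteq> space \<kappa> \<and> measure \<kappa> K' = 1).
             ennreal (- (measure \<kappa> {k} * ln (measure \<kappa> {k})))
      else \<infinity>)"

lemma Shannon_entropy_eq:
  assumes "prob_space \<kappa>" "countable K'" "K' \<subseteq> space \<kappa>" "measure \<kappa> K' = 1"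
  shows "Shannon_entropy \<kappa> = (\<Sum>\<^sub>\<infinity>k\<in>K'. ennreal (- (measure \<kappa> {k} * ln (measure \<kappa> {k}))))"
proof -
  interpret prob_space \<kappa> by fact
  define P where "P = (\<lambda>K'. countable K' \<and> K' \<subseteq> space \<kappa> \<and> measure \<kappa> K' = 1)"
  define A where "A = (SOME K'. P K')"
  have PK: "P K'" using assms by (simp add: P_def)
  then have PA: "P A" unfolding A_def by (rule someI)
  have zero: "measure \<kappa> {k} = 0" if "P B" "k \<notin> B" for B k
  proof (cases "{k} \<in> sets \<kappa>")
    case True
    have B: "B \<in> sets \<kappa>" "prob B = 1"
      using \<open>P B\<close> measure_notin_sets[of B \<kappa>] by (auto simp: P_def)
    have "prob (B \<union> {k}) = prob B + prob {k}"
      using that True B by (intro finite_measure_Union) auto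
    then show ?thesis
      using B prob_le_1[of "B \<union> {k}"] measure_nonneg[of \<kappa> "{k}"] by linarith
  qed (simp add: measure_notin_sets)
  have "(\<Sum>\<^sub>\<infinity>k\<in>A. ennreal (- (measure \<kappa> {k} * ln (measure \<kappa> {k})))) =
        (\<Sum>\<^sub>\<infinity>k\<in>K'. ennreal (- (measure \<kappa> {k} * ln (measure \<kappa> {k}))))"
    by (rule infsum_cong_neutral) (use zero[OF PA] zero[OF PK] in auto)
  then show ?thesis
    using PK unfolding Shannon_entropy_def A_def P_def by auto
qed

lemma topspace_subset_topology: "topspace (subset_topology G) = Pow (carrier G)"
  by (auto simp: subset_topology_def topspace_pullback_topology)

lemma topspace_Sub_topology: "topspace (Sub_topology G) = {H. subgroup H G}"
  by (auto simp: Sub_topology_def topspace_subset_topology dest: subgroup.subset)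

lemma space_borel_of [simp]: "space (borel_of X) = topspace X"
  by (simp add: borel_of_def space_measure_of_conv)

lemma open_in_borel_of: "openin X U \<Longrightarrow> U \<in> sets (borel_of X)"
  by (auto simp: borel_of_def sets_measure_of_conv dest: openin_subset)

lemma measurable_mem_Sub [measurable]:
  "Measurable.pred (borel_of (Sub_topology G)) (\<lambda>H. g \<in> H)"
proof (cases "g \<in> carrier G")
  case True
  have "openin (product_topology (\<lambda>_. discrete_topology (UNIV :: bool set)) (carrier G))
          {f \<in> topspace (product_topology (\<lambda>_. discrete_topology UNIV) (carrier G)). f g \<in> {True}}"
    by (rule openin_continuous_map_preimage[OF continuous_map_product_projection[OF True]]) simp
  then have "openin (subset_topology G)
      ((\<lambda>A. \<lambda>g\<in>carrier G. g \<in> A) -`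
        {f \<in> topspace (product_topology (\<lambda>_. discrete_topology UNIV) (carrier G)). f g \<in> {True}}
        \<inter> Pow (carrier G))" (is "openin _ ?U")
    unfolding subset_topology_def openin_pullback_topology by blast
  moreover have "{H \<in> topspace (Sub_topology G). g \<in> H} = ?U \<inter> {H. subgroup H G}"
    using True by (auto simp: topspace_Sub_topology dest: subgroup.subset)
  ultimately have "openin (Sub_topology G) {H \<in> topspace (Sub_topology G). g \<in> H}"
    unfolding Sub_topology_def openin_subtopology by blast
  then show ?thesis
    by (simp add: pred_def open_in_borel_of)
next
  case False
  then have "{H \<in> space (borel_of (Sub_topology G)). g \<in> H} = {}"
    by (auto simp: topspace_Sub_topology dest: subgroup.subset)
  then show ?thesis unfolding pred_def by (simp only: sets.empty_sets)
qed

lemma (in group) lcoset_eq_iff: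
  assumes "subgroup H G" "g \<in> carrier G" "h \<in> carrier G"
  shows "g <# H = h <# H \<longleftrightarrow> inv g \<otimes> h \<in> H"
proof
  assume "g <# H = h <# H"
  then have "h \<in> g <# H" using lcos_self[of h H] assms by simp
  then obtain x where "x \<in> H" "h = g \<otimes> x" by (auto simp: l_coset_def)
  then show "inv g \<otimes> h \<in> H"
    using assms subgroup.mem_carrier[OF assms(1)] by (simp add: m_assoc[symmetric])
next
  assume "inv g \<otimes> h \<in> H"
  then have "h \<in> g <# H"
    using assms by (auto simp: l_coset_def m_assoc[symmetric] intro!: bexI[of _ "inv g \<otimes> h"])
  then show "g <# H = h <# H"
    using l_repr_independence assms by blast
qed

lemma (in group) Sub_tensor_act_apply:
  assumes H: "subgroup H G" and g: "g \<in> carrier G" and f: "f \<in> carrier G"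
  shows "snd (Sub_tensor_act G g (H, \<omega>)) (f <# conj_subgroup G g H) = \<omega> ((f \<otimes> g) <# H)"
proof -
  have HG: "H \<subseteq> carrier G" using H by (rule subgroup.subset)
  have "(f <# conj_subgroup G g H) #> g = (f \<otimes> g) <# H"
    using g f HG unfolding conj_subgroup_def l_coset_def r_coset_def
    by (auto simp: m_assoc subset_eq)
  moreover have "f <# conj_subgroup G g H \<in> lcosets (conj_subgroup G g H)"
    using f by (auto simp: LCOSETS_def)
  ultimately show ?thesis by (simp add: Sub_tensor_act_def)
qed

lemma space_Sub_tensor:
  "space (Sub_tensor G K) = {(H, \<omega>). subgroup H G \<and> \<omega> \<in> (lcosets\<^bsub>G\<^esub> H) \<rightarrow>\<^sub>E space K}"
  by (simp add: Sub_tensor_def)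

lemma space_Sub_tensor_measure [simp]:
  "space (Sub_tensor_measure G \<eta> \<kappa>) = space (Sub_tensor G \<kappa>)"
  by (simp add: Sub_tensor_measure_def sets.space_closed)

lemma sets_Sub_tensor_measure [simp, measurable_cong]:
  "sets (Sub_tensor_measure G \<eta> \<kappa>) = sets (Sub_tensor G \<kappa>)"
  by (simp add: Sub_tensor_measure_def sets.space_closed sets.sigma_sets_eq)

lemma measurable_lift:
  "(\<lambda>\<omega>. \<lambda>g\<in>carrier G. \<omega> (g <#\<^bsub>G\<^esub> H)) \<in> (\<Pi>\<^sub>M C\<in>lcosets\<^bsub>G\<^esub> H. K) \<rightarrow>\<^sub>M (\<Pi>\<^sub>M g\<in>carrier G. K)"
proof (rule measurable_restrict)
  fix g assume "g \<in> carrier G"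
  then have "g <#\<^bsub>G\<^esub> H \<in> lcosets\<^bsub>G\<^esub> H" by (auto simp: LCOSETS_def)
  then show "(\<lambda>\<omega>. \<omega> (g <#\<^bsub>G\<^esub> H)) \<in> (\<Pi>\<^sub>M C\<in>lcosets\<^bsub>G\<^esub> H. K) \<rightarrow>\<^sub>M K" by simp
qed

lemma (in group) measurable_lift_kernel:
  assumes "prob_space \<kappa>"
  shows "(\<lambda>H. distr (\<Pi>\<^sub>M C\<in>lcosets H. \<kappa>) (\<Pi>\<^sub>M g\<in>carrier G. \<kappa>)
                (\<lambda>\<omega>. \<lambda>g\<in>carrier G. \<omega> (g <# H)))
         \<in> borel_of (Sub_topology G) \<rightarrow>\<^sub>M subprob_algebra (\<Pi>\<^sub>M g\<in>carrier G. \<kappa>)"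
proof -
  interpret \<kappa>: prob_space \<kappa> by fact
  have prob: "prob_space (PiM I (\<lambda>_. \<kappa>))" for I :: "'x set"
    by (rule prob_space_PiM) (rule assms)
  define V where "V H = distr (\<Pi>\<^sub>M C\<in>lcosets H. \<kappa>) (\<Pi>\<^sub>M g\<in>carrier G. \<kappa>)
                (\<lambda>\<omega>. \<lambda>g\<in>carrier G. \<omega> (g <# H))" for H
  have pV: "prob_space (V H)" for H
    unfolding V_def by (intro prob_space.prob_space_distr prob measurable_lift)
  have "V \<in> borel_of (Sub_topology G) \<rightarrow>\<^sub>M subprob_algebra (\<Pi>\<^sub>M g\<in>carrier G. \<kappa>)"
  proof (rule measurable_subprob_algebra_generated[OF sets_PiM Int_stable_prod_algebra
              prod_algebra_sets_into_space])
    fix H show "subprob_space (V H)" by (rule prob_space_imp_subprob_space[OF pV])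
    show "sets (V H) = sets (\<Pi>\<^sub>M g\<in>carrier G. \<kappa>)" by (simp add: V_def)
  next
    have "emeasure (V H) (space (\<Pi>\<^sub>M g\<in>carrier G. \<kappa>)) = 1" for H
      using prob_space.emeasure_space_1[OF pV[of H]] by (simp add: V_def)
    then show "(\<lambda>H. emeasure (V H) (\<Pi>\<^sub>E g\<in>carrier G. space \<kappa>)) \<in> borel_measurable (borel_of (Sub_topology G))"
      by (simp add: space_PiM)
  next
    fix A assume "A \<in> prod_algebra (carrier G) (\<lambda>_. \<kappa>)"
    then obtain J X where A: "A = prod_emb (carrier G) (\<lambda>_. \<kappa>) J (Pi\<^sub>E J X)"
      and J: "finite J" "J \<subseteq> carrier G" and X: "\<And>j. j \<in> J \<Longrightarrow> X j \<in> sets \<kappa>"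
      by (rule prod_algebraE) auto
    define R where "R H = {p \<in> J \<times> J. inv (fst p) \<otimes> snd p \<in> H}" for H
    define W where "W Q = (\<Prod>T\<in>(\<lambda>g. {h\<in>J. (g, h) \<in> Q}) ` J. emeasure \<kappa> (space \<kappa> \<inter> (\<Inter>h\<in>T. X h)))"
      for Q
    have VW: "emeasure (V H) A = W (R H)" if H: "subgroup H G" for H
    proof -
      interpret L: product_prob_space "\<lambda>_. \<kappa>" "lcosets H" by unfold_locales
      define F where "F = (\<lambda>g. g <# H) ` J"
      define cls where "cls C = {h\<in>J. h <# H = C}" for C
      define Y where "Y C = space \<kappa> \<inter> (\<Inter>h\<in>cls C. X h)" for C
      have FL: "F \<subseteq> lcosets H" "finite F" using J by (auto simp: F_def LCOSETS_def)
      have Y: "Y C \<in> sets \<kappa>" for C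
        unfolding Y_def cls_def using J X by (cases "{h\<in>J. h <# H = C} = {}")
          (auto intro!: sets.Int sets.finite_INT)
      have As: "A \<in> sets (\<Pi>\<^sub>M g\<in>carrier G. \<kappa>)"
        unfolding A using J X by (intro sets_PiM_I) auto
      have mem: "(\<lambda>g\<in>carrier G. \<omega> (g <# H)) \<in> A \<longleftrightarrow> (\<forall>C\<in>F. \<omega> C \<in> Y C)"
        if "\<omega> \<in> space (\<Pi>\<^sub>M C\<in>lcosets H. \<kappa>)" for \<omega>
      proof -
        have sp: "\<omega> (g <# H) \<in> space \<kappa>" if "g \<in> carrier G" for g
          using \<open>\<omega> \<in> _\<close> that by (auto simp: space_PiM LCOSETS_def)
        have "(\<lambda>g\<in>carrier G. \<omega> (g <# H)) \<in> A \<longleftrightarrow> (\<forall>g\<in>J. \<omega> (g <# H) \<in> X g)"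
          unfolding A prod_emb_def using J sp
          by (auto simp: PiE_iff Pi_iff restrict_def extensional_def subset_eq)
        also have "\<dots> \<longleftrightarrow> (\<forall>C\<in>F. \<omega> C \<in> Y C)"
          using J sp by (auto simp: F_def Y_def cls_def subset_eq)
        finally show ?thesis .
      qed
      have "emeasure (V H) A = emeasure (\<Pi>\<^sub>M C\<in>lcosets H. \<kappa>)
              {\<omega> \<in> space (\<Pi>\<^sub>M C\<in>lcosets H. \<kappa>). \<forall>C\<in>F. \<omega> C \<in> Y C}"
      proof -
        have "(\<lambda>\<omega>. \<lambda>g\<in>carrier G. \<omega> (g <# H)) -` A \<inter> space (\<Pi>\<^sub>M C\<in>lcosets H. \<kappa>)
            = {\<omega> \<in> space (\<Pi>\<^sub>M C\<in>lcosets H. \<kappa>). \<forall>C\<in>F. \<omega> C \<in> Y C}"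
          using mem by blast
        then show ?thesis unfolding V_def by (simp only: emeasure_distr[OF measurable_lift As])
      qed
      also have "\<dots> = (\<Prod>C\<in>F. emeasure \<kappa> (Y C))"
        using FL Y by (intro L.emeasure_PiM_Collect) auto
      also have "\<dots> = (\<Prod>T\<in>cls ` F. emeasure \<kappa> (space \<kappa> \<inter> (\<Inter>h\<in>T. X h)))"
      proof (subst prod.reindex)
        show "inj_on cls F"
        proof (rule inj_onI)
          fix C D assume "C \<in> F" "D \<in> F" and eq: "cls C = cls D"
          then obtain g where g: "g \<in> J" "C = g <# H" by (auto simp: F_def)
          then have "g \<in> cls C" by (simp add: cls_def)
          then have "g \<in> cls D" by (simp only: eq)
          then show "C = D" using g by (simp add: cls_def)
        qed
      qed (simp add: Y_def)
      also have "cls ` F = (\<lambda>g. {h\<in>J. (g, h) \<in> R H}) ` J"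
      proof -
        have "cls (g <# H) = {h\<in>J. (g, h) \<in> R H}" if "g \<in> J" for g
          using that J lcoset_eq_iff[OF H, of g] by (auto simp: cls_def R_def subset_eq)
        then show ?thesis by (auto simp: F_def image_image cong: image_cong)
      qed
      finally show ?thesis by (simp add: W_def)
    qed
    have "R \<in> borel_of (Sub_topology G) \<rightarrow>\<^sub>M count_space (Pow (J \<times> J))"
    proof (subst measurable_count_space_eq2)
      show "finite (Pow (J \<times> J))" using J by simp
      show "R \<in> space (borel_of (Sub_topology G)) \<rightarrow> Pow (J \<times> J) \<and>
        (\<forall>Q\<in>Pow (J \<times> J). R -` {Q} \<inter> space (borel_of (Sub_topology G)) \<in> sets (borel_of (Sub_topology G)))"
      proof (intro conjI ballI)
        fix Q assume Q: "Q \<in> Pow (J \<times> J)"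
        have fin: "finite (J \<times> J)" using J by simp
        have "R -` {Q} \<inter> space (borel_of (Sub_topology G)) =
          {H \<in> space (borel_of (Sub_topology G)).
             \<forall>p\<in>J \<times> J. (inv (fst p) \<otimes> snd p \<in> H) \<longleftrightarrow> p \<in> Q}"
        proof -
          have "R H = Q \<longleftrightarrow> (\<forall>p\<in>J \<times> J. (inv (fst p) \<otimes> snd p \<in> H) \<longleftrightarrow> p \<in> Q)" for H
            using Q unfolding R_def by blast
          then show ?thesis by blast
        qed
        also have "\<dots> \<in> sets (borel_of (Sub_topology G))"
        proof (rule sets.sets_Collect_finite_All[OF _ fin])
          fix p show "{H \<in> space (borel_of (Sub_topology G)). (inv (fst p) \<otimes> snd p \<in> H) \<longleftrightarrow> p \<in> Q}
              \<in> sets (borel_of (Sub_topology G))"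
          proof (cases "p \<in> Q")
            case True
            then show ?thesis
              using measurable_mem_Sub[of "inv (fst p) \<otimes> snd p" G] by (simp add: pred_def)
          next
            case False
            then show ?thesis
              using pred_intros_logic(2)[OF measurable_mem_Sub[of "inv (fst p) \<otimes> snd p" G]]
              by (simp add: pred_def)
          qed
        qed
        finally show "R -` {Q} \<inter> space (borel_of (Sub_topology G)) \<in> sets (borel_of (Sub_topology G))" .
      qed (auto simp: R_def)
    qed
    then have "(\<lambda>H. W (R H)) \<in> borel_measurable (borel_of (Sub_topology G))"
      by (rule measurable_compose) simp
    then show "(\<lambda>H. emeasure (V H) A) \<in> borel_measurable (borel_of (Sub_topology G))"
      by (subst measurable_cong[where g = "\<lambda>H. W (R H)"])
         (auto simp: VW topspace_Sub_topology)
  qed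
  then show ?thesis by (simp add: V_def[abs_def])
qed

lemma measurable_Pair_Sub_tensor:
  assumes "subgroup H G"
  shows "Pair H \<in> (\<Pi>\<^sub>M C\<in>lcosets\<^bsub>G\<^esub> H. \<kappa>) \<rightarrow>\<^sub>M Sub_tensor G \<kappa>"
  unfolding Sub_tensor_def
proof (rule measurable_vimage_algebra2)
  show "Pair H \<in> space (\<Pi>\<^sub>M C\<in>lcosets\<^bsub>G\<^esub> H. \<kappa>)
      \<rightarrow> {(H, \<omega>). subgroup H G \<and> \<omega> \<in> lcosets\<^bsub>G\<^esub> H \<rightarrow>\<^sub>E space \<kappa>}"
    using assms by (auto simp: space_PiM)
  show "(\<lambda>\<omega>. Sub_tensor_embed G (H, \<omega>)) \<in> (\<Pi>\<^sub>M C\<in>lcosets\<^bsub>G\<^esub> H. \<kappa>)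
      \<rightarrow>\<^sub>M borel_of (Sub_topology G) \<Otimes>\<^sub>M (\<Pi>\<^sub>M g\<in>carrier G. \<kappa>)"
    unfolding Sub_tensor_embed_def using assms measurable_lift[of G H \<kappa>]
    by (auto simp: topspace_Sub_topology intro!: measurable_Pair)
qed

lemma (in group) emeasure_Sub_tensor_measure:
  assumes \<eta>: "\<eta> \<in> borel_prob_measures (Sub_topology G)" and \<kappa>: "prob_space \<kappa>"
    and E: "E \<in> sets (Sub_tensor G \<kappa>)"
  shows "emeasure (Sub_tensor_measure G \<eta> \<kappa>) E =
     (\<integral>\<^sup>+H. emeasure (\<Pi>\<^sub>M C\<in>lcosets H. \<kappa>)
             {\<omega> \<in> space (\<Pi>\<^sub>M C\<in>lcosets H. \<kappa>). (H, \<omega>) \<in> E} \<partial>\<eta>)" (is "_ = ?m E")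
proof -
  have s\<eta>: "sets \<eta> = sets (borel_of (Sub_topology G))" using \<eta> by (simp add: borel_prob_measures_def)
  then have sp: "space \<eta> = {H. subgroup H G}"
    using sets_eq_imp_space_eq[OF s\<eta>] by (simp add: topspace_Sub_topology)
  define V where "V H = distr (\<Pi>\<^sub>M C\<in>lcosets H. \<kappa>) (\<Pi>\<^sub>M g\<in>carrier G. \<kappa>)
                (\<lambda>\<omega>. \<lambda>g\<in>carrier G. \<omega> (g <# H))" for H
  have V: "V \<in> borel_of (Sub_topology G) \<rightarrow>\<^sub>M subprob_algebra (\<Pi>\<^sub>M g\<in>carrier G. \<kappa>)"
    using measurable_lift_kernel[OF \<kappa>] by (simp add: V_def[abs_def])
  have sl: "{\<omega> \<in> space (\<Pi>\<^sub>M C\<in>lcosets H. \<kappa>). (H, \<omega>) \<in> F} \<in> sets (\<Pi>\<^sub>M C\<in>lcosets H. \<kappa>)"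
    if "F \<in> sets (Sub_tensor G \<kappa>)" "H \<in> space \<eta>" for F H
    using measurable_sets[OF measurable_Pair_Sub_tensor[of H G \<kappa>] that(1)] that(2)
    by (simp add: sp vimage_def Int_def conj_commute)
  have meas: "(\<lambda>H. emeasure (\<Pi>\<^sub>M C\<in>lcosets H. \<kappa>)
          {\<omega> \<in> space (\<Pi>\<^sub>M C\<in>lcosets H. \<kappa>). (H, \<omega>) \<in> F}) \<in> borel_measurable \<eta>"
    if F: "F \<in> sets (Sub_tensor G \<kappa>)" for F
  proof -
    have "Sub_tensor_embed G \<in> space (Sub_tensor G \<kappa>)
        \<rightarrow> space (borel_of (Sub_topology G) \<Otimes>\<^sub>M (\<Pi>\<^sub>M g\<in>carrier G. \<kappa>))"
      by (auto simp: space_Sub_tensor Sub_tensor_embed_def space_pair_measure space_PiM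
          topspace_Sub_topology LCOSETS_def)
    then obtain B where B: "B \<in> sets (borel_of (Sub_topology G) \<Otimes>\<^sub>M (\<Pi>\<^sub>M g\<in>carrier G. \<kappa>))"
      and FB: "F = Sub_tensor_embed G -` B \<inter> space (Sub_tensor G \<kappa>)"
      using F unfolding Sub_tensor_def by (auto simp: sets_vimage_algebra2)
    have "emeasure (\<Pi>\<^sub>M C\<in>lcosets H. \<kappa>) {\<omega> \<in> space (\<Pi>\<^sub>M C\<in>lcosets H. \<kappa>). (H, \<omega>) \<in> F}
       = (\<integral>\<^sup>+x. indicator B (H, x) \<partial>V H)" if H: "subgroup H G" for H
    proof -
      have BH: "Pair H -` B \<in> sets (\<Pi>\<^sub>M g\<in>carrier G. \<kappa>)" by (rule sets_Pair1[OF B])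
      have "(\<integral>\<^sup>+x. indicator B (H, x) \<partial>V H) = (\<integral>\<^sup>+x. indicator (Pair H -` B) x \<partial>V H)"
        by (simp add: indicator_def)
      also have "\<dots> = emeasure (V H) (Pair H -` B)"
        using BH by (simp add: V_def)
      also have "\<dots> = emeasure (\<Pi>\<^sub>M C\<in>lcosets H. \<kappa>)
          {\<omega> \<in> space (\<Pi>\<^sub>M C\<in>lcosets H. \<kappa>). (H, \<omega>) \<in> F}"
        unfolding V_def by (subst emeasure_distr[OF measurable_lift BH])
          (use H in \<open>auto intro!: arg_cong2[where f = emeasure]
            simp: FB space_Sub_tensor space_PiM Sub_tensor_embed_def\<close>)
      finally show ?thesis by simp
    qed
    moreover have "(\<lambda>H. \<integral>\<^sup>+x. indicator B (H, x) \<partial>V H) \<in> borel_measurable (borel_of (Sub_topology G))"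
      by (rule nn_integral_measurable_subprob_algebra2[OF _ V]) (use B in simp)
    ultimately show ?thesis
      by (subst measurable_cong[where g = "\<lambda>H. \<integral>\<^sup>+x. indicator B (H, x) \<partial>V H"])
         (auto simp: sp measurable_cong_sets[OF s\<eta> refl])
  qed
  show ?thesis
    unfolding Sub_tensor_measure_def
  proof (rule emeasure_measure_of_sigma)
    show "sigma_algebra (space (Sub_tensor G \<kappa>)) (sets (Sub_tensor G \<kappa>))"
      by (rule sets.sigma_algebra_axioms)
    show "positive (sets (Sub_tensor G \<kappa>)) ?m" by (simp add: positive_def)
    show "countably_additive (sets (Sub_tensor G \<kappa>)) ?m"
    proof (rule countably_additiveI)
      fix F :: "nat \<Rightarrow> _" assume F: "range F \<subseteq> sets (Sub_tensor G \<kappa>)" "disjoint_family F"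
      have "(\<Sum>i. ?m (F i)) = (\<integral>\<^sup>+H. (\<Sum>i. emeasure (\<Pi>\<^sub>M C\<in>lcosets H. \<kappa>)
             {\<omega> \<in> space (\<Pi>\<^sub>M C\<in>lcosets H. \<kappa>). (H, \<omega>) \<in> F i}) \<partial>\<eta>)"
        by (rule nn_integral_suminf[symmetric]) (use F in \<open>auto intro!: meas\<close>)
      also have "\<dots> = ?m (\<Union>i. F i)"
      proof (rule nn_integral_cong)
        fix H assume H: "H \<in> space \<eta>"
        show "(\<Sum>i. emeasure (\<Pi>\<^sub>M C\<in>lcosets H. \<kappa>) {\<omega> \<in> space (\<Pi>\<^sub>M C\<in>lcosets H. \<kappa>). (H, \<omega>) \<in> F i})
          = emeasure (\<Pi>\<^sub>M C\<in>lcosets H. \<kappa>) {\<omega> \<in> space (\<Pi>\<^sub>M C\<in>lcosets H. \<kappa>). (H, \<omega>) \<in> (\<Union>i. F i)}"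
          by (subst suminf_emeasure)
             (use F H sl in \<open>auto simp: disjoint_family_on_def intro!: arg_cong2[where f = emeasure]\<close>)
      qed
      finally show "(\<Sum>i. ?m (F i)) = ?m (\<Union>i. F i)" .
    qed
    show "E \<in> sets (Sub_tensor G \<kappa>)" by fact
  qed
qed

lemma (in group) prob_space_Sub_tensor_measure:
  assumes \<eta>: "\<eta> \<in> borel_prob_measures (Sub_topology G)" and \<kappa>: "prob_space \<kappa>"
  shows "prob_space (Sub_tensor_measure G \<eta> \<kappa>)"
proof
  interpret \<eta>: prob_space \<eta> using \<eta> by (simp add: borel_prob_measures_def)
  have "sets \<eta> = sets (borel_of (Sub_topology G))" using \<eta> by (simp add: borel_prob_measures_def)
  then have sp: "space \<eta> = {H. subgroup H G}"
    using sets_eq_imp_space_eq[of \<eta>] by (simp add: topspace_Sub_topology)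
  have "emeasure (Sub_tensor_measure G \<eta> \<kappa>) (space (Sub_tensor G \<kappa>)) = (\<integral>\<^sup>+H. 1 \<partial>\<eta>)"
  proof (subst emeasure_Sub_tensor_measure[OF \<eta> \<kappa> sets.top], rule nn_integral_cong)
    fix H assume "H \<in> space \<eta>"
    then have "{\<omega> \<in> space (\<Pi>\<^sub>M C\<in>lcosets H. \<kappa>). (H, \<omega>) \<in> space (Sub_tensor G \<kappa>)}
        = space (\<Pi>\<^sub>M C\<in>lcosets H. \<kappa>)"
      by (auto simp: sp space_Sub_tensor space_PiM)
    then show "emeasure (\<Pi>\<^sub>M C\<in>lcosets H. \<kappa>)
        {\<omega> \<in> space (\<Pi>\<^sub>M C\<in>lcosets H. \<kappa>). (H, \<omega>) \<in> space (Sub_tensor G \<kappa>)} = 1"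
      using prob_space.emeasure_space_1[OF prob_space_PiM[of "lcosets H" "\<lambda>_. \<kappa>"]] \<kappa> by simp
  qed
  then show "emeasure (Sub_tensor_measure G \<eta> \<kappa>) (space (Sub_tensor_measure G \<eta> \<kappa>)) = 1"
    by (simp add: \<eta>.emeasure_space_1)
qed

end

theory Submission
  imports Defs
begin

text \<open>
  The entropy \<open>H(\<kappa>)\<close> is the supremum of the entropies of finite measurable partitions, so if
  \<open>H(\<nu>) < H(\<kappa>)\<close> there is a finite partition \<open>\<alpha>\<close> of \<open>K\<close> with \<open>H(\<alpha>) > H(\<nu>)\<close>. Approximate the
  conjugacy \<open>\<phi>\<close> by a sliding block code with finite window and finite alphabet, and its inverse,
  followed by \<open>\<alpha>\<close>, by another one; both codes also read the stabilizer in a finite window. Along a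
  sofic approximation \<open>\<sigma>\<close> of \<open>\<eta>\<close> by permutations of \<open>{1..d}\<close>, apply the first code to an i.i.d.
  colouring \<open>x\<close> with law \<open>\<kappa>\<close>, giving a word \<open>z\<close>. On average over the points of \<open>{1..d}\<close> the law of
  the letters of \<open>z\<close> is close to that of a partition \<open>\<beta>\<close> of \<open>L\<close>, and the second code recovers
  \<open>\<alpha>(x)\<close> from \<open>z\<close> with few errors, because these are statements about expectations of local
  functions, which soficity transfers from \<open>\<eta> \<otimes> \<kappa>\<close>. So \<open>\<alpha>(x)\<close>, whose entropy is \<open>d H(\<alpha>)\<close>, can be
  described with about \<open>d H(\<beta>) \<le> d H(\<nu>)\<close> nats, contradicting Gibbs' inequality. Only first moments
  are needed; no microstates are counted.
\<close>


section \<open>Entropy as a supremum over finite partitions\<close>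

text \<open>The letters of the word \<open>z\<close> are dependent, yet it is charged by the product
  of single-letter laws: by linearity of expectation such a product code costs d times a one-letter
  cross-entropy, whatever the joint law of the letters. That is why first moments are enough.
  Logarithms of tiny probabilities would break this, so every law used for coding is mixed with a
  uniform one, and the rare errors of the two codes then cost a bounded amount. That the conjugacy
  covers the identity of the factor enters through the second code. At a point q of the finite model
  there is a single set, the stabilizer of q under \<sigma>, and it has to serve both as stabilizer
  of the coloured point and as stabilizer of its image. A further obstacle is that this set need not
  be a subgroup, so it may have no counterpart in the support of \<eta>. Since costs are
  non-negative and bounded and only an upper bound for their mean is wanted, such points can be
  charged the maximal cost. The argument yields one inequality between the entropies; the inverse of
  the conjugacy yields the other.\<close>

definition surprisal :: "real \<Rightarrow> ennreal" where
  "surprisal p = (if p = 0 then \<infinity> else ennreal (- ln p))"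

lemma surprisal_antimono: "0 \<le> p \<Longrightarrow> p \<le> q \<Longrightarrow> surprisal q \<le> surprisal p"
  by (auto simp: surprisal_def intro!: ennreal_leI)

text \<open>Continuity at 0, where the value is infinite, is the point: it makes partitions whose
  cells shrink to a non-atom detect infinite entropy.\<close>

lemma tendsto_surprisal:
  assumes "m \<longlonglongrightarrow> p" and "\<And>n. 0 \<le> m n"
  shows "(\<lambda>n. surprisal (m n)) \<longlonglongrightarrow> surprisal p"
proof (cases "p = 0")
  case True
  have "\<forall>\<^sub>F n in sequentially. ennreal r < surprisal (m n)" if "r \<ge> 0" for r
  proof -
    have "\<forall>\<^sub>F n in sequentially. m n < exp (- (r + 1))"
      using order_tendstoD(2)[OF assms(1)] True by simp
    then show ?thesis
    proof eventually_elim
      case (elim n)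
      show ?case
      proof (cases "m n = 0")
        case False
        then have "0 < m n" using assms(2)[of n] by simp
        then have "ln (m n) < - (r + 1)" using elim by (metis ln_exp ln_less_cancel_iff exp_gt_zero)
        then show ?thesis using False that by (simp add: surprisal_def ennreal_less_iff)
      qed (simp add: surprisal_def)
    qed
  qed
  then show ?thesis using True
    by (simp add: surprisal_def tendsto_top_iff_ennreal)
next
  case False
  then have p: "0 < p" using LIMSEQ_le_const[OF assms(1), of 0] assms(2) by force
  have "(\<lambda>n. ennreal (- ln (m n))) \<longlonglongrightarrow> ennreal (- ln p)"
    using assms(1) p by (intro tendsto_ennrealI tendsto_minus tendsto_ln) auto
  moreover have "\<forall>\<^sub>F n in sequentially. m n > 0" using order_tendstoD(1)[OF assms(1) p] .
  then have "\<forall>\<^sub>F n in sequentially. ennreal (- ln (m n)) = surprisal (m n)"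
    by eventually_elim (simp add: surprisal_def)
  ultimately show ?thesis using p Lim_transform_eventually by (fastforce simp: surprisal_def)
qed

lemma infsum_eq_nn_integral_count_space:
  fixes f :: "'a \<Rightarrow> ennreal"
  assumes "countable A"
  shows "(\<Sum>\<^sub>\<infinity>x\<in>A. f x) = (\<integral>\<^sup>+x. f x \<partial>count_space A)"
proof (cases "finite A")
  case True
  then show ?thesis by (simp add: nn_integral_count_space_finite)
next
  case False
  then have b: "bij_betw (from_nat_into A) UNIV A"
    using assms by (intro bij_betw_from_nat_into)
  have "(\<Sum>\<^sub>\<infinity>x\<in>A. f x) = (\<Sum>\<^sub>\<infinity>n. f (from_nat_into A n))"
    using infsum_reindex_bij_betw[OF b, of f] by simp
  also have "\<dots> = (\<Sum>n. f (from_nat_into A n))"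
    by (intro sums_unique has_sum_imp_sums has_sum_infsum) (rule nonneg_summable_on_complete, simp)
  also have "\<dots> = (\<integral>\<^sup>+n. f (from_nat_into A n) \<partial>count_space UNIV)"
    by (simp add: nn_integral_count_space_nat)
  also have "\<dots> = (\<integral>\<^sup>+x. f x \<partial>count_space A)"
    by (rule nn_integral_bij_count_space[OF b])
  finally show ?thesis .
qed

lemma standard_borel_separating_sequence:
  assumes "standard_borel_space M"
  obtains U :: "nat \<Rightarrow> 'a set" where "\<And>n. U n \<in> sets M"
    "\<And>x y. x \<in> space M \<Longrightarrow> y \<in> space M \<Longrightarrow> x \<noteq> y \<Longrightarrow> \<exists>n. (x \<in> U n) \<noteq> (y \<in> U n)"
proof -
  obtain X where X: "completely_metrizable_space X" "second_countable X"
    and sM: "space M = topspace X" "sets M = sets (borel_of X)"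
    using assms by (auto simp: standard_borel_space_def)
  obtain B where B: "countable B" "\<And>V. V \<in> B \<Longrightarrow> openin X V"
    "\<And>U x. openin X U \<Longrightarrow> x \<in> U \<Longrightarrow> \<exists>V\<in>B. x \<in> V \<and> V \<subseteq> U"
    using X(2) unfolding second_countable_def by metis
  have H: "Hausdorff_space X"
    using X(1) completely_metrizable_imp_metrizable_space metrizable_imp_Hausdorff_space by blast
  \<comment> \<open>The added \<open>{}\<close> makes the enumerated set non-empty, so that
    \<open>from_nat_into\<close> has exactly this range even if \<open>B\<close> is empty; it does
    not affect separation.\<close>
  define U where "U = from_nat_into (insert {} B)"
  have rU: "range U = insert {} B" unfolding U_def using B(1) by (intro range_from_nat_into) auto
  show thesis
  proof
    fix n
    have "U n \<in> insert {} B" using rU by blast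
    then show "U n \<in> sets M" using B(2) sM(2) open_in_borel_of by fastforce
  next
    fix x y assume xy: "x \<in> space M" "y \<in> space M" "x \<noteq> y"
    then obtain V W where "openin X V" "openin X W" "x \<in> V" "y \<in> W" "disjnt V W"
      using H sM(1) unfolding Hausdorff_space_def by metis
    then obtain Z where "Z \<in> B" "x \<in> Z" "y \<notin> Z" using B(3)[of V x] by (auto simp: disjnt_def)
    then show "\<exists>n. (x \<in> U n) \<noteq> (y \<in> U n)" using rU by (metis insertCI rangeE)
  qed
qed

lemma standard_borel_singleton:
  assumes "standard_borel_space M" "x \<in> space M"
  shows "{x} \<in> sets M"
proof -
  obtain U :: "nat \<Rightarrow> 'a set" where U: "\<And>n. U n \<in> sets M"
    "\<And>x y. x \<in> space M \<Longrightarrow> y \<in> space M \<Longrightarrow> x \<noteq> y \<Longrightarrow> \<exists>n. (x \<in> U n) \<noteq> (y \<in> U n)"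
    using standard_borel_separating_sequence[OF assms(1)] by blast
  have "{x} = (\<Inter>n. if x \<in> U n then U n else space M - U n)"
  proof (intro equalityI subsetI)
    fix y assume y: "y \<in> (\<Inter>n. if x \<in> U n then U n else space M - U n)"
    then have yn: "y \<in> (if x \<in> U n then U n else space M - U n)" for n by blast
    have "y \<in> space M"
      using yn[of 0] sets.sets_into_space[OF U(1)[of 0]] by (auto split: if_splits)
    moreover have "(x \<in> U n) = (y \<in> U n)" for n using yn[of n] by (auto split: if_splits)
    ultimately show "y \<in> {x}" using U(2)[of x y] assms(2) by blast
  qed (use assms(2) in auto)
  also have "\<dots> \<in> sets M" using U(1) by (intro sets.countable_INT) auto
  finally show ?thesis .
qed

text \<open>An atom of mass p contributes p times its surprisal, and every other point has infinite
  surprisal, so the two cases in the definition of entropy become one integral. In this form entropy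
  can be compared with finite partitions point by point.\<close>

lemma Shannon_entropy_eq_nn_integral:
  assumes "standard_prob_space \<mu>"
  shows "Shannon_entropy \<mu> = (\<integral>\<^sup>+x. surprisal (measure \<mu> {x}) \<partial>\<mu>)"
proof -
  interpret prob_space \<mu> using assms by (simp add: standard_prob_space_def)
  have sing: "{x} \<in> sets \<mu>" if "x \<in> space \<mu>" for x
    using assms standard_borel_singleton that by (auto simp: standard_prob_space_def)
  define D where "D = {x \<in> space \<mu>. measure \<mu> {x} \<noteq> 0}"
  have D: "countable D" using countable_support by (rule countable_subset[rotated]) (auto simp: D_def)
  have mD: "D \<in> sets \<mu>" using D sing by (rule sets.countable[rotated]) (auto simp: D_def)
  \<comment> \<open>Off the countable set \<open>D\<close> of atoms the function is constantly
    \<open>surprisal 0\<close>.\<close>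
  have meas [measurable]: "(\<lambda>x. surprisal (measure \<mu> {x})) \<in> borel_measurable \<mu>"
    by (rule measurable_discrete_difference[of "\<lambda>_. surprisal 0" _ _ D])
       (use D sing in \<open>auto simp: D_def\<close>)
  show ?thesis
  proof (cases "\<exists>K'. countable K' \<and> K' \<subseteq> space \<mu> \<and> measure \<mu> K' = 1")
    case True
    then obtain K' where K: "countable K'" "K' \<subseteq> space \<mu>" "measure \<mu> K' = 1" by blast
    have mK: "K' \<in> sets \<mu>" by (rule sets.countable[OF _ K(1)]) (use K sing in auto)
    have AEK: "AE x in \<mu>. x \<in> K'" using K mK by (simp add: prob_eq_1)
    have "Shannon_entropy \<mu> = (\<Sum>\<^sub>\<infinity>k\<in>K'. ennreal (- (measure \<mu> {k} * ln (measure \<mu> {k}))))"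
      by (rule Shannon_entropy_eq) (use K prob_space_axioms in auto)
    also have "\<dots> = (\<integral>\<^sup>+k. ennreal (- (measure \<mu> {k} * ln (measure \<mu> {k}))) \<partial>count_space K')"
      by (rule infsum_eq_nn_integral_count_space[OF K(1)])
    \<comment> \<open>Each summand is the integral of a constant over the atom \<open>{k}\<close>;
      after exchanging sum and integral only the term k = x survives at x.\<close>
    also have "\<dots> = (\<integral>\<^sup>+k. \<integral>\<^sup>+x. surprisal (measure \<mu> {k}) * indicator {k} x \<partial>\<mu> \<partial>count_space K')"
    proof (rule nn_integral_cong)
      fix k assume "k \<in> space (count_space K')"
      then have [simp]: "{k} \<in> sets \<mu>" using K sing by auto
      have l: "ln (measure \<mu> {k}) \<le> 0" by (cases "measure \<mu> {k} = 0") (auto simp: ln_le_zero_iff measure_le_0_iff less_le)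
      show "ennreal (- (measure \<mu> {k} * ln (measure \<mu> {k}))) =
          (\<integral>\<^sup>+x. surprisal (measure \<mu> {k}) * indicator {k} x \<partial>\<mu>)"
        using l by (subst nn_integral_cmult_indicator)
          (auto simp: surprisal_def emeasure_eq_measure ennreal_mult''[symmetric] mult.commute)
    qed
    also have "\<dots> = (\<integral>\<^sup>+x. \<integral>\<^sup>+k. surprisal (measure \<mu> {k}) * indicator {k} x \<partial>count_space K' \<partial>\<mu>)"
      by (rule nn_integral_count_space_nn_integral[symmetric]) (use K sing in \<open>auto intro!: borel_measurable_times_ennreal\<close>)
    also have "\<dots> = (\<integral>\<^sup>+x. surprisal (measure \<mu> {x}) \<partial>\<mu>)"
    proof (rule nn_integral_cong_AE, use AEK in eventually_elim)
      fix x assume x: "x \<in> K'"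
      have "(\<integral>\<^sup>+k. surprisal (measure \<mu> {k}) * indicator {k} x \<partial>count_space K')
          = (\<integral>\<^sup>+k. surprisal (measure \<mu> {x}) * indicator {x} k \<partial>count_space K')"
        by (rule nn_integral_cong) (simp split: split_indicator)
      then show "(\<integral>\<^sup>+k. surprisal (measure \<mu> {k}) * indicator {k} x \<partial>count_space K') = surprisal (measure \<mu> {x})"
        using x by (simp add: nn_integral_cmult_indicator)
    qed
    finally show ?thesis .
  next
    case False
    \<comment> \<open>\<open>D\<close> is itself a countable candidate for \<open>K'\<close>, so it
      cannot have full measure; on its complement the surprisal is infinite.\<close>
    then have "measure \<mu> D \<noteq> 1" using D by (auto simp: D_def)
    then have "emeasure \<mu> (space \<mu> - D) \<noteq> 0"
      using mD by (simp add: prob_compl emeasure_eq_measure)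
    moreover have "\<infinity> * emeasure \<mu> (space \<mu> - D) = (\<integral>\<^sup>+x. \<infinity> * indicator (space \<mu> - D) x \<partial>\<mu>)"
      using mD by (subst nn_integral_cmult_indicator) auto
    moreover have "\<dots> \<le> (\<integral>\<^sup>+x. surprisal (measure \<mu> {x}) \<partial>\<mu>)"
      by (rule nn_integral_mono) (auto simp: D_def surprisal_def split: split_indicator)
    ultimately have "(\<integral>\<^sup>+x. surprisal (measure \<mu> {x}) \<partial>\<mu>) = \<infinity>"
      by (simp add: ennreal_top_mult top_unique split: if_splits)
    then show ?thesis using False by (auto simp: Shannon_entropy_def)
  qed
qed

definition cell_measure :: "'a measure \<Rightarrow> ('a \<Rightarrow> nat) \<Rightarrow> nat \<Rightarrow> real" where
  "cell_measure \<mu> \<alpha> k = measure \<mu> {y \<in> space \<mu>. \<alpha> y = k}"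

definition partition_entropy :: "'a measure \<Rightarrow> ('a \<Rightarrow> nat) \<Rightarrow> real" where
  "partition_entropy \<mu> \<alpha> = (\<integral>x. - ln (cell_measure \<mu> \<alpha> (\<alpha> x)) \<partial>\<mu>)"

lemma cell_measure_le_1: "prob_space \<mu> \<Longrightarrow> cell_measure \<mu> \<alpha> k \<le> 1"
  by (simp add: cell_measure_def prob_space.prob_le_1)

lemma ln_prob_le_0: "0 \<le> p \<Longrightarrow> p \<le> 1 \<Longrightarrow> ln p \<le> (0::real)"
  by (cases "p = 0") auto

context
  fixes \<mu> :: "'a measure" and \<alpha> :: "'a \<Rightarrow> nat" and n :: nat
  assumes P: "prob_space \<mu>"
    and \<alpha> [measurable]: "\<alpha> \<in> \<mu> \<rightarrow>\<^sub>M count_space UNIV"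
    and bound: "\<And>x. x \<in> space \<mu> \<Longrightarrow> \<alpha> x < n"
begin

interpretation prob_space \<mu> by (rule P)

text \<open>There are finitely many cells, so the null ones together form a null set. This makes the
  convention \<open>ln 0 = 0\<close> harmless in \<open>partition_entropy\<close>.\<close>

lemma AE_cell_measure_pos: "AE x in \<mu>. cell_measure \<mu> \<alpha> (\<alpha> x) > 0"
proof -
  have "AE x in \<mu>. \<forall>k\<in>{k. k < n \<and> cell_measure \<mu> \<alpha> k = 0}. \<alpha> x \<noteq> k"
  proof (rule AE_ball_countable')
    fix k assume k: "k \<in> {k. k < n \<and> cell_measure \<mu> \<alpha> k = 0}"
    then show "AE x in \<mu>. \<alpha> x \<noteq> k"
      by (intro AE_I[of _ _ "{y \<in> space \<mu>. \<alpha> y = k}"])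
         (auto simp: cell_measure_def emeasure_eq_measure)
  qed (auto intro: countable_finite)
  then have "AE x in \<mu>. cell_measure \<mu> \<alpha> (\<alpha> x) \<noteq> 0"
    using AE_space by eventually_elim (use bound in auto)
  then show ?thesis
    by eventually_elim (auto simp: cell_measure_def less_le)
qed

lemma integrable_comp_partition: "integrable \<mu> (\<lambda>x. f (\<alpha> x) :: real)"
proof (rule integrable_const_bound)
  show "AE x in \<mu>. norm (f (\<alpha> x)) \<le> (\<Sum>k<n. norm (f k))"
    using AE_space
    by eventually_elim (rule member_le_sum[of _ "{..<n}" "\<lambda>k. norm (f k)"], use bound in auto)
qed simp

lemma integral_comp_partition: "(\<integral>x. f (\<alpha> x) \<partial>\<mu>) = (\<Sum>k<n. f k * cell_measure \<mu> \<alpha> k)"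
proof -
  have "(\<integral>x. f (\<alpha> x) \<partial>\<mu>) = (\<integral>x. (\<Sum>k<n. f k * indicator {y \<in> space \<mu>. \<alpha> y = k} x) \<partial>\<mu>)"
  proof (rule Bochner_Integration.integral_cong[OF refl])
    fix x assume x: "x \<in> space \<mu>"
    have "(\<Sum>k<n. f k * indicator {y \<in> space \<mu>. \<alpha> y = k} x) = (\<Sum>k<n. if k = \<alpha> x then f k else 0)"
      by (rule sum.cong) (use x in \<open>auto simp: indicator_def\<close>)
    then show "f (\<alpha> x) = (\<Sum>k<n. f k * indicator {y \<in> space \<mu>. \<alpha> y = k} x)"
      using bound[OF x] by simp
  qed
  also have "\<dots> = (\<Sum>k<n. f k * cell_measure \<mu> \<alpha> k)"
    by (subst Bochner_Integration.integral_sum) (auto simp: cell_measure_def emeasure_eq_measure intro!: integrable_mult_right integrable_real_indicator)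
  finally show ?thesis .
qed

lemma ennreal_partition_entropy:
  "ennreal (partition_entropy \<mu> \<alpha>) = (\<integral>\<^sup>+x. surprisal (cell_measure \<mu> \<alpha> (\<alpha> x)) \<partial>\<mu>)"
proof -
  have "(\<integral>\<^sup>+x. surprisal (cell_measure \<mu> \<alpha> (\<alpha> x)) \<partial>\<mu>) = (\<integral>\<^sup>+x. ennreal (- ln (cell_measure \<mu> \<alpha> (\<alpha> x))) \<partial>\<mu>)"
    by (rule nn_integral_cong_AE, use AE_cell_measure_pos in eventually_elim) (simp add: surprisal_def)
  also have "\<dots> = ennreal (partition_entropy \<mu> \<alpha>)"
    unfolding partition_entropy_def
    by (rule nn_integral_eq_integral[OF integrable_comp_partition])
       (auto intro!: ln_prob_le_0 cell_measure_le_1 P simp: cell_measure_def)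
  finally show ?thesis by simp
qed

text \<open>Pointwise comparison: the cell containing x has at least the mass of \<open>{x}\<close>,
  and surprisal decreases with mass.\<close>

lemma partition_entropy_le_Shannon:
  assumes "standard_prob_space \<mu>"
  shows "ennreal (partition_entropy \<mu> \<alpha>) \<le> Shannon_entropy \<mu>"
  unfolding ennreal_partition_entropy Shannon_entropy_eq_nn_integral[OF assms]
  by (rule nn_integral_mono) (auto simp: cell_measure_def intro!: surprisal_antimono finite_measure_mono)

end

text \<open>The partitions generated by the first n sets of a separating sequence refine each other
  and their cells decrease to points. So the surprisal of the cell of x increases to that of
  \<open>{x}\<close>, and monotone convergence gives entropies of finite partitions tending to the
  Shannon entropy.\<close>

lemma Shannon_less_partition_entropy:
  fixes \<mu> :: "'a measure"
  assumes S: "standard_prob_space \<mu>" and c: "c < Shannon_entropy \<mu>"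
  obtains \<alpha> :: "'a \<Rightarrow> nat" and n where "\<alpha> \<in> \<mu> \<rightarrow>\<^sub>M count_space UNIV"
    "\<And>x. x \<in> space \<mu> \<Longrightarrow> \<alpha> x < n" "c < ennreal (partition_entropy \<mu> \<alpha>)"
proof -
  have P: "prob_space \<mu>" using S by (simp add: standard_prob_space_def)
  interpret prob_space \<mu> by (rule P)
  have B: "standard_borel_space \<mu>" using S by (simp add: standard_prob_space_def)
  obtain U :: "nat \<Rightarrow> 'a set" where U [measurable]: "\<And>n. U n \<in> sets \<mu>"
    and sep: "\<And>x y. x \<in> space \<mu> \<Longrightarrow> y \<in> space \<mu> \<Longrightarrow> x \<noteq> y \<Longrightarrow> \<exists>n. (x \<in> U n) \<noteq> (y \<in> U n)"
    using standard_borel_separating_sequence[OF B] by blast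
  \<comment> \<open>The first n membership bits of x are read as a binary number, so equal labels
    mean equal membership in the first n sets.\<close>
  define \<alpha> where "\<alpha> n x = (\<Sum>i<n. if x \<in> U i then 2 ^ i else 0 :: nat)" for n x
  have \<alpha> [measurable]: "\<alpha> n \<in> \<mu> \<rightarrow>\<^sub>M count_space UNIV" for n
    unfolding \<alpha>_def by measurable
  have \<alpha>_enc: "\<alpha> n x = set_encode {i. i < n \<and> x \<in> U i}" for n x
    unfolding \<alpha>_def set_encode_def by (subst sum.inter_filter[symmetric]) (auto simp: lessThan_def)
  have \<alpha>_eq: "\<alpha> n x = \<alpha> n y \<longleftrightarrow> (\<forall>i<n. (x \<in> U i) = (y \<in> U i))" for n x y
    unfolding \<alpha>_enc by (subst set_encode_eq) auto
  have bd: "\<alpha> n x < Suc (\<Sum>i<n. 2 ^ i)" for n x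
    unfolding \<alpha>_def less_Suc_eq_le by (rule sum_mono) auto
  let ?C = "\<lambda>n x. cell_measure \<mu> (\<alpha> n) (\<alpha> n x)"
  have lim: "(\<lambda>n. surprisal (?C n x)) \<longlonglongrightarrow> surprisal (measure \<mu> {x})" if x: "x \<in> space \<mu>" for x
  proof (rule tendsto_surprisal)
    have "(\<lambda>n. measure \<mu> {y \<in> space \<mu>. \<alpha> n y = \<alpha> n x}) \<longlonglongrightarrow> measure \<mu> (\<Inter>n. {y \<in> space \<mu>. \<alpha> n y = \<alpha> n x})"
      by (rule finite_Lim_measure_decseq) (auto simp: decseq_def \<alpha>_eq)
    also have "(\<Inter>n. {y \<in> space \<mu>. \<alpha> n y = \<alpha> n x}) = {x}"
    proof (intro equalityI subsetI)
      fix y assume "y \<in> (\<Inter>n. {y \<in> space \<mu>. \<alpha> n y = \<alpha> n x})"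
      then have "y \<in> space \<mu>" "\<And>n. \<forall>i<n. (y \<in> U i) = (x \<in> U i)" by (auto simp: \<alpha>_eq)
      then show "y \<in> {x}" using sep[of x y] x by blast
    qed (use x in auto)
    finally show "(\<lambda>n. ?C n x) \<longlonglongrightarrow> measure \<mu> {x}" by (simp add: cell_measure_def)
  qed (simp add: cell_measure_def)
  have inc: "incseq (\<lambda>n. surprisal (?C n x))" for x
    by (intro incseq_SucI surprisal_antimono) (auto simp: cell_measure_def \<alpha>_eq intro!: finite_measure_mono)
  have "Shannon_entropy \<mu> = (\<integral>\<^sup>+x. (SUP n. surprisal (?C n x)) \<partial>\<mu>)"
    unfolding Shannon_entropy_eq_nn_integral[OF S]
    by (rule nn_integral_cong) (use lim LIMSEQ_SUP[OF inc] in \<open>blast intro: LIMSEQ_unique\<close>)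
  also have "\<dots> = (SUP n. \<integral>\<^sup>+x. surprisal (?C n x) \<partial>\<mu>)"
    using inc by (intro nn_integral_monotone_convergence_SUP) (auto simp: incseq_def le_fun_def)
  finally obtain n where "c < (\<integral>\<^sup>+x. surprisal (?C n x) \<partial>\<mu>)" using c by (auto simp: less_SUP_iff)
  then have "c < ennreal (partition_entropy \<mu> (\<alpha> n))"
    using ennreal_partition_entropy[OF P \<alpha> bd] by simp
  then show thesis using that \<alpha> bd by blast
qed

section \<open>A coding bound for i.i.d. colourings\<close>

lemma (in finite_measure) integrable_finite_range:
  fixes f :: "'a \<Rightarrow> real"
  assumes "f \<in> borel_measurable M" "finite (f ` space M)"
  shows "integrable M f"
proof (rule integrable_const_bound)
  show "AE x in M. norm (f x) \<le> (\<Sum>y\<in>f ` space M. norm y)"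
    using AE_space by eventually_elim (rule member_le_sum[where f=norm], use assms in auto)
qed (rule assms)

lemma PiM_AE_component:
  assumes "prob_space \<kappa>" "i \<in> I" "AE y in \<kappa>. Q y"
  shows "AE x in (\<Pi>\<^sub>M i\<in>I. \<kappa>). Q (x i)"
  using AE_PiM_component[of I "\<lambda>_. \<kappa>" i Q] assms by simp

lemma PiM_integral_component:
  fixes f :: "'a \<Rightarrow> real"
  assumes "prob_space \<kappa>" "i \<in> I" and [measurable]: "f \<in> borel_measurable \<kappa>"
  shows "(\<integral>x. f (x i) \<partial>(\<Pi>\<^sub>M i\<in>I. \<kappa>)) = (\<integral>y. f y \<partial>\<kappa>)"
proof -
  have "(\<integral>y. f y \<partial>\<kappa>) = (\<integral>y. f y \<partial>distr (\<Pi>\<^sub>M i\<in>I. \<kappa>) \<kappa> (\<lambda>x. x i))"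
    using distr_PiM_component[of I "\<lambda>_. \<kappa>" i] assms by simp
  also have "\<dots> = (\<integral>x. f (x i) \<partial>(\<Pi>\<^sub>M i\<in>I. \<kappa>))"
    using assms(2) by (intro integral_distr) auto
  finally show ?thesis by simp
qed

text \<open>Gibbs' inequality for the law of \<open>\<alpha>(x)\<close> against the marginal \<open>\<Sum>\<^sub>z Q(a, z)\<close> of
  \<open>Q(a, z) = \<Prod>\<^sub>q r(z\<^sub>q) w(a\<^sub>q | \<Phi>(z)\<^sub>q)\<close>; the single summand \<open>Q(\<alpha>(x), z(x))\<close> bounds the marginal
  from below.\<close>

lemma coding_bound_iid:
  fixes \<kappa> :: "'k measure" and \<alpha> :: "'k \<Rightarrow> nat" and z :: "('i \<Rightarrow> 'k) \<Rightarrow> 'i \<Rightarrow> nat"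
    and r :: "nat \<Rightarrow> real" and w :: "nat \<Rightarrow> nat \<Rightarrow> real" and \<Phi> :: "('i \<Rightarrow> nat) \<Rightarrow> 'i \<Rightarrow> nat"
  assumes P: "prob_space \<kappa>" and I: "finite I"
    and \<alpha> [measurable]: "\<alpha> \<in> \<kappa> \<rightarrow>\<^sub>M count_space UNIV"
    and bound: "\<And>y. y \<in> space \<kappa> \<Longrightarrow> \<alpha> y < n"
    and z: "\<And>q. q \<in> I \<Longrightarrow> (\<lambda>x. z x q) \<in> (\<Pi>\<^sub>M i\<in>I. \<kappa>) \<rightarrow>\<^sub>M count_space UNIV"
    and zm: "\<And>x q. x \<in> space (\<Pi>\<^sub>M i\<in>I. \<kappa>) \<Longrightarrow> q \<in> I \<Longrightarrow> z x q < m"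
    and r: "\<And>b. b < m \<Longrightarrow> 0 < r b" "(\<Sum>b<m. r b) = 1"
    and w: "\<And>a c. a < n \<Longrightarrow> 0 < w a c" "\<And>c. (\<Sum>a<n. w a c) \<le> 1"
  shows "real (card I) * partition_entropy \<kappa> \<alpha> \<le>
    (\<Sum>q\<in>I. \<integral>x. - ln (r (z x q)) - ln (w (\<alpha> (x q)) (\<Phi> (restrict (z x) I) q)) \<partial>(\<Pi>\<^sub>M i\<in>I. \<kappa>))"
proof -
  let ?P = "\<Pi>\<^sub>M i\<in>I. \<kappa>"
  let ?Z = "I \<rightarrow>\<^sub>E {..<m}"
  let ?p = "cell_measure \<kappa> \<alpha>"
  interpret \<kappa>: prob_space \<kappa> by (rule P)
  interpret PP: product_prob_space "\<lambda>_. \<kappa>" I by unfold_locales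
  have PS: "prob_space ?P" by (rule prob_space_PiM) (rule P)
  then have FM: "finite_measure ?P" by (simp add: prob_space_def)
  have finZ: "finite ?Z" using I by (intro finite_PiE) auto
  \<comment> \<open>Restricted to \<open>I\<close>, the word takes values in the finite set
    \<open>?Z\<close>, so every function of it and of one label is measurable with finite
    range.\<close>
  define zz where "zz x = restrict (z x) I" for x
  have zzZ: "zz x \<in> ?Z" if "x \<in> space ?P" for x using zm that by (auto simp: zz_def)
  have zz_meas [measurable]: "zz \<in> ?P \<rightarrow>\<^sub>M count_space ?Z"
  proof (subst measurable_count_space_eq2[OF finZ], intro conjI ballI)
    fix b assume b: "b \<in> ?Z"
    have "zz -` {b} \<inter> space ?P = {x \<in> space ?P. \<forall>q\<in>I. z x q = b q}"
      using b by (auto simp: zz_def fun_eq_iff restrict_def PiE_def extensional_def)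
    also have "\<dots> \<in> sets ?P"
      by (rule sets.sets_Collect_finite_All[OF _ I]) (use z in \<open>auto intro!: measurable_sets_Collect\<close>)
    finally show "zz -` {b} \<inter> space ?P \<in> sets ?P" .
  qed (use zzZ in auto)
  have coord [measurable]: "(\<lambda>x. \<alpha> (x q)) \<in> ?P \<rightarrow>\<^sub>M count_space UNIV" if "q \<in> I" for q
    using that by measurable
  have coordn: "\<alpha> (x q) < n" if "x \<in> space ?P" "q \<in> I" for x q
    using that by (intro bound) (auto simp: space_PiM)
  define c where "c q b a = - ln (r (b q)) - ln (w a (\<Phi> b q))" for q b a
  have meas2: "(\<lambda>x. F (zz x) (\<alpha> (x q))) \<in> borel_measurable ?P" if "q \<in> I"
    for q and F :: "('i \<Rightarrow> nat) \<Rightarrow> nat \<Rightarrow> real"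
    by (rule measurable_compose_countable'[OF _ zz_meas countable_finite[OF finZ]])
       (use that in measurable)
  have fin2: "finite ((\<lambda>x. F (zz x) (\<alpha> (x q))) ` space ?P)" if "q \<in> I"
    for q and F :: "('i \<Rightarrow> nat) \<Rightarrow> nat \<Rightarrow> real"
  proof (rule finite_subset)
    show "(\<lambda>x. F (zz x) (\<alpha> (x q))) ` space ?P \<subseteq> (\<lambda>p. F (fst p) (snd p)) ` (?Z \<times> {..<n})"
    proof
      fix t assume "t \<in> (\<lambda>x. F (zz x) (\<alpha> (x q))) ` space ?P"
      then obtain x where "x \<in> space ?P" "t = F (zz x) (\<alpha> (x q))" by blast
      then show "t \<in> (\<lambda>p. F (fst p) (snd p)) ` (?Z \<times> {..<n})"
        using zzZ coordn that by (intro image_eqI[of _ _ "(zz x, \<alpha> (x q))"]) auto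
    qed
  qed (use finZ in simp)
  have int2: "integrable ?P (\<lambda>x. F (zz x) (\<alpha> (x q)))" if "q \<in> I"
    for q and F :: "('i \<Rightarrow> nat) \<Rightarrow> nat \<Rightarrow> real"
    by (rule finite_measure.integrable_finite_range[OF FM meas2[OF that] fin2[OF that]])
  \<comment> \<open>This is the likelihood ratio between the marginal of Q and the true law of the
    labels. For a fixed word \<open>b\<close> the factors depend on different coordinates and
    integrate separately; the dependence of \<open>z\<close> on x enters only when the summand of
    the actual word is singled out.\<close>
  define L where "L x = (\<Sum>b\<in>?Z. \<Prod>q\<in>I. r (b q) * (w (\<alpha> (x q)) (\<Phi> b q) / ?p (\<alpha> (x q))))" for x
  have intf: "integrable \<kappa> (\<lambda>y. f (\<alpha> y) :: real)" for f
    by (rule integrable_comp_partition[OF P \<alpha> bound])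
  have intprod: "integrable ?P (\<lambda>x. \<Prod>q\<in>I. r (b q) * (w (\<alpha> (x q)) (\<Phi> b q) / ?p (\<alpha> (x q))))" for b
    by (rule PP.product_integrable_prod[OF I]) (rule intf)
  have "(\<integral>x. L x \<partial>?P) = (\<Sum>b\<in>?Z. \<Prod>q\<in>I. \<integral>y. r (b q) * (w (\<alpha> y) (\<Phi> b q) / ?p (\<alpha> y)) \<partial>\<kappa>)"
    unfolding L_def
    by (subst Bochner_Integration.integral_sum[OF intprod], rule sum.cong[OF refl],
        rule PP.product_integral_prod[OF I]) (rule intf)
  also have "\<dots> \<le> (\<Sum>b\<in>?Z. \<Prod>q\<in>I. r (b q))"
  proof (rule sum_mono, rule prod_mono)
    fix b q assume b: "b \<in> ?Z" and q: "q \<in> I"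
    have r0: "0 < r (b q)" using b q r(1) by auto
    have "(\<integral>y. r (b q) * (w (\<alpha> y) (\<Phi> b q) / ?p (\<alpha> y)) \<partial>\<kappa>)
        = (\<Sum>a<n. r (b q) * (w a (\<Phi> b q) / ?p a) * ?p a)"
      by (rule integral_comp_partition[OF P \<alpha> bound])
    \<comment> \<open>Only an inequality: for a null cell division by zero gives 0, and the term on
      the left disappears.\<close>
    also have "\<dots> \<le> (\<Sum>a<n. r (b q) * w a (\<Phi> b q))"
      using r0 w(1) by (intro sum_mono) (auto intro!: less_imp_le mult_pos_pos)
    also have "\<dots> = r (b q) * (\<Sum>a<n. w a (\<Phi> b q))" by (simp add: sum_distrib_left)
    also have "\<dots> \<le> r (b q)" using w(2)[of "\<Phi> b q"] r0 by (simp add: mult_left_le)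
    finally have "(\<integral>y. r (b q) * (w (\<alpha> y) (\<Phi> b q) / ?p (\<alpha> y)) \<partial>\<kappa>) \<le> r (b q)" .
    moreover have "0 \<le> (\<integral>y. r (b q) * (w (\<alpha> y) (\<Phi> b q) / ?p (\<alpha> y)) \<partial>\<kappa>)"
      using r0 w(1)[THEN less_imp_le] bound by (intro Bochner_Integration.integral_nonneg)
        (auto intro!: mult_nonneg_nonneg divide_nonneg_nonneg simp: cell_measure_def)
    ultimately show "0 \<le> (\<integral>y. r (b q) * (w (\<alpha> y) (\<Phi> b q) / ?p (\<alpha> y)) \<partial>\<kappa>) \<and>
      (\<integral>y. r (b q) * (w (\<alpha> y) (\<Phi> b q) / ?p (\<alpha> y)) \<partial>\<kappa>) \<le> r (b q)" by simp
  qed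
  also have "\<dots> = (\<Prod>q\<in>I. \<Sum>b<m. r b)"
    by (rule prod_sum_PiE[symmetric]) (use I in auto)
  also have "\<dots> = 1" using r(2) by simp
  finally have L1: "(\<integral>x. L x \<partial>?P) \<le> 1" .
  have Lint: "integrable ?P L"
    unfolding L_def[abs_def] by (rule Bochner_Integration.integrable_sum) (rule intprod)
  have pos: "AE x in ?P. \<forall>q\<in>I. 0 < ?p (\<alpha> (x q))"
    by (rule AE_ball_countable'[OF PiM_AE_component[OF P _ AE_cell_measure_pos[OF P \<alpha> bound]]])
       (use I in \<open>auto intro: countable_finite\<close>)
  have "AE x in ?P. (\<Sum>q\<in>I. - c q (zz x) (\<alpha> (x q)) - ln (?p (\<alpha> (x q)))) \<le> L x - 1"
    using pos AE_space
  proof eventually_elim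
    case (elim x)
    let ?f = "\<lambda>b q. r (b q) * (w (\<alpha> (x q)) (\<Phi> b q) / ?p (\<alpha> (x q)))"
    have fpos: "0 < ?f b q" if "b \<in> ?Z" "q \<in> I" for b q
      using that elim r(1) w(1) coordn by (intro mult_pos_pos divide_pos_pos) auto
    have "(\<Sum>q\<in>I. - c q (zz x) (\<alpha> (x q)) - ln (?p (\<alpha> (x q)))) = (\<Sum>q\<in>I. ln (?f (zz x) q))"
    proof (rule sum.cong[OF refl])
      fix q assume q: "q \<in> I"
      have "0 < r (zz x q)" using r(1) zzZ[OF elim(2)] q by auto
      moreover have "0 < w (\<alpha> (x q)) (\<Phi> (zz x) q)" using w(1) coordn elim q by auto
      moreover have "0 < ?p (\<alpha> (x q))" using elim q by auto
      ultimately show "- c q (zz x) (\<alpha> (x q)) - ln (?p (\<alpha> (x q))) = ln (?f (zz x) q)"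
        by (simp add: c_def ln_mult ln_div)
    qed
    also have "\<dots> = ln (\<Prod>q\<in>I. ?f (zz x) q)"
      by (rule ln_prod[symmetric]) (use I fpos[OF zzZ[OF elim(2)]] in force)+
    also have "\<dots> \<le> (\<Prod>q\<in>I. ?f (zz x) q) - 1"
      by (rule ln_le_minus_one, rule prod_pos, rule fpos[OF zzZ[OF elim(2)]])
    also have "(\<Prod>q\<in>I. ?f (zz x) q) \<le> L x"
      unfolding L_def
      by (rule member_le_sum[where f = "\<lambda>b. \<Prod>q\<in>I. ?f b q"])
         (rule zzZ[OF elim(2)], rule prod_nonneg, rule less_imp_le, rule fpos, use finZ in auto)
    finally show ?case by simp
  qed
  note AEL = this
  have intq: "integrable ?P (\<lambda>x. - c q (zz x) (\<alpha> (x q)) - ln (?p (\<alpha> (x q))))" if "q \<in> I" for q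
    using int2[OF that, of "\<lambda>b a. - c q b a - ln (?p a)"] .
  have "(\<integral>x. (\<Sum>q\<in>I. - c q (zz x) (\<alpha> (x q)) - ln (?p (\<alpha> (x q)))) \<partial>?P) \<le> (\<integral>x. L x - 1 \<partial>?P)"
  proof (rule integral_mono_AE[OF _ _ AEL])
    show "integrable ?P (\<lambda>x. \<Sum>q\<in>I. - c q (zz x) (\<alpha> (x q)) - ln (?p (\<alpha> (x q))))"
      by (rule Bochner_Integration.integrable_sum) (rule intq)
    show "integrable ?P (\<lambda>x. L x - 1)"
      using Lint FM by (simp add: finite_measure.integrable_const)
  qed
  also have "\<dots> \<le> 0" using L1 Lint FM by (simp add: prob_space.prob_space[OF PS] finite_measure.integrable_const)
  also have "(\<integral>x. (\<Sum>q\<in>I. - c q (zz x) (\<alpha> (x q)) - ln (?p (\<alpha> (x q)))) \<partial>?P)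
      = (\<Sum>q\<in>I. \<integral>x. - c q (zz x) (\<alpha> (x q)) - ln (?p (\<alpha> (x q))) \<partial>?P)"
    by (rule Bochner_Integration.integral_sum) (rule intq)
  also have "\<dots> = (\<Sum>q\<in>I. - (\<integral>x. c q (zz x) (\<alpha> (x q)) \<partial>?P) + partition_entropy \<kappa> \<alpha>)"
  proof (rule sum.cong[OF refl])
    fix q assume q: "q \<in> I"
    have "(\<integral>x. - c q (zz x) (\<alpha> (x q)) - ln (?p (\<alpha> (x q))) \<partial>?P)
       = (\<integral>x. - ln (?p (\<alpha> (x q))) - c q (zz x) (\<alpha> (x q)) \<partial>?P)"
      by (rule Bochner_Integration.integral_cong) auto
    also have "\<dots> = (\<integral>x. - ln (?p (\<alpha> (x q))) \<partial>?P) - (\<integral>x. c q (zz x) (\<alpha> (x q)) \<partial>?P)"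
      by (rule Bochner_Integration.integral_diff)
         (rule int2[OF q, of "\<lambda>b a. - ln (?p a)"], rule int2[OF q, of "c q"])
    also have "(\<integral>x. - ln (?p (\<alpha> (x q))) \<partial>?P) = partition_entropy \<kappa> \<alpha>"
      unfolding partition_entropy_def by (rule PiM_integral_component[OF P q]) measurable
    finally show "(\<integral>x. - c q (zz x) (\<alpha> (x q)) - ln (?p (\<alpha> (x q))) \<partial>?P)
       = - (\<integral>x. c q (zz x) (\<alpha> (x q)) \<partial>?P) + partition_entropy \<kappa> \<alpha>" by simp
  qed
  also have "\<dots> = real (card I) * partition_entropy \<kappa> \<alpha> - (\<Sum>q\<in>I. \<integral>x. c q (zz x) (\<alpha> (x q)) \<partial>?P)"
    by (simp add: sum_subtractf)
  finally have "real (card I) * partition_entropy \<kappa> \<alpha> \<le> (\<Sum>q\<in>I. \<integral>x. c q (zz x) (\<alpha> (x q)) \<partial>?P)" by simp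
  also have "\<dots> = (\<Sum>q\<in>I. \<integral>x. - ln (r (z x q)) - ln (w (\<alpha> (x q)) (\<Phi> (restrict (z x) I) q)) \<partial>?P)"
    by (rule sum.cong[OF refl]) (simp add: c_def zz_def)
  finally show ?thesis .
qed

section \<open>The measure on the tensor product as a mixture of product measures\<close>

text \<open>A basic open box constrains finitely many coordinates, and a constraint on two-valued
  coordinates is implied by prescribing the trace on a finite set. This replaces the product
  topology by cylinders in all later arguments.\<close>

lemma openin_subset_topology_iff:
  "openin (subset_topology G) U \<longleftrightarrow> U \<subseteq> Pow (carrier G) \<and>
     (\<forall>A\<in>U. \<exists>F. finite F \<and> F \<subseteq> carrier G \<and> (\<forall>B\<subseteq>carrier G. B \<inter> F = A \<inter> F \<longrightarrow> B \<in> U))"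
    (is "?l \<longleftrightarrow> ?r")
proof
  let ?T = "product_topology (\<lambda>_. discrete_topology (UNIV :: bool set)) (carrier G)"
  let ?i = "\<lambda>A. \<lambda>g\<in>carrier G. g \<in> A"
  assume ?l
  then obtain V where V: "openin ?T V" "U = ?i -` V \<inter> Pow (carrier G)"
    unfolding subset_topology_def openin_pullback_topology by blast
  have "\<exists>F. finite F \<and> F \<subseteq> carrier G \<and> (\<forall>B\<subseteq>carrier G. B \<inter> F = A \<inter> F \<longrightarrow> B \<in> U)"
    if A: "A \<in> U" for A
  proof -
    obtain W where W: "finite {i \<in> carrier G. W i \<noteq> UNIV}" "?i A \<in> Pi\<^sub>E (carrier G) W"
      "Pi\<^sub>E (carrier G) W \<subseteq> V"
      using V A unfolding openin_product_topology_alt by fastforce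
    let ?F = "{i \<in> carrier G. W i \<noteq> UNIV}"
    have "B \<in> U" if B: "B \<subseteq> carrier G" "B \<inter> ?F = A \<inter> ?F" for B
    proof -
      have "(g \<in> B) \<in> W g" if g: "g \<in> carrier G" for g
      proof (cases "W g = UNIV")
        case False
        then have "g \<in> B \<longleftrightarrow> g \<in> A" using B(2) g by blast
        then show ?thesis using W(2) g by (auto simp: PiE_iff)
      qed simp
      then have "?i B \<in> Pi\<^sub>E (carrier G) W" by (auto simp: PiE_iff)
      then show ?thesis using V(2) W(3) B(1) by blast
    qed
    then show ?thesis using W(1) by (intro exI[of _ ?F]) auto
  qed
  moreover have "U \<subseteq> Pow (carrier G)" unfolding V(2) by (rule Int_lower2)
  ultimately show ?r by simp
next
  let ?T = "product_topology (\<lambda>_. discrete_topology (UNIV :: bool set)) (carrier G)"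
  let ?i = "\<lambda>A. \<lambda>g\<in>carrier G. g \<in> A"
  assume r: ?r
  show ?l
  proof (subst openin_subopen, intro ballI)
    fix A assume A: "A \<in> U"
    then obtain F where F: "finite F" "F \<subseteq> carrier G"
      "\<And>B. B \<subseteq> carrier G \<Longrightarrow> B \<inter> F = A \<inter> F \<Longrightarrow> B \<in> U" using r by meson
    \<comment> \<open>Here \<open>{g \<in> A}\<close> is the singleton of a truth value: the box
      prescribes the coordinates in \<open>F\<close> and leaves the others free.\<close>
    define W where "W g = (if g \<in> F then {g \<in> A} else UNIV)" for g
    have "openin ?T (Pi\<^sub>E (carrier G) W)"
      by (subst openin_PiE_gen)
         (use F(1) in \<open>auto simp: W_def intro!: disjI2 finite_subset[OF _ F(1)] split: if_splits\<close>)
    then have "openin (subset_topology G) (?i -` Pi\<^sub>E (carrier G) W \<inter> Pow (carrier G))"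
      unfolding subset_topology_def openin_pullback_topology by blast
    moreover have "?i -` Pi\<^sub>E (carrier G) W \<inter> Pow (carrier G) \<subseteq> U"
    proof
      fix B assume B: "B \<in> ?i -` Pi\<^sub>E (carrier G) W \<inter> Pow (carrier G)"
      then have "(g \<in> B) = (g \<in> A)" if "g \<in> F" for g
        using that F(2) by (auto simp: PiE_iff W_def dest!: bspec[of _ _ g])
      then show "B \<in> U" using B by (intro F(3)) auto
    qed
    moreover have "A \<in> ?i -` Pi\<^sub>E (carrier G) W \<inter> Pow (carrier G)"
      using A r by (auto simp: PiE_iff W_def)
    ultimately show "\<exists>T. openin (subset_topology G) T \<and> A \<in> T \<and> T \<subseteq> U" by blast
  qed
qed

text \<open>These are the test functions that will define the weak* neighbourhood to which soficity
  is applied.\<close>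

lemma continuous_map_finite_dependence:
  assumes "finite F" "F \<subseteq> carrier G"
  shows "continuous_map (subset_topology G) euclideanreal (\<lambda>T. p (T \<inter> F) :: real)"
proof -
  have "openin (subset_topology G) {T \<in> Pow (carrier G). p (T \<inter> F) \<in> U}" for U
    unfolding openin_subset_topology_iff
    by (intro conjI ballI exI[of _ F]) (use assms in auto)
  then show ?thesis by (simp add: continuous_map_def topspace_subset_topology)
qed

text \<open>For countable G there are countably many cylinders, so every open set is a countable
  union of cylinders, and these are finite combinations of membership events.\<close>

lemma measurable_into_Sub:
  assumes C: "countable (carrier G)"
    and h: "\<And>x. x \<in> space M \<Longrightarrow> subgroup (h x) G"
    and mem: "\<And>g. g \<in> carrier G \<Longrightarrow> {x \<in> space M. g \<in> h x} \<in> sets M"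
  shows "h \<in> M \<rightarrow>\<^sub>M borel_of (Sub_topology G)"
  unfolding borel_of_def
proof (rule measurable_measure_of)
  fix U assume "U \<in> {U. openin (Sub_topology G) U}"
  then obtain V where V: "openin (subset_topology G) V" "U = V \<inter> {H. subgroup H G}"
    by (auto simp: Sub_topology_def openin_subtopology)
  define FF where "FF = {F. finite F \<and> F \<subseteq> carrier G}"
  \<comment> \<open>Pairs of a window and a prescribed trace whose cylinder lies inside
    \<open>V\<close>.\<close>
  define X where "X = {p \<in> FF \<times> FF. \<forall>B\<subseteq>carrier G. B \<inter> fst p = snd p \<longrightarrow> B \<in> V}"
  have "countable FF" unfolding FF_def by (rule countable_Collect_finite_subset[OF C])
  then have "countable X" unfolding X_def by (intro countable_Collect countable_SIGMA)
  moreover have "{x \<in> space M. h x \<inter> fst p = snd p} \<in> sets M" if "p \<in> X" for p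
  proof -
    have p: "finite (fst p)" "finite (snd p)" "fst p \<subseteq> carrier G"
      using that by (auto simp: X_def FF_def)
    have "{x \<in> space M. h x \<inter> fst p = snd p} =
      {x \<in> space M. \<forall>g\<in>fst p \<union> snd p. (g \<in> h x \<and> g \<in> fst p) = (g \<in> snd p)}" by blast
    also have "\<dots> \<in> sets M"
    proof (rule sets.sets_Collect_finite_All)
      fix g
      show "{x \<in> space M. (g \<in> h x \<and> g \<in> fst p) = (g \<in> snd p)} \<in> sets M"
      proof (cases "g \<in> fst p")
        case True
        have "{x \<in> space M. g \<notin> h x} = space M - {x \<in> space M. g \<in> h x}" by auto
        then show ?thesis using True mem[of g] p(3) by (cases "g \<in> snd p") auto
      qed (cases "g \<in> snd p"; simp)
    qed (use p in simp)
    finally show ?thesis .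
  qed
  ultimately have "(\<Union>p\<in>X. {x \<in> space M. h x \<inter> fst p = snd p}) \<in> sets M"
    by (intro sets.countable_UN') auto
  also have "(\<Union>p\<in>X. {x \<in> space M. h x \<inter> fst p = snd p}) = h -` U \<inter> space M"
  proof (intro equalityI subsetI)
    fix x assume "x \<in> (\<Union>p\<in>X. {x \<in> space M. h x \<inter> fst p = snd p})"
    then obtain p where p: "p \<in> X" "x \<in> space M" "h x \<inter> fst p = snd p" by blast
    then have "h x \<in> V" using subgroup.subset[OF h[OF p(2)]] unfolding X_def by blast
    then show "x \<in> h -` U \<inter> space M" unfolding V(2) using h p(2) by simp
  next
    fix x assume x: "x \<in> h -` U \<inter> space M"
    then have "h x \<in> U" by blast
    then have "h x \<in> V" unfolding V(2) by blast
    then obtain F where "finite F" "F \<subseteq> carrier G" "\<forall>B\<subseteq>carrier G. B \<inter> F = h x \<inter> F \<longrightarrow> B \<in> V"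
      using V(1)[unfolded openin_subset_topology_iff] by meson
    then show "x \<in> (\<Union>p\<in>X. {x \<in> space M. h x \<inter> fst p = snd p})"
      using x by (intro UN_I[of "(F, h x \<inter> F)"]) (auto simp: X_def FF_def)
  qed
  finally show "h -` U \<inter> space M \<in> sets M" .
qed (use h openin_subset[of "Sub_topology G"] in \<open>auto simp: topspace_Sub_topology\<close>)

lemma measurable_Sub_inclusion:
  "(\<lambda>H. H) \<in> borel_of (Sub_topology G) \<rightarrow>\<^sub>M borel_of (subset_topology G)"
  unfolding borel_of_def[of "subset_topology G"]
proof (rule measurable_measure_of)
  fix U assume "U \<in> {U. openin (subset_topology G) U}"
  then have "openin (Sub_topology G) (U \<inter> {H. subgroup H G})"
    unfolding Sub_topology_def openin_subtopology by blast
  then show "(\<lambda>H. H) -` U \<inter> space (borel_of (Sub_topology G)) \<in> sets (borel_of (Sub_topology G))"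
    using open_in_borel_of by (auto simp: topspace_Sub_topology)
qed (use openin_subset[of "subset_topology G"] in \<open>auto simp: topspace_Sub_topology topspace_subset_topology dest: subgroup.subset\<close>)

section \<open>Coordinates, and conditional laws given the stabilizer\<close>

definition coord :: "('g, 'm) monoid_scheme \<Rightarrow> 'g set \<times> ('g set \<Rightarrow> 'k) \<Rightarrow> 'g \<Rightarrow> 'k" where
  "coord G x = (\<lambda>g. snd x (g <#\<^bsub>G\<^esub> fst x))"

lemma Sub_tensor_embed_in_space:
  "Sub_tensor_embed G \<in> space (Sub_tensor G K)
     \<rightarrow> space (borel_of (Sub_topology G) \<Otimes>\<^sub>M (\<Pi>\<^sub>M g\<in>carrier G. K))"
  by (auto simp: space_Sub_tensor Sub_tensor_embed_def space_pair_measure space_PiM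
      topspace_Sub_topology LCOSETS_def)

lemma measurable_Sub_tensor_embed [measurable]:
  "Sub_tensor_embed G \<in> Sub_tensor G K \<rightarrow>\<^sub>M borel_of (Sub_topology G) \<Otimes>\<^sub>M (\<Pi>\<^sub>M g\<in>carrier G. K)"
  using measurable_vimage_algebra1[OF Sub_tensor_embed_in_space[of G K]]
  by (simp add: Sub_tensor_def sets.space_closed)

lemma Sub_tensor_embed_eq: "Sub_tensor_embed G x = (fst x, \<lambda>g\<in>carrier G. coord G x g)"
  by (cases x) (simp add: Sub_tensor_embed_def coord_def)

lemma measurable_fst_Sub_tensor [measurable]: "fst \<in> Sub_tensor G K \<rightarrow>\<^sub>M borel_of (Sub_topology G)"
  using measurable_compose[OF measurable_Sub_tensor_embed measurable_fst]
  by (simp add: Sub_tensor_embed_eq)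

lemma measurable_coord_PiM [measurable]:
  "(\<lambda>x. \<lambda>g\<in>carrier G. coord G x g) \<in> Sub_tensor G K \<rightarrow>\<^sub>M (\<Pi>\<^sub>M g\<in>carrier G. K)"
  using measurable_compose[OF measurable_Sub_tensor_embed measurable_snd]
  by (simp add: Sub_tensor_embed_eq)

lemma measurable_coord:
  assumes "g \<in> carrier G"
  shows "(\<lambda>x. coord G x g) \<in> Sub_tensor G K \<rightarrow>\<^sub>M K"
  using measurable_compose[OF measurable_coord_PiM measurable_component_singleton[OF assms]] assms
  by simp

lemma coord_in_space: "x \<in> space (Sub_tensor G K) \<Longrightarrow> g \<in> carrier G \<Longrightarrow> coord G x g \<in> space K"
  using measurable_space[OF measurable_coord] by fast

text \<open>The conditional law of (H, \<omega>) given H. With it the measure becomes a monadic bind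
  over \<eta>, which supplies Fubini and lets invariance be checked separately on fibres and on the
  base.\<close>

definition tensor_kernel ::
    "('g, 'm) monoid_scheme \<Rightarrow> 'k measure \<Rightarrow> 'g set \<Rightarrow> ('g set \<times> ('g set \<Rightarrow> 'k)) measure" where
  "tensor_kernel G \<kappa> H = distr (\<Pi>\<^sub>M C\<in>lcosets\<^bsub>G\<^esub> H. \<kappa>) (Sub_tensor G \<kappa>) (Pair H)"

lemma prob_space_tensor_kernel:
  "prob_space \<kappa> \<Longrightarrow> subgroup H G \<Longrightarrow> prob_space (tensor_kernel G \<kappa> H)"
  unfolding tensor_kernel_def
  by (intro prob_space.prob_space_distr prob_space_PiM measurable_Pair_Sub_tensor)

text \<open>Measurable sets are preimages under the embedding, so the claim reduces to the lifted
  kernel on functions over the whole group, which lives on one fixed space for all H.\<close>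

lemma (in group) measurable_tensor_kernel:
  assumes \<kappa>: "prob_space \<kappa>"
  shows "tensor_kernel G \<kappa> \<in> borel_of (Sub_topology G) \<rightarrow>\<^sub>M subprob_algebra (Sub_tensor G \<kappa>)"
proof (rule measurable_subprob_algebra)
  fix H assume "H \<in> space (borel_of (Sub_topology G))"
  then show "subprob_space (tensor_kernel G \<kappa> H)"
    using prob_space_tensor_kernel[OF \<kappa>] by (auto simp: topspace_Sub_topology intro: prob_space_imp_subprob_space)
next
  fix F assume F: "F \<in> sets (Sub_tensor G \<kappa>)"
  define V where "V H = distr (\<Pi>\<^sub>M C\<in>lcosets H. \<kappa>) (\<Pi>\<^sub>M g\<in>carrier G. \<kappa>)
                (\<lambda>\<omega>. \<lambda>g\<in>carrier G. \<omega> (g <# H))" for H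
  have V: "V \<in> borel_of (Sub_topology G) \<rightarrow>\<^sub>M subprob_algebra (\<Pi>\<^sub>M g\<in>carrier G. \<kappa>)"
    using measurable_lift_kernel[OF \<kappa>] by (simp add: V_def[abs_def])
  obtain B where B: "B \<in> sets (borel_of (Sub_topology G) \<Otimes>\<^sub>M (\<Pi>\<^sub>M g\<in>carrier G. \<kappa>))"
    and FB: "F = Sub_tensor_embed G -` B \<inter> space (Sub_tensor G \<kappa>)"
    using F Sub_tensor_embed_in_space[of G \<kappa>] unfolding Sub_tensor_def by (auto simp: sets_vimage_algebra2)
  have "emeasure (tensor_kernel G \<kappa> H) F = (\<integral>\<^sup>+x. indicator B (H, x) \<partial>V H)"
    if H: "subgroup H G" for H
  proof -
    have BH: "Pair H -` B \<in> sets (\<Pi>\<^sub>M g\<in>carrier G. \<kappa>)" by (rule sets_Pair1[OF B])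
    have "(\<integral>\<^sup>+x. indicator B (H, x) \<partial>V H) = (\<integral>\<^sup>+x. indicator (Pair H -` B) x \<partial>V H)"
      by (simp add: indicator_def)
    also have "\<dots> = emeasure (V H) (Pair H -` B)" using BH by (simp add: V_def)
    also have "\<dots> = emeasure (tensor_kernel G \<kappa> H) F"
      unfolding V_def tensor_kernel_def emeasure_distr[OF measurable_lift BH]
        emeasure_distr[OF measurable_Pair_Sub_tensor[OF H] F]
      by (rule arg_cong2[where f = emeasure])
         (use H in \<open>auto simp: FB space_Sub_tensor space_PiM Sub_tensor_embed_def\<close>)
    finally show ?thesis by simp
  qed
  moreover have "(\<lambda>H. \<integral>\<^sup>+x. indicator B (H, x) \<partial>V H) \<in> borel_measurable (borel_of (Sub_topology G))"
    by (rule nn_integral_measurable_subprob_algebra2[OF _ V]) (use B in simp)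
  ultimately show "(\<lambda>H. emeasure (tensor_kernel G \<kappa> H) F) \<in> borel_measurable (borel_of (Sub_topology G))"
    by (subst measurable_cong[where g = "\<lambda>H. \<integral>\<^sup>+x. indicator B (H, x) \<partial>V H"])
       (auto simp: topspace_Sub_topology)
qed (simp add: tensor_kernel_def)

lemma space_borel_prob_measure_Sub:
  "\<eta> \<in> borel_prob_measures (Sub_topology G) \<Longrightarrow> space \<eta> = {H. subgroup H G}"
  using sets_eq_imp_space_eq[of \<eta> "borel_of (Sub_topology G)"]
  by (simp add: borel_prob_measures_def topspace_Sub_topology)

lemma (in group) Sub_tensor_measure_eq_bind:
  assumes \<eta>: "\<eta> \<in> borel_prob_measures (Sub_topology G)" and \<kappa>: "prob_space \<kappa>"
  shows "Sub_tensor_measure G \<eta> \<kappa> = \<eta> \<bind> tensor_kernel G \<kappa>"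
proof -
  have s\<eta>: "sets \<eta> = sets (borel_of (Sub_topology G))" using \<eta> by (simp add: borel_prob_measures_def)
  have sp: "space \<eta> = {H. subgroup H G}" by (rule space_borel_prob_measure_Sub[OF \<eta>])
  have ne: "space \<eta> \<noteq> {}" using sp triv_subgroup by blast
  have N: "tensor_kernel G \<kappa> \<in> \<eta> \<rightarrow>\<^sub>M subprob_algebra (Sub_tensor G \<kappa>)"
    using measurable_tensor_kernel[OF \<kappa>] by (simp add: measurable_cong_sets[OF s\<eta> refl])
  show ?thesis
  proof (rule measure_eqI)
    show "sets (Sub_tensor_measure G \<eta> \<kappa>) = sets (\<eta> \<bind> tensor_kernel G \<kappa>)"
      by (subst sets_bind[OF sets_kernel[OF N] ne]) auto
    fix E assume "E \<in> sets (Sub_tensor_measure G \<eta> \<kappa>)"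
    then have E: "E \<in> sets (Sub_tensor G \<kappa>)" by simp
    show "emeasure (Sub_tensor_measure G \<eta> \<kappa>) E = emeasure (\<eta> \<bind> tensor_kernel G \<kappa>) E"
      unfolding emeasure_Sub_tensor_measure[OF \<eta> \<kappa> E] emeasure_bind[OF ne N E]
    proof (rule nn_integral_cong)
      fix H assume "H \<in> space \<eta>"
      then have H: "subgroup H G" by (simp add: sp)
      show "emeasure (\<Pi>\<^sub>M C\<in>lcosets H. \<kappa>) {\<omega> \<in> space (\<Pi>\<^sub>M C\<in>lcosets H. \<kappa>). (H, \<omega>) \<in> E}
          = emeasure (tensor_kernel G \<kappa> H) E"
        unfolding tensor_kernel_def emeasure_distr[OF measurable_Pair_Sub_tensor[OF H] E]
        by (rule arg_cong2[where f = emeasure]) auto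
    qed
  qed
qed

lemma (in group) nn_integral_Sub_tensor_measure:
  assumes \<eta>: "\<eta> \<in> borel_prob_measures (Sub_topology G)" and \<kappa>: "prob_space \<kappa>"
    and f: "f \<in> borel_measurable (Sub_tensor G \<kappa>)"
  shows "(\<integral>\<^sup>+x. f x \<partial>Sub_tensor_measure G \<eta> \<kappa>)
    = (\<integral>\<^sup>+H. \<integral>\<^sup>+\<omega>. f (H, \<omega>) \<partial>(\<Pi>\<^sub>M C\<in>lcosets H. \<kappa>) \<partial>\<eta>)"
proof -
  have s\<eta>: "sets \<eta> = sets (borel_of (Sub_topology G))" using \<eta> by (simp add: borel_prob_measures_def)
  have N: "tensor_kernel G \<kappa> \<in> \<eta> \<rightarrow>\<^sub>M subprob_algebra (Sub_tensor G \<kappa>)"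
    using measurable_tensor_kernel[OF \<kappa>] by (simp add: measurable_cong_sets[OF s\<eta> refl])
  show ?thesis
    unfolding Sub_tensor_measure_eq_bind[OF \<eta> \<kappa>] nn_integral_bind[OF f N]
  proof (rule nn_integral_cong)
    fix H assume "H \<in> space \<eta>"
    then have H: "subgroup H G" by (simp add: space_borel_prob_measure_Sub[OF \<eta>])
    show "(\<integral>\<^sup>+x. f x \<partial>tensor_kernel G \<kappa> H) = (\<integral>\<^sup>+\<omega>. f (H, \<omega>) \<partial>(\<Pi>\<^sub>M C\<in>lcosets H. \<kappa>))"
      unfolding tensor_kernel_def by (rule nn_integral_distr[OF measurable_Pair_Sub_tensor[OF H]]) (use f in simp)
  qed
qed

text \<open>Both sides arise by copying an i.i.d. family indexed by representatives of the common
  fibres, so only the pattern of coincidences matters. It compares cosets of two subgroups, and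
  cosets with points of the finite model.\<close>

lemma iid_pullback_cong:
  fixes f :: "'j \<Rightarrow> 'a" and f' :: "'j \<Rightarrow> 'b" and \<kappa> :: "'k measure"
  assumes \<kappa>: "prob_space \<kappa>" and f: "f \<in> J \<rightarrow> I" and f': "f' \<in> J \<rightarrow> I'"
    and eq: "\<And>i j. i \<in> J \<Longrightarrow> j \<in> J \<Longrightarrow> f i = f j \<longleftrightarrow> f' i = f' j"
  shows "distr (\<Pi>\<^sub>M i\<in>I. \<kappa>) (\<Pi>\<^sub>M j\<in>J. \<kappa>) (\<lambda>\<omega>. \<lambda>j\<in>J. \<omega> (f j))
       = distr (\<Pi>\<^sub>M i\<in>I'. \<kappa>) (\<Pi>\<^sub>M j\<in>J. \<kappa>) (\<lambda>\<omega>. \<lambda>j\<in>J. \<omega> (f' j))"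
proof -
  \<comment> \<open>The choice depends on j only through \<open>f j\<close>, so all indices of a
    fibre receive the same representative.\<close>
  define r where "r j = (SOME i. i \<in> J \<and> f i = f j)" for j
  have r: "r j \<in> J" "f (r j) = f j" if "j \<in> J" for j
    using someI[of "\<lambda>i. i \<in> J \<and> f i = f j" j] that by (auto simp: r_def)
  have rr: "r i = r j" if "i \<in> J" "j \<in> J" "f i = f j" for i j
    using that by (simp add: r_def)
  let ?J = "r ` J"
  have *: "distr (\<Pi>\<^sub>M i\<in>I. \<kappa>) (\<Pi>\<^sub>M j\<in>J. \<kappa>) (\<lambda>\<omega>. \<lambda>j\<in>J. \<omega> (h j))
       = distr (\<Pi>\<^sub>M j\<in>?J. \<kappa>) (\<Pi>\<^sub>M j\<in>J. \<kappa>) (\<lambda>\<omega>. \<lambda>j\<in>J. \<omega> (r j))"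
    if h: "h \<in> J \<rightarrow> I" and heq: "\<And>i j. i \<in> J \<Longrightarrow> j \<in> J \<Longrightarrow> f i = f j \<longleftrightarrow> h i = h j"
    for h :: "'j \<Rightarrow> 'c" and I
  proof -
    have inj: "inj_on h ?J"
    proof (rule inj_onI)
      fix a b assume "a \<in> ?J" "b \<in> ?J" "h a = h b"
      then obtain i j where "i \<in> J" "j \<in> J" "a = r i" "b = r j" by blast
      then show "a = b" using \<open>h a = h b\<close> heq[of a b] r rr by metis
    qed
    have h': "h \<in> ?J \<rightarrow> I" using h r by auto
    have m1: "(\<lambda>\<omega>. \<lambda>n\<in>?J. \<omega> (h n)) \<in> (\<Pi>\<^sub>M i\<in>I. \<kappa>) \<rightarrow>\<^sub>M (\<Pi>\<^sub>M j\<in>?J. \<kappa>)"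
      using h' by (intro measurable_restrict measurable_component_singleton) auto
    have m2: "(\<lambda>\<omega>. \<lambda>j\<in>J. \<omega> (r j)) \<in> (\<Pi>\<^sub>M j\<in>?J. \<kappa>) \<rightarrow>\<^sub>M (\<Pi>\<^sub>M j\<in>J. \<kappa>)"
      by (intro measurable_restrict measurable_component_singleton) auto
    have "distr (\<Pi>\<^sub>M j\<in>?J. \<kappa>) (\<Pi>\<^sub>M j\<in>J. \<kappa>) (\<lambda>\<omega>. \<lambda>j\<in>J. \<omega> (r j))
      = distr (distr (\<Pi>\<^sub>M i\<in>I. \<kappa>) (\<Pi>\<^sub>M j\<in>?J. \<kappa>) (\<lambda>\<omega>. \<lambda>n\<in>?J. \<omega> (h n))) (\<Pi>\<^sub>M j\<in>J. \<kappa>) (\<lambda>\<omega>. \<lambda>j\<in>J. \<omega> (r j))"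
      using distr_PiM_reindex[OF \<kappa> inj h'] by simp
    also have "\<dots> = distr (\<Pi>\<^sub>M i\<in>I. \<kappa>) (\<Pi>\<^sub>M j\<in>J. \<kappa>) ((\<lambda>\<omega>. \<lambda>j\<in>J. \<omega> (r j)) \<circ> (\<lambda>\<omega>. \<lambda>n\<in>?J. \<omega> (h n)))"
      by (rule distr_distr[OF m2 m1])
    also have "((\<lambda>\<omega> :: 'j \<Rightarrow> 'k. \<lambda>j\<in>J. \<omega> (r j)) \<circ> (\<lambda>\<omega>. \<lambda>n\<in>?J. \<omega> (h n))) = (\<lambda>\<omega>. \<lambda>j\<in>J. \<omega> (h j))"
    proof -
      have X: "(\<lambda>j\<in>J. (\<lambda>n\<in>?J. \<omega> (h n)) (r j)) = (\<lambda>j\<in>J. \<omega> (h j))" for \<omega> :: "'c \<Rightarrow> 'k"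
      proof (rule restrict_ext)
        fix j assume j: "j \<in> J"
        then show "(\<lambda>n\<in>?J. \<omega> (h n)) (r j) = \<omega> (h j)" using heq[of "r j" j] r[OF j] by simp
      qed
      show ?thesis unfolding comp_def by (rule ext) (rule X)
    qed
    finally show ?thesis by (rule sym)
  qed
  show ?thesis
    using *[OF f] *[OF f' eq] by simp
qed

section \<open>Invariance and local functions\<close>

lemma (in group) mem_conj_subgroup_iff:
  assumes H: "subgroup H G" and g: "g \<in> carrier G"
  shows "f \<in> conj_subgroup G g H \<longleftrightarrow> f \<in> carrier G \<and> inv g \<otimes> f \<otimes> g \<in> H"
proof
  assume "f \<in> conj_subgroup G g H"
  then obtain h where h: "h \<in> H" "f = g \<otimes> h \<otimes> inv g"
    by (auto simp: conj_subgroup_def l_coset_def r_coset_def)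
  have hc: "h \<in> carrier G" using subgroup.subset[OF H] h(1) by blast
  have "inv g \<otimes> f \<otimes> g = h" using h(2) g hc by (simp add: m_assoc inv_solve_left')
  then show "f \<in> carrier G \<and> inv g \<otimes> f \<otimes> g \<in> H" using h g hc by simp
next
  assume f: "f \<in> carrier G \<and> inv g \<otimes> f \<otimes> g \<in> H"
  then have "f = g \<otimes> (inv g \<otimes> f \<otimes> g) \<otimes> inv g" using g by (simp add: m_assoc) (simp add: m_assoc[symmetric])
  then show "f \<in> conj_subgroup G g H" using f
    unfolding conj_subgroup_def l_coset_def r_coset_def by blast
qed

lemma (in group) subgroup_conj_subgroup:
  assumes H: "subgroup H G" and g: "g \<in> carrier G"
  shows "subgroup (conj_subgroup G g H) G"
proof (rule subgroupI)
  have "\<one> \<in> conj_subgroup G g H"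
    using g subgroup.one_closed[OF H] by (simp add: mem_conj_subgroup_iff[OF H g])
  then show "conj_subgroup G g H \<noteq> {}" by blast
next
  fix a assume a: "a \<in> conj_subgroup G g H"
  then have ac: "a \<in> carrier G" and "inv g \<otimes> a \<otimes> g \<in> H" by (auto simp: mem_conj_subgroup_iff[OF H g])
  then have "inv (inv g \<otimes> a \<otimes> g) \<in> H" using subgroup.m_inv_closed[OF H] by blast
  then show "inv a \<in> conj_subgroup G g H"
    using ac g by (simp add: mem_conj_subgroup_iff[OF H g] inv_mult_group m_assoc)
next
  fix a b assume "a \<in> conj_subgroup G g H" "b \<in> conj_subgroup G g H"
  then have ab: "a \<in> carrier G" "b \<in> carrier G" and "inv g \<otimes> a \<otimes> g \<in> H" "inv g \<otimes> b \<otimes> g \<in> H"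
    by (auto simp: mem_conj_subgroup_iff[OF H g])
  then have "(inv g \<otimes> a \<otimes> g) \<otimes> (inv g \<otimes> b \<otimes> g) \<in> H" using subgroup.m_closed[OF H] by blast
  moreover have "(inv g \<otimes> a \<otimes> g) \<otimes> (inv g \<otimes> b \<otimes> g) = inv g \<otimes> (a \<otimes> b) \<otimes> g"
    using ab g by (simp add: m_assoc) (simp add: m_assoc[symmetric])
  ultimately show "a \<otimes> b \<in> conj_subgroup G g H"
    using ab g by (simp add: mem_conj_subgroup_iff[OF H g])
qed (auto simp: mem_conj_subgroup_iff[OF H g])

lemma (in group) lcosets_eq_image: "lcosets H = (\<lambda>f. f <# H) ` carrier G"
  by (auto simp: LCOSETS_def)

lemma (in group) lcoset_conj_rcos:
  assumes H: "subgroup H G" and g: "g \<in> carrier G" and f: "f \<in> carrier G"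
  shows "(f <# conj_subgroup G g H) #> g = (f \<otimes> g) <# H"
  using g f subgroup.subset[OF H] unfolding conj_subgroup_def l_coset_def r_coset_def
  by (auto simp: m_assoc subset_eq)

text \<open>Right translation by g carries cosets of the conjugate to cosets of H. Pulling an i.i.d.
  family back along an injective map of indices gives an i.i.d. family again, which is the
  invariance on fibres.\<close>

lemma (in group) lcosets_conj_reindex:
  assumes H: "subgroup H G" and g: "g \<in> carrier G"
  shows "inj_on (\<lambda>C. C #> g) (lcosets (conj_subgroup G g H))"
    and "(\<lambda>C. C #> g) \<in> lcosets (conj_subgroup G g H) \<rightarrow> lcosets H"
proof -
  have H': "subgroup (conj_subgroup G g H) G" by (rule subgroup_conj_subgroup[OF H g])
  show "inj_on (\<lambda>C. C #> g) (lcosets (conj_subgroup G g H))"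
  proof (rule inj_onI)
    fix C D assume "C \<in> lcosets (conj_subgroup G g H)" "D \<in> lcosets (conj_subgroup G g H)"
      and eq: "C #> g = D #> g"
    then obtain a b where ab: "a \<in> carrier G" "b \<in> carrier G"
      "C = a <# conj_subgroup G g H" "D = b <# conj_subgroup G g H" by (auto simp: lcosets_eq_image)
    then have "(a \<otimes> g) <# H = (b \<otimes> g) <# H" using eq lcoset_conj_rcos[OF H g] by simp
    then have "inv (a \<otimes> g) \<otimes> (b \<otimes> g) \<in> H" using lcoset_eq_iff[OF H] ab g by simp
    then have "inv a \<otimes> b \<in> conj_subgroup G g H"
      using ab g by (simp add: mem_conj_subgroup_iff[OF H g] inv_mult_group m_assoc)
    then show "C = D" using lcoset_eq_iff[OF H'] ab by simp
  qed
  show "(\<lambda>C. C #> g) \<in> lcosets (conj_subgroup G g H) \<rightarrow> lcosets H"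
    using lcoset_conj_rcos[OF H g] g by (auto simp: lcosets_eq_image)
qed

lemma (in group) coord_act:
  assumes "subgroup (fst x) G" "g \<in> carrier G" "f \<in> carrier G"
  shows "coord G (Sub_tensor_act G g x) f = coord G x (f \<otimes> g)"
  using Sub_tensor_act_apply[of "fst x" g f "snd x"] assms
  by (cases x) (simp add: coord_def Sub_tensor_act_def)

lemma fst_act [simp]: "fst (Sub_tensor_act G g x) = conj_subgroup G g (fst x)"
  by (cases x) (simp add: Sub_tensor_act_def)

lemma (in group) act_in_space:
  assumes g: "g \<in> carrier G" and x: "x \<in> space (Sub_tensor G K)"
  shows "Sub_tensor_act G g x \<in> space (Sub_tensor G K)"
proof -
  obtain H \<omega> where H: "x = (H, \<omega>)" "subgroup H G" and \<omega>: "\<omega> \<in> lcosets H \<rightarrow>\<^sub>E space K"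
    using x by (auto simp: space_Sub_tensor)
  have "(\<lambda>C\<in>lcosets (conj_subgroup G g H). \<omega> (C #> g)) \<in> lcosets (conj_subgroup G g H) \<rightarrow>\<^sub>E space K"
    using lcosets_conj_reindex(2)[OF H(2) g] by (intro restrict_PiE_iff[THEN iffD2] ballI PiE_mem[OF \<omega>]) auto
  then show ?thesis
    using subgroup_conj_subgroup[OF H(2) g] by (simp add: H(1) space_Sub_tensor Sub_tensor_act_def)
qed

lemma (in group) measurable_conj_subgroup:
  assumes C: "countable (carrier G)" and g: "g \<in> carrier G"
  shows "conj_subgroup G g \<in> borel_of (Sub_topology G) \<rightarrow>\<^sub>M borel_of (Sub_topology G)"
proof (rule measurable_into_Sub[OF C])
  fix f assume f: "f \<in> carrier G"
  have "{H \<in> space (borel_of (Sub_topology G)). f \<in> conj_subgroup G g H}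
      = {H \<in> space (borel_of (Sub_topology G)). inv g \<otimes> f \<otimes> g \<in> H}"
    using mem_conj_subgroup_iff[OF _ g] f by (auto simp: topspace_Sub_topology)
  then show "{H \<in> space (borel_of (Sub_topology G)). f \<in> conj_subgroup G g H} \<in> sets (borel_of (Sub_topology G))"
    using measurable_mem_Sub[of "inv g \<otimes> f \<otimes> g" G] by (simp add: pred_def)
qed (use subgroup_conj_subgroup g in \<open>auto simp: topspace_Sub_topology\<close>)

lemma subgroup_fst_Sub_tensor: "x \<in> space (Sub_tensor G K) \<Longrightarrow> subgroup (fst x) G"
  by (auto simp: space_Sub_tensor)

lemma (in group) measurable_act:
  assumes C: "countable (carrier G)" and g: "g \<in> carrier G"
  shows "Sub_tensor_act G g \<in> Sub_tensor G K \<rightarrow>\<^sub>M Sub_tensor G K"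
  unfolding Sub_tensor_def[of G K]
proof (rule measurable_vimage_algebra2, fold Sub_tensor_def[of G K])
  show "Sub_tensor_act G g \<in> space (Sub_tensor G K)
      \<rightarrow> {(H, \<omega>). subgroup H G \<and> \<omega> \<in> lcosets H \<rightarrow>\<^sub>E space K}"
    using act_in_space[OF g, of _ K] by (auto simp: space_Sub_tensor)
  have "(\<lambda>x. (conj_subgroup G g (fst x), \<lambda>f\<in>carrier G. coord G x (f \<otimes> g))) \<in> Sub_tensor G K \<rightarrow>\<^sub>M
      borel_of (Sub_topology G) \<Otimes>\<^sub>M (\<Pi>\<^sub>M g\<in>carrier G. K)"
    using g by (intro measurable_Pair measurable_restrict measurable_coord
      measurable_compose[OF measurable_fst_Sub_tensor measurable_conj_subgroup[OF C g]]) auto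
  also have "?this \<longleftrightarrow> (\<lambda>x. Sub_tensor_embed G (Sub_tensor_act G g x)) \<in> Sub_tensor G K \<rightarrow>\<^sub>M
      borel_of (Sub_topology G) \<Otimes>\<^sub>M (\<Pi>\<^sub>M g\<in>carrier G. K)"
    by (rule measurable_cong)
       (auto simp: Sub_tensor_embed_eq coord_act[OF subgroup_fst_Sub_tensor g] cong: restrict_cong)
  finally show "(\<lambda>x. Sub_tensor_embed G (Sub_tensor_act G g x)) \<in> Sub_tensor G K \<rightarrow>\<^sub>M
      borel_of (Sub_topology G) \<Otimes>\<^sub>M (\<Pi>\<^sub>M g\<in>carrier G. K)" .
qed

text \<open>The element g maps the fibre over H to the fibre over its conjugate, and there it only
  renames the indices of the product.\<close>

lemma (in group) distr_act_tensor_kernel: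
  assumes C: "countable (carrier G)" and g: "g \<in> carrier G" and H: "subgroup H G" and \<kappa>: "prob_space \<kappa>"
  shows "distr (tensor_kernel G \<kappa> H) (Sub_tensor G \<kappa>) (Sub_tensor_act G g)
    = tensor_kernel G \<kappa> (conj_subgroup G g H)"
proof -
  let ?H = "conj_subgroup G g H"
  let ?r = "\<lambda>\<omega>. \<lambda>C\<in>lcosets ?H. \<omega> (C #> g)"
  have H': "subgroup ?H G" by (rule subgroup_conj_subgroup[OF H g])
  have r: "?r \<in> (\<Pi>\<^sub>M C\<in>lcosets H. \<kappa>) \<rightarrow>\<^sub>M (\<Pi>\<^sub>M C\<in>lcosets ?H. \<kappa>)"
    using lcosets_conj_reindex(2)[OF H g] by (intro measurable_restrict measurable_component_singleton) auto
  have "distr (tensor_kernel G \<kappa> H) (Sub_tensor G \<kappa>) (Sub_tensor_act G g)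
      = distr (\<Pi>\<^sub>M C\<in>lcosets H. \<kappa>) (Sub_tensor G \<kappa>) (Sub_tensor_act G g \<circ> Pair H)"
    unfolding tensor_kernel_def by (rule distr_distr[OF measurable_act[OF C g] measurable_Pair_Sub_tensor[OF H]])
  also have "Sub_tensor_act G g \<circ> Pair H = Pair ?H \<circ> ?r"
    by (auto simp: Sub_tensor_act_def)
  also have "distr (\<Pi>\<^sub>M C\<in>lcosets H. \<kappa>) (Sub_tensor G \<kappa>) (Pair ?H \<circ> ?r)
      = distr (distr (\<Pi>\<^sub>M C\<in>lcosets H. \<kappa>) (\<Pi>\<^sub>M C\<in>lcosets ?H. \<kappa>) ?r) (Sub_tensor G \<kappa>) (Pair ?H)"
    by (rule distr_distr[OF measurable_Pair_Sub_tensor[OF H'] r, symmetric])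
  also have "distr (\<Pi>\<^sub>M C\<in>lcosets H. \<kappa>) (\<Pi>\<^sub>M C\<in>lcosets ?H. \<kappa>) ?r = (\<Pi>\<^sub>M C\<in>lcosets ?H. \<kappa>)"
    by (rule distr_PiM_reindex[OF \<kappa> lcosets_conj_reindex[OF H g]])
  finally show ?thesis by (simp add: tensor_kernel_def)
qed

text \<open>Equivariance of the conditional laws reduces this to the conjugation invariance of
  \<eta> on the base.\<close>

lemma (in group) distr_act_Sub_tensor_measure:
  assumes C: "countable (carrier G)" and g: "g \<in> carrier G" and \<eta>: "conj_invariant_measure G \<eta>"
    and \<kappa>: "prob_space \<kappa>"
  shows "distr (Sub_tensor_measure G \<eta> \<kappa>) (Sub_tensor_measure G \<eta> \<kappa>) (Sub_tensor_act G g)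
    = Sub_tensor_measure G \<eta> \<kappa>"
proof (rule measure_eqI)
  let ?M = "Sub_tensor_measure G \<eta> \<kappa>"
  have \<eta>': "\<eta> \<in> borel_prob_measures (Sub_topology G)"
    and inv: "distr \<eta> (borel_of (Sub_topology G)) (conj_subgroup G g) = \<eta>"
    using \<eta> g by (auto simp: conj_invariant_measure_def)
  have s\<eta>: "sets \<eta> = sets (borel_of (Sub_topology G))" using \<eta>' by (simp add: borel_prob_measures_def)
  have sp: "space \<eta> = {H. subgroup H G}" by (rule space_borel_prob_measure_Sub[OF \<eta>'])
  have ne: "space \<eta> \<noteq> {}" using sp triv_subgroup by blast
  have N': "tensor_kernel G \<kappa> \<in> borel_of (Sub_topology G) \<rightarrow>\<^sub>M subprob_algebra (Sub_tensor G \<kappa>)"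
    by (rule measurable_tensor_kernel[OF \<kappa>])
  then have N: "tensor_kernel G \<kappa> \<in> \<eta> \<rightarrow>\<^sub>M subprob_algebra (Sub_tensor G \<kappa>)"
    by (simp add: measurable_cong_sets[OF s\<eta> refl])
  have act: "Sub_tensor_act G g \<in> Sub_tensor G \<kappa> \<rightarrow>\<^sub>M Sub_tensor G \<kappa>" by (rule measurable_act[OF C g])
  then have actM: "Sub_tensor_act G g \<in> ?M \<rightarrow>\<^sub>M ?M" by (simp cong: measurable_cong_sets)
  fix E assume "E \<in> sets (distr ?M ?M (Sub_tensor_act G g))"
  then have E: "E \<in> sets (Sub_tensor G \<kappa>)" by simp
  have E': "Sub_tensor_act G g -` E \<inter> space (Sub_tensor G \<kappa>) \<in> sets (Sub_tensor G \<kappa>)"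
    using act E by (rule measurable_sets)
  have "emeasure (distr ?M ?M (Sub_tensor_act G g)) E
      = emeasure ?M (Sub_tensor_act G g -` E \<inter> space (Sub_tensor G \<kappa>))"
    using actM E by (simp add: emeasure_distr)
  also have "\<dots> = (\<integral>\<^sup>+H. emeasure (tensor_kernel G \<kappa> H) (Sub_tensor_act G g -` E \<inter> space (Sub_tensor G \<kappa>)) \<partial>\<eta>)"
    unfolding Sub_tensor_measure_eq_bind[OF \<eta>' \<kappa>] by (rule emeasure_bind[OF ne N E'])
  also have "\<dots> = (\<integral>\<^sup>+H. emeasure (tensor_kernel G \<kappa> (conj_subgroup G g H)) E \<partial>\<eta>)"
  proof (rule nn_integral_cong)
    fix H assume "H \<in> space \<eta>"
    then have H: "subgroup H G" by (simp add: sp)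
    show "emeasure (tensor_kernel G \<kappa> H) (Sub_tensor_act G g -` E \<inter> space (Sub_tensor G \<kappa>))
        = emeasure (tensor_kernel G \<kappa> (conj_subgroup G g H)) E"
      unfolding distr_act_tensor_kernel[OF C g H \<kappa>, symmetric]
      by (subst emeasure_distr) (use act E in \<open>auto simp: tensor_kernel_def\<close>)
  qed
  also have "\<dots> = (\<integral>\<^sup>+H. emeasure (tensor_kernel G \<kappa> H) E \<partial>distr \<eta> (borel_of (Sub_topology G)) (conj_subgroup G g))"
    by (rule nn_integral_distr[symmetric])
       (use measurable_conj_subgroup[OF C g] measurable_emeasure_kernel[OF N' E] in
         \<open>auto simp: measurable_cong_sets[OF s\<eta> refl]\<close>)
  also have "\<dots> = emeasure ?M E"
    unfolding inv Sub_tensor_measure_eq_bind[OF \<eta>' \<kappa>] by (rule emeasure_bind[OF ne N E, symmetric])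
  finally show "emeasure (distr ?M ?M (Sub_tensor_act G g)) E = emeasure ?M E" .
qed simp

section \<open>Approximation by functions of finite windows\<close>

lemma (in finite_measure) approximation_by_algebra:
  assumes alg: "algebra (space M) \<A>" and gen: "sets M = sigma_sets (space M) \<A>"
    and E: "E \<in> sets M" and e: "0 < e"
  shows "\<exists>A\<in>\<A>. measure M (sym_diff E A) < e"
proof -
  interpret algebra "space M" \<A> by (rule alg)
  have As: "A \<in> sets M" if "A \<in> \<A>" for A using that gen by auto
  have "E \<in> sigma_sets (space M) \<A>" using E gen by simp
  \<comment> \<open>The approximable sets contain the algebra and are closed under complements and
    countable unions. The quantifier over \<open>e\<close> belongs to the induction because unions
    need smaller errors for their members.\<close>
  then have "E \<in> sets M \<and> (\<forall>e>0. \<exists>A\<in>\<A>. measure M (sym_diff E A) < e)"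
  proof (induction rule: sigma_sets.induct)
    case (Basic A)
    then show ?case using As by (auto intro!: bexI[of _ A])
  next
    case Empty
    then show ?case by (auto intro!: bexI[of _ "{}"])
  next
    case (Compl E)
    have "\<exists>A\<in>\<A>. measure M (sym_diff (space M - E) A) < e" if e: "e > 0" for e
    proof -
      obtain A where A: "A \<in> \<A>" "measure M (sym_diff E A) < e" using Compl.IH e by blast
      have "sym_diff (space M - E) (space M - A) = sym_diff E A"
        using sets.sets_into_space[OF As[OF A(1)]] sets.sets_into_space[of E] Compl.IH by blast
      then show ?thesis using A by (intro bexI[of _ "space M - A"]) auto
    qed
    then show ?case using Compl.IH by auto
  next
    case (Union E)
    have Es [measurable]: "E i \<in> sets M" for i using Union.IH by blast
    have "\<exists>A\<in>\<A>. measure M (sym_diff (\<Union>i. E i) A) < e" if e: "e > 0" for e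
    proof -
      have "(\<lambda>n. measure M (\<Union>i<n. E i)) \<longlonglongrightarrow> measure M (\<Union>n. \<Union>i<n. E i)"
        by (rule finite_Lim_measure_incseq) (auto simp: incseq_def intro: order_less_le_trans)
      also have "(\<Union>n. \<Union>i<n. E i) = (\<Union>i. E i)" by blast
      finally have "\<forall>\<^sub>F n in sequentially. measure M (\<Union>i<n. E i) > measure M (\<Union>i. E i) - e / 2"
        using e by (intro order_tendstoD) auto
      then obtain n where n: "measure M (\<Union>i<n. E i) > measure M (\<Union>i. E i) - e / 2"
        by (auto simp: eventually_sequentially)
      \<comment> \<open>Half of \<open>e\<close> pays for the tail of the union after n members; the
        other half is shared by these n members, with \<open>Suc n\<close> avoiding a division by
        zero.\<close>
      have "\<exists>A\<in>\<A>. measure M (sym_diff (E i) A) < e / (2 * real (Suc n))" for i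
        using Union.IH[of i] e by (auto simp del: of_nat_Suc)
      then obtain A where A: "\<And>i. A i \<in> \<A>" "\<And>i. measure M (sym_diff (E i) (A i)) < e / (2 * real (Suc n))"
        by metis
      have [measurable]: "A i \<in> sets M" for i using A As by blast
      let ?A = "\<Union>i<n. A i"
      have "sym_diff (\<Union>i. E i) ?A \<subseteq> ((\<Union>i. E i) - (\<Union>i<n. E i)) \<union> (\<Union>i<n. sym_diff (E i) (A i))" by blast
      then have "measure M (sym_diff (\<Union>i. E i) ?A)
          \<le> measure M (((\<Union>i. E i) - (\<Union>i<n. E i)) \<union> (\<Union>i<n. sym_diff (E i) (A i)))"
        by (rule finite_measure_mono) measurable
      also have "\<dots> \<le> measure M ((\<Union>i. E i) - (\<Union>i<n. E i)) + measure M (\<Union>i<n. sym_diff (E i) (A i))"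
        by (rule measure_subadditive) (auto simp: emeasure_eq_measure)
      also have "measure M ((\<Union>i. E i) - (\<Union>i<n. E i)) = measure M (\<Union>i. E i) - measure M (\<Union>i<n. E i)"
        by (rule finite_measure_Diff) auto
      also have "measure M (\<Union>i<n. sym_diff (E i) (A i)) \<le> (\<Sum>i<n. measure M (sym_diff (E i) (A i)))"
        by (rule finite_measure_subadditive_finite) auto
      also have "\<dots> \<le> (\<Sum>i<n. e / (2 * real (Suc n)))" using A(2) by (intro sum_mono less_imp_le)
      also have "\<dots> \<le> e / 2" using e by (simp add: field_simps)
      finally have "measure M (sym_diff (\<Union>i. E i) ?A) < e" using n by simp
      then show ?thesis using A(1) by (intro bexI[of _ ?A]) auto
    qed
    then show ?case by auto
  qed
  then show ?thesis using e by blast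
qed

definition local_view :: "'g set \<Rightarrow> ('k \<Rightarrow> nat) \<Rightarrow> 'g set \<Rightarrow> ('g \<Rightarrow> 'k) \<Rightarrow> 'g set \<times> ('g \<Rightarrow> nat)" where
  "local_view F \<gamma> T y = (T \<inter> F, \<lambda>g\<in>F. \<gamma> (y g))"

text \<open>Window and alphabet are finite, so only finitely many views occur and \<open>u\<close>
  may be arbitrary without harming measurability. These are the sliding block codes that can also be
  evaluated in a finite model.\<close>

definition local_fun ::
    "('g, 'm) monoid_scheme \<Rightarrow> 'k measure \<Rightarrow> ('g set \<times> ('g set \<Rightarrow> 'k) \<Rightarrow> 'c) \<Rightarrow> bool" where
  "local_fun G K f \<longleftrightarrow> (\<exists>F \<gamma> n u. finite F \<and> F \<subseteq> carrier G \<and> \<gamma> \<in> K \<rightarrow>\<^sub>M count_space UNIV \<and>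
     (\<forall>y\<in>space K. \<gamma> y < n) \<and>
     (\<forall>x\<in>space (Sub_tensor G K). f x = u (local_view F \<gamma> (fst x) (coord G x))))"

lemma measurable_local_view:
  assumes F: "finite F" "F \<subseteq> carrier G" and \<gamma>: "\<gamma> \<in> K \<rightarrow>\<^sub>M count_space UNIV"
    and n: "\<And>y. y \<in> space K \<Longrightarrow> \<gamma> y < (n :: nat)"
  shows "(\<lambda>x. local_view F \<gamma> (fst x) (coord G x)) \<in> Sub_tensor G K \<rightarrow>\<^sub>M count_space UNIV"
proof -
  let ?R = "Pow F \<times> (F \<rightarrow>\<^sub>E {..<n})"
  let ?v = "\<lambda>x. local_view F \<gamma> (fst x) (coord G x)"
  have fin: "finite ?R" using F by (auto intro: finite_PiE)
  have R: "?v x \<in> ?R" if "x \<in> space (Sub_tensor G K)" for x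
    using n coord_in_space[OF that] F by (auto simp: local_view_def)
  have "?v \<in> Sub_tensor G K \<rightarrow>\<^sub>M count_space ?R"
  proof (subst measurable_count_space_eq2[OF fin], intro conjI ballI)
    fix p assume p: "p \<in> ?R"
    have "?v -` {p} \<inter> space (Sub_tensor G K) =
      {x \<in> space (Sub_tensor G K). \<forall>g\<in>F. (g \<in> fst x) = (g \<in> fst p) \<and> \<gamma> (coord G x g) = snd p g}"
    proof -
      have "(T \<inter> F, \<lambda>g\<in>F. \<gamma> (y g)) = p \<longleftrightarrow> (\<forall>g\<in>F. (g \<in> T) = (g \<in> fst p) \<and> \<gamma> (y g) = snd p g)" for T y
      proof -
        have "T \<inter> F = fst p \<longleftrightarrow> (\<forall>g\<in>F. (g \<in> T) = (g \<in> fst p))" using p by auto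
        moreover have "(\<lambda>g\<in>F. \<gamma> (y g)) = snd p \<longleftrightarrow> (\<forall>g\<in>F. \<gamma> (y g) = snd p g)"
          using p by (auto simp: fun_eq_iff restrict_def PiE_def extensional_def)
        ultimately show ?thesis by (auto simp: prod_eq_iff)
      qed
      then show ?thesis by (auto simp: local_view_def)
    qed
    also have "\<dots> \<in> sets (Sub_tensor G K)"
    proof (rule sets.sets_Collect_finite_All[OF _ F(1)])
      fix g assume "g \<in> F"
      then have "g \<in> carrier G" using F by blast
      note [measurable] = measurable_coord[OF this, of K] \<gamma>
      show "{x \<in> space (Sub_tensor G K). (g \<in> fst x) = (g \<in> fst p) \<and> \<gamma> (coord G x g) = snd p g}
          \<in> sets (Sub_tensor G K)" by measurable
    qed
    finally show "?v -` {p} \<inter> space (Sub_tensor G K) \<in> sets (Sub_tensor G K)" .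
  qed (use R in auto)
  then show ?thesis by (rule measurable_compose) (simp add: measurable_count_space_eq1)
qed

lemma measurable_local_fun:
  assumes "local_fun G K f"
  shows "f \<in> Sub_tensor G K \<rightarrow>\<^sub>M count_space UNIV"
proof -
  obtain F \<gamma> n u where F: "finite F" "F \<subseteq> carrier G" "\<gamma> \<in> K \<rightarrow>\<^sub>M count_space UNIV"
    "\<And>y. y \<in> space K \<Longrightarrow> \<gamma> y < (n :: nat)"
    and f: "\<And>x. x \<in> space (Sub_tensor G K) \<Longrightarrow> f x = u (local_view F \<gamma> (fst x) (coord G x))"
    using assms unfolding local_fun_def by metis
  have "(\<lambda>x. u (local_view F \<gamma> (fst x) (coord G x))) \<in> Sub_tensor G K \<rightarrow>\<^sub>M count_space UNIV"
    by (rule measurable_compose[OF measurable_local_view[OF F]]) (simp_all add: measurable_count_space_eq1)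
  then show ?thesis by (subst measurable_cong[OF f])
qed

lemma local_fun_const: "local_fun G K (\<lambda>_. c)"
  unfolding local_fun_def
  by (rule exI[of _ "{}"], rule exI[of _ "\<lambda>_. 0"], rule exI[of _ 1], rule exI[of _ "\<lambda>_. c"]) simp

text \<open>The union of the windows and the product of the alphabets, encoded as pairs, carry both
  views at once.\<close>

lemma local_fun_comb:
  assumes "local_fun G K f" "local_fun G K f'"
  shows "local_fun G K (\<lambda>x. h (f x) (f' x))"
proof -
  obtain F \<gamma> n u where F: "finite F" "F \<subseteq> carrier G" "\<gamma> \<in> K \<rightarrow>\<^sub>M count_space UNIV"
    "\<And>y. y \<in> space K \<Longrightarrow> \<gamma> y < (n :: nat)"
    and f: "\<And>x. x \<in> space (Sub_tensor G K) \<Longrightarrow> f x = u (local_view F \<gamma> (fst x) (coord G x))"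
    using assms(1) unfolding local_fun_def by metis
  obtain F' \<gamma>' n' u' where F': "finite F'" "F' \<subseteq> carrier G" "\<gamma>' \<in> K \<rightarrow>\<^sub>M count_space UNIV"
    "\<And>y. y \<in> space K \<Longrightarrow> \<gamma>' y < (n' :: nat)"
    and f': "\<And>x. x \<in> space (Sub_tensor G K) \<Longrightarrow> f' x = u' (local_view F' \<gamma>' (fst x) (coord G x))"
    using assms(2) unfolding local_fun_def by metis
  let ?\<gamma> = "\<lambda>y. prod_encode (\<gamma> y, \<gamma>' y)"
  define N where "N = Suc (Max (prod_encode ` ({..<n} \<times> {..<n'})))"
  have N: "?\<gamma> y < N" if "y \<in> space K" for y
    unfolding N_def less_Suc_eq_le by (rule Max_ge) (use F(4) F'(4) that in auto)
  define v where "v p = (fst p \<inter> F, \<lambda>g\<in>F. fst (prod_decode (snd p g)))" for p :: "'a set \<times> ('a \<Rightarrow> nat)"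
  define v' where "v' p = (fst p \<inter> F', \<lambda>g\<in>F'. snd (prod_decode (snd p g)))" for p :: "'a set \<times> ('a \<Rightarrow> nat)"
  have v: "local_view F \<gamma> T y = v (local_view (F \<union> F') ?\<gamma> T y)" for T y
    by (auto simp: local_view_def v_def cong: restrict_cong)
  have v': "local_view F' \<gamma>' T y = v' (local_view (F \<union> F') ?\<gamma> T y)" for T y
    by (auto simp: local_view_def v'_def cong: restrict_cong)
  have m: "?\<gamma> \<in> K \<rightarrow>\<^sub>M count_space UNIV"
    using F(3) F'(3) by measurable
  show ?thesis unfolding local_fun_def
    by (rule exI[of _ "F \<union> F'"], rule exI[of _ ?\<gamma>], rule exI[of _ N],
        rule exI[of _ "\<lambda>p. h (u (v p)) (u' (v' p))"])
       (use F F' N m in \<open>simp add: f f' v v'\<close>)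
qed

lemma local_fun_mem:
  assumes "g \<in> carrier G" shows "local_fun G K (\<lambda>x. g \<in> fst x)"
  unfolding local_fun_def
  by (rule exI[of _ "{g}"], rule exI[of _ "\<lambda>_. 0"], rule exI[of _ 1], rule exI[of _ "\<lambda>p. g \<in> fst p"])
     (use assms in \<open>auto simp: local_view_def\<close>)

lemma local_fun_coord:
  assumes "g \<in> carrier G" "Z \<in> sets K" shows "local_fun G K (\<lambda>x. coord G x g \<in> Z)"
  unfolding local_fun_def
  by (rule exI[of _ "{g}"], rule exI[of _ "\<lambda>y. if y \<in> Z then 1 else 0"], rule exI[of _ 2],
      rule exI[of _ "\<lambda>p. snd p g = 1"])
     (use assms in \<open>auto simp: local_view_def\<close>)

definition local_sets :: "('g, 'm) monoid_scheme \<Rightarrow> 'k measure \<Rightarrow> ('g set \<times> ('g set \<Rightarrow> 'k)) set set" where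
  "local_sets G K = {{x \<in> space (Sub_tensor G K). P x} | P. local_fun G K P}"

lemma local_setsI: "local_fun G K P \<Longrightarrow> {x \<in> space (Sub_tensor G K). P x} \<in> local_sets G K"
  by (auto simp: local_sets_def)

lemma algebra_local_sets: "algebra (space (Sub_tensor G K)) (local_sets G K)"
proof (subst algebra_iff_Un, intro conjI ballI)
  show "local_sets G K \<subseteq> Pow (space (Sub_tensor G K))" by (auto simp: local_sets_def)
  show "{} \<in> local_sets G K"
    by (auto simp: local_sets_def intro!: exI[of _ "\<lambda>_. False"] local_fun_const)
  fix A assume "A \<in> local_sets G K"
  then obtain P where P: "A = {x \<in> space (Sub_tensor G K). P x}" "local_fun G K P"
    by (auto simp: local_sets_def)
  have eq: "space (Sub_tensor G K) - A = {x \<in> space (Sub_tensor G K). \<not> P x}" using P by auto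
  then show "space (Sub_tensor G K) - A \<in> local_sets G K"
    using local_setsI[OF local_fun_comb[OF P(2) P(2), of "\<lambda>a b. \<not> a"]] by (simp only: eq)
  fix B assume "B \<in> local_sets G K"
  then obtain Q where Q: "B = {x \<in> space (Sub_tensor G K). Q x}" "local_fun G K Q"
    by (auto simp: local_sets_def)
  have eq': "A \<union> B = {x \<in> space (Sub_tensor G K). P x \<or> Q x}" using P Q by auto
  then show "A \<union> B \<in> local_sets G K"
    using local_setsI[OF local_fun_comb[OF P(2) Q(2), of "(\<or>)"]] by (simp only: eq')
qed

text \<open>Events about one membership or one coordinate are local, and they already make the
  embedding measurable for the generated sigma-algebra. Every measurable set is a preimage under the
  embedding.\<close>

lemma (in group) sets_Sub_tensor_eq_sigma_local:
  assumes C: "countable (carrier G)"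
  shows "sets (Sub_tensor G K) = sigma_sets (space (Sub_tensor G K)) (local_sets G K)"
proof
  let ?X = "space (Sub_tensor G K)"
  have "local_sets G K \<subseteq> sets (Sub_tensor G K)"
  proof
    fix A assume "A \<in> local_sets G K"
    then obtain P where P: "A = {x \<in> ?X. P x}" "local_fun G K P" by (auto simp: local_sets_def)
    show "A \<in> sets (Sub_tensor G K)"
      using measurable_local_fun[OF P(2)] unfolding P(1) by (simp add: pred_def)
  qed
  then show "sigma_sets ?X (local_sets G K) \<subseteq> sets (Sub_tensor G K)" by (rule sets.sigma_sets_subset)
  define S where "S = sigma ?X (local_sets G K)"
  have sub: "local_sets G K \<subseteq> Pow ?X" by (auto simp: local_sets_def)
  have sS: "space S = ?X" "sets S = sigma_sets ?X (local_sets G K)"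
    using sub by (auto simp: S_def space_measure_of_conv sets_measure_of)
  have in_S: "{x \<in> ?X. P x} \<in> sets S" if "local_fun G K P" for P
    using that unfolding sS(2) local_sets_def by blast
  have "(\<lambda>x. (fst x, \<lambda>g\<in>carrier G. coord G x g)) \<in> S \<rightarrow>\<^sub>M borel_of (Sub_topology G) \<Otimes>\<^sub>M (\<Pi>\<^sub>M g\<in>carrier G. K)"
  proof (intro measurable_Pair measurable_restrict)
    show "fst \<in> S \<rightarrow>\<^sub>M borel_of (Sub_topology G)"
      by (rule measurable_into_Sub[OF C]) (auto simp: sS(1) intro!: in_S local_fun_mem subgroup_fst_Sub_tensor)
    fix g assume g: "g \<in> carrier G"
    show "(\<lambda>x. coord G x g) \<in> S \<rightarrow>\<^sub>M K"
    proof (rule measurableI)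
      fix Z assume "Z \<in> sets K"
      then have "{x \<in> ?X. coord G x g \<in> Z} \<in> sets S" by (intro in_S local_fun_coord g)
      moreover have "(\<lambda>x. coord G x g) -` Z \<inter> space S = {x \<in> ?X. coord G x g \<in> Z}" by (auto simp: sS)
      ultimately show "(\<lambda>x. coord G x g) -` Z \<inter> space S \<in> sets S" by simp
    qed (use coord_in_space g in \<open>auto simp: sS(1)\<close>)
  qed
  then have "Sub_tensor_embed G \<in> S \<rightarrow>\<^sub>M borel_of (Sub_topology G) \<Otimes>\<^sub>M (\<Pi>\<^sub>M g\<in>carrier G. K)"
    by (simp add: Sub_tensor_embed_eq[abs_def])
  note me = this
  show "sets (Sub_tensor G K) \<subseteq> sigma_sets ?X (local_sets G K)"
  proof
    fix E assume "E \<in> sets (Sub_tensor G K)"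
    then obtain B where B: "B \<in> sets (borel_of (Sub_topology G) \<Otimes>\<^sub>M (\<Pi>\<^sub>M g\<in>carrier G. K))"
      and E: "E = Sub_tensor_embed G -` B \<inter> ?X"
      using Sub_tensor_embed_in_space[of G K] unfolding Sub_tensor_def by (auto simp: sets_vimage_algebra2)
    show "E \<in> sigma_sets ?X (local_sets G K)"
      using measurable_sets[OF me B] by (simp add: E sS)
  qed
qed

lemma sets_neq_nat:
  fixes f g :: "'a \<Rightarrow> nat"
  assumes "f \<in> M \<rightarrow>\<^sub>M count_space UNIV" "g \<in> M \<rightarrow>\<^sub>M count_space UNIV"
  shows "{x \<in> space M. f x \<noteq> g x} \<in> sets M"
proof -
  have "(\<lambda>x. real (f x)) \<in> borel_measurable M" "(\<lambda>x. real (g x)) \<in> borel_measurable M"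
    using assms by (auto intro: measurable_compose)
  from borel_measurable_neq[OF this] show ?thesis by simp
qed

text \<open>Induction on the number of values: the top level set is approximated by a local set,
  which then overrides an approximation of the function with its top value replaced by 0. Each of
  the two errors receives half of \<open>e\<close>.\<close>

lemma (in group) local_fun_approximation:
  fixes f :: "'a set \<times> ('a set \<Rightarrow> 'k) \<Rightarrow> nat"
  assumes C: "countable (carrier G)" and \<eta>: "\<eta> \<in> borel_prob_measures (Sub_topology G)"
    and \<kappa>: "prob_space \<kappa>"
    and f: "f \<in> Sub_tensor G \<kappa> \<rightarrow>\<^sub>M count_space UNIV"
    and bound: "\<And>x. x \<in> space (Sub_tensor G \<kappa>) \<Longrightarrow> f x < Suc n" and e: "0 < e"
  shows "\<exists>w. local_fun G \<kappa> w \<and> (\<forall>x. w x < Suc n) \<and>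
    measure (Sub_tensor_measure G \<eta> \<kappa>) {x \<in> space (Sub_tensor G \<kappa>). f x \<noteq> w x} < e"
  using f bound e
proof (induction n arbitrary: f e)
  case 0
  have E: "{x \<in> space (Sub_tensor G \<kappa>). f x \<noteq> 0} = {}" using 0(2) by auto
  show ?case
    by (rule exI[of _ "\<lambda>_. 0"], unfold E) (use 0(3) local_fun_const in simp)
next
  case (Suc n)
  let ?M = "Sub_tensor_measure G \<eta> \<kappa>"
  let ?X = "space (Sub_tensor G \<kappa>)"
  interpret M: prob_space ?M by (rule prob_space_Sub_tensor_measure[OF \<eta> \<kappa>])
  note [measurable] = Suc.prems(1)
  define f' where "f' x = (if f x = Suc n then 0 else f x)" for x
  have f': "f' \<in> Sub_tensor G \<kappa> \<rightarrow>\<^sub>M count_space UNIV" unfolding f'_def by measurable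
  have "f' x < Suc n" if "x \<in> ?X" for x using Suc.prems(2)[OF that] by (auto simp: f'_def)
  then obtain w where w: "local_fun G \<kappa> w" "\<And>x. w x < Suc n" "measure ?M {x \<in> ?X. f' x \<noteq> w x} < e / 2"
    using Suc.IH[OF f', of "e / 2"] Suc.prems(3) by auto
  let ?E = "{x \<in> ?X. f x = Suc n}"
  have E: "?E \<in> sets ?M" by simp
  have "\<exists>A\<in>local_sets G \<kappa>. measure ?M (sym_diff ?E A) < e / 2"
    using Suc.prems(3) sets_Sub_tensor_eq_sigma_local[OF C] algebra_local_sets
    by (intro M.approximation_by_algebra E) auto
  then obtain P where P: "local_fun G \<kappa> P" "measure ?M (sym_diff ?E {x \<in> ?X. P x}) < e / 2"
    by (auto simp: local_sets_def)
  note [measurable] = measurable_local_fun[OF P(1)] measurable_local_fun[OF w(1)] f'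
  have S1: "{x \<in> ?X. f' x \<noteq> w x} \<in> sets ?M"
    using sets_neq_nat[OF f' measurable_local_fun[OF w(1)]] by simp
  have "{x \<in> ?X. P x} \<in> sets ?M"
    using measurable_local_fun[OF P(1)] by (simp add: pred_def)
  then have S2: "sym_diff ?E {x \<in> ?X. P x} \<in> sets ?M" using E by blast
  have "{x \<in> ?X. f x \<noteq> (if P x then Suc n else w x)}
      \<subseteq> {x \<in> ?X. f' x \<noteq> w x} \<union> sym_diff ?E {x \<in> ?X. P x}"
    by (auto simp: f'_def)
  then have "measure ?M {x \<in> ?X. f x \<noteq> (if P x then Suc n else w x)}
      \<le> measure ?M ({x \<in> ?X. f' x \<noteq> w x} \<union> sym_diff ?E {x \<in> ?X. P x})"
    by (rule M.finite_measure_mono) (rule sets.Un[OF S1 S2])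
  also have "\<dots> \<le> measure ?M {x \<in> ?X. f' x \<noteq> w x} + measure ?M (sym_diff ?E {x \<in> ?X. P x})"
    by (rule measure_subadditive[OF S1 S2]) (auto simp: M.emeasure_eq_measure)
  also have "\<dots> < e" using w(3) P(2) by simp
  finally have "measure ?M {x \<in> ?X. f x \<noteq> (if P x then Suc n else w x)} < e" .
  moreover have "local_fun G \<kappa> (\<lambda>x. if P x then Suc n else w x)"
    using local_fun_comb[OF P(1) w(1), of "\<lambda>p k. if p then Suc n else k"] .
  ultimately show ?case
    using w(2) by (intro exI[of _ "\<lambda>x. if P x then Suc n else w x"]) (auto simp: less_Suc_eq)
qed

section \<open>Transfer along sofic approximations\<close>

lemma prob_integral_bounds:
  fixes f :: "'a \<Rightarrow> real"
  assumes N: "prob_space N" and f: "\<And>x. x \<in> space N \<Longrightarrow> f x \<le> M" and M: "0 \<le> M"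
  shows "(\<integral>x. f x \<partial>N) \<le> M"
proof (cases "integrable N f")
  case True
  then show ?thesis using f by (intro prob_space.integral_le_const[OF N]) (auto intro: AE_I2)
qed (use M in \<open>simp add: not_integrable_integral_eq\<close>)

text \<open>The law of \<open>x \<circ> (\<lambda>g. \<sigma> g q)\<close> on \<open>J\<close> depends only on which of the points \<open>\<sigma> g q\<close> coincide; at a
  point \<open>q\<close> where \<open>\<sigma>\<close> is multiplicative on \<open>P\<close> this is read off \<open>Stab\<^sub>\<sigma>(q) \<inter> S\<close>, exactly as for the
  cosets of a subgroup.\<close>

lemma (in group) sofic_transfer:
  fixes h :: "'a set \<Rightarrow> ('a \<Rightarrow> 'k) \<Rightarrow> real"
  assumes \<eta>: "\<eta> \<in> borel_prob_measures (Sub_topology G)" and sofic: "sofic_measure G \<eta>"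
    and \<kappa>: "prob_space \<kappa>"
    and h0: "\<And>T y. 0 \<le> h T y" and hM: "\<And>T y. h T y \<le> M"
    and J: "finite J" "J \<subseteq> carrier G" and S: "finite S" "S \<subseteq> carrier G"
    and JS: "\<And>i j. i \<in> J \<Longrightarrow> j \<in> J \<Longrightarrow> inv i \<otimes> j \<in> S"
    and hT: "\<And>T y. h T y = h (T \<inter> S) y"
    and hy: "\<And>T y y'. (\<And>j. j \<in> J \<Longrightarrow> y j = y' j) \<Longrightarrow> h T y = h T y'"
    and hmeas: "\<And>T. (\<lambda>y. h T y) \<in> borel_measurable (\<Pi>\<^sub>M j\<in>J. \<kappa>)"
    and P: "finite P" "P \<subseteq> carrier G" "J \<subseteq> P" "S \<subseteq> P" and \<tau>: "0 < \<tau>"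
  shows "\<exists>d>0. \<exists>\<sigma>. (\<forall>g\<in>carrier G. \<sigma> g permutes {1..d}) \<and>
    (\<forall>c. (\<forall>q\<in>{1..d}. \<forall>x\<in>space (\<Pi>\<^sub>M i\<in>{1..d}. \<kappa>). c q x \<le> M \<and>
        ((\<forall>g\<in>P. \<forall>g'\<in>P. \<sigma> g (\<sigma> g' q) = \<sigma> (g \<otimes> g') q) \<longrightarrow>
          c q x = h (Stab_map G \<sigma> q) (\<lambda>g. x (\<sigma> g q)))) \<longrightarrow>
      (\<Sum>q\<in>{1..d}. \<integral>x. c q x \<partial>(\<Pi>\<^sub>M i\<in>{1..d}. \<kappa>)) \<le>
        real d * ((\<integral>x. h (fst x) (coord G x) \<partial>Sub_tensor_measure G \<eta> \<kappa>) + \<tau>))"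
proof -
  let ?X = "subset_topology G"
  let ?M = "Sub_tensor_measure G \<eta> \<kappa>"
  have s\<eta>: "sets \<eta> = sets (borel_of (Sub_topology G))" using \<eta> by (simp add: borel_prob_measures_def)
  have sp: "space \<eta> = {H. subgroup H G}" by (rule space_borel_prob_measure_Sub[OF \<eta>])
  have P\<eta>: "prob_space \<eta>" using \<eta> by (simp add: borel_prob_measures_def)
  interpret M: prob_space ?M by (rule prob_space_Sub_tensor_measure[OF \<eta> \<kappa>])
  have M0: "0 \<le> M" using h0 hM order_trans by blast
  define law where "law H = distr (\<Pi>\<^sub>M C\<in>lcosets H. \<kappa>) (\<Pi>\<^sub>M j\<in>J. \<kappa>) (\<lambda>\<omega>. \<lambda>j\<in>J. \<omega> (j <# H))" for H
  define e where "e H = (\<integral>y. h H y \<partial>law H)" for H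
  have cosets: "(\<lambda>j. j <# H) \<in> J \<rightarrow> lcosets H" for H using J by (auto simp: LCOSETS_def)
  have m1: "(\<lambda>\<omega>. \<lambda>j\<in>J. \<omega> (j <# H)) \<in> (\<Pi>\<^sub>M C\<in>lcosets H. \<kappa>) \<rightarrow>\<^sub>M (\<Pi>\<^sub>M j\<in>J. \<kappa>)" for H
    using cosets by (intro measurable_restrict measurable_component_singleton) auto
  have Plaw: "prob_space (law H)" for H
    unfolding law_def by (intro prob_space.prob_space_distr prob_space_PiM \<kappa> m1)
  have e0: "0 \<le> e H" and eM: "e H \<le> M" for H
    unfolding e_def using h0 hM by (auto intro!: prob_integral_bounds[OF Plaw] M0)
  \<comment> \<open>Consequently the conditional mean \<open>e\<close> is a function of a finite
    trace, hence continuous and visible to weak* neighbourhoods.\<close>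
  have law_cong: "law H = law H'" and e_cong: "e H = e H'"
    if "subgroup H G" "subgroup H' G" "H \<inter> S = H' \<inter> S" for H H'
  proof -
    have "i <# H = j <# H \<longleftrightarrow> i <# H' = j <# H'" if "i \<in> J" "j \<in> J" for i j
    proof -
      have "inv i \<otimes> j \<in> H \<longleftrightarrow> inv i \<otimes> j \<in> H'" using JS[OF that] \<open>H \<inter> S = H' \<inter> S\<close> by blast
      moreover have c: "i \<in> carrier G" "j \<in> carrier G" using that J by auto
      ultimately show ?thesis
        unfolding lcoset_eq_iff[OF \<open>subgroup H G\<close> c] lcoset_eq_iff[OF \<open>subgroup H' G\<close> c] by blast
    qed
    then show l: "law H = law H'" unfolding law_def by (rule iid_pullback_cong[OF \<kappa> cosets cosets])
    have "h H = h H'" using hT[of H] hT[of H'] that(3) by (auto simp: fun_eq_iff)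
    then show "e H = e H'" by (simp add: e_def l)
  qed
  \<comment> \<open>Only an upper bound is needed, so traces \<open>Q\<close> of sets that are not traces of subgroups get \<open>M\<close>.\<close>
  define p where "p Q = (if \<exists>H. subgroup H G \<and> H \<inter> S = Q
    then e (SOME H. subgroup H G \<and> H \<inter> S = Q) else M)" for Q
  have pH: "p (H \<inter> S) = e H" if H: "subgroup H G" for H
  proof -
    have "\<exists>H'. subgroup H' G \<and> H' \<inter> S = H \<inter> S" using H by blast
    moreover from someI_ex[OF this]
    have "e (SOME H'. subgroup H' G \<and> H' \<inter> S = H \<inter> S) = e H" using H by (blast intro: e_cong)
    ultimately show ?thesis by (simp add: p_def)
  qed
  have p0: "0 \<le> p Q" and pM: "p Q \<le> M" for Q using e0 eM M0 by (auto simp: p_def)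
  have cont: "continuous_map ?X euclideanreal (\<lambda>T. p (T \<inter> S))"
    by (rule continuous_map_finite_dependence[OF S])
  have pm: "(\<lambda>T. p (T \<inter> S)) \<in> borel_measurable (borel_of ?X)"
  proof (rule borel_measurableI)
    fix U :: "real set" assume "open U"
    then have "openin ?X {T \<in> topspace ?X. p (T \<inter> S) \<in> U}"
      using cont by (intro openin_continuous_map_preimage[OF cont]) simp
    then show "(\<lambda>T. p (T \<inter> S)) -` U \<inter> space (borel_of ?X) \<in> sets (borel_of ?X)"
      using open_in_borel_of by (simp add: vimage_def Int_def conj_commute)
  qed
  have incl: "(\<lambda>H. H) \<in> \<eta> \<rightarrow>\<^sub>M borel_of ?X"
    using measurable_Sub_inclusion by (simp add: measurable_cong_sets[OF s\<eta> refl])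
  have pm\<eta>: "(\<lambda>T. p (T \<inter> S)) \<in> borel_measurable \<eta>" by (rule measurable_compose[OF incl pm])
  have finQ: "finite (Pow S)" using S by simp
  have cyl: "(\<lambda>H. H \<inter> S) \<in> borel_of (Sub_topology G) \<rightarrow>\<^sub>M count_space (Pow S)"
  proof (subst measurable_count_space_eq2[OF finQ], intro conjI ballI)
    fix Q assume Q: "Q \<in> Pow S"
    have "(\<lambda>H. H \<inter> S) -` {Q} \<inter> space (borel_of (Sub_topology G))
      = {H \<in> space (borel_of (Sub_topology G)). \<forall>g\<in>S. (g \<in> H) = (g \<in> Q)}" using Q by auto
    also have "\<dots> \<in> sets (borel_of (Sub_topology G))"
      by (rule sets.sets_Collect_finite_All[OF _ S(1)]) measurable
    finally show "(\<lambda>H. H \<inter> S) -` {Q} \<inter> space (borel_of (Sub_topology G)) \<in> sets (borel_of (Sub_topology G))" .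
  qed auto
  let ?c = "\<lambda>x. h (fst x) (coord G x)"
  have cJ: "(\<lambda>x. \<lambda>j\<in>J. coord G x j) \<in> Sub_tensor G \<kappa> \<rightarrow>\<^sub>M (\<Pi>\<^sub>M j\<in>J. \<kappa>)"
    using J by (intro measurable_restrict measurable_coord) auto
  have hc: "?c = (\<lambda>x. h (fst x \<inter> S) (\<lambda>j\<in>J. coord G x j))"
    by (rule ext, subst hT, rule hy) simp
  have hcm: "?c \<in> borel_measurable (Sub_tensor G \<kappa>)"
    unfolding hc
    by (rule measurable_compose_countable'[OF _ measurable_compose[OF measurable_fst_Sub_tensor cyl]
          countable_finite[OF finQ]]) (rule measurable_compose[OF cJ hmeas])
  have inner: "(\<integral>\<^sup>+\<omega>. ennreal (h H (coord G (H, \<omega>))) \<partial>(\<Pi>\<^sub>M C\<in>lcosets H. \<kappa>)) = ennreal (p (H \<inter> S))"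
    if H: "subgroup H G" for H
  proof -
    have "(\<integral>\<^sup>+\<omega>. ennreal (h H (coord G (H, \<omega>))) \<partial>(\<Pi>\<^sub>M C\<in>lcosets H. \<kappa>))
      = (\<integral>\<^sup>+\<omega>. ennreal (h H (\<lambda>j\<in>J. \<omega> (j <# H))) \<partial>(\<Pi>\<^sub>M C\<in>lcosets H. \<kappa>))"
      by (rule nn_integral_cong, rule arg_cong[where f = ennreal], rule hy) (simp add: coord_def)
    also have "\<dots> = (\<integral>\<^sup>+y. ennreal (h H y) \<partial>law H)"
      unfolding law_def by (rule nn_integral_distr[symmetric, OF m1]) (use hmeas in simp)
    also have "\<dots> = ennreal (e H)"
      unfolding e_def
    proof (rule nn_integral_eq_integral)
      interpret L: prob_space "law H" by (rule Plaw)
      show "integrable (law H) (h H)"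
        by (rule L.integrable_const_bound[of _ M]) (use h0 hM hmeas in \<open>auto simp: law_def\<close>)
    qed (use h0 in auto)
    finally show ?thesis by (simp add: pH[OF H])
  qed
  have int_eq: "(\<integral>x. ?c x \<partial>?M) = (\<integral>H. p (H \<inter> S) \<partial>\<eta>)"
  proof -
    have "(\<integral>x. ?c x \<partial>?M) = enn2real (\<integral>\<^sup>+x. ennreal (?c x) \<partial>?M)"
      by (rule integral_eq_nn_integral) (use hcm h0 in auto)
    also have "(\<integral>\<^sup>+x. ennreal (?c x) \<partial>?M)
        = (\<integral>\<^sup>+H. \<integral>\<^sup>+\<omega>. ennreal (?c (H, \<omega>)) \<partial>(\<Pi>\<^sub>M C\<in>lcosets H. \<kappa>) \<partial>\<eta>)"
      by (rule nn_integral_Sub_tensor_measure[OF \<eta> \<kappa>]) (use hcm in simp)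
    also have "\<dots> = (\<integral>\<^sup>+H. ennreal (p (H \<inter> S)) \<partial>\<eta>)"
      by (rule nn_integral_cong) (use inner in \<open>auto simp: sp\<close>)
    also have "enn2real \<dots> = (\<integral>H. p (H \<inter> S) \<partial>\<eta>)"
      by (rule integral_eq_nn_integral[symmetric]) (use pm\<eta> p0 in auto)
    finally show ?thesis .
  qed
  define I where "I = (\<integral>H. p (H \<inter> S) \<partial>\<eta>)"
  let ?\<eta>' = "distr \<eta> (borel_of ?X) (\<lambda>H. H)"
  \<comment> \<open>A one-sided condition suffices for an upper bound. Half of \<tau> is spent here,
    the other half on points where \<sigma> is not multiplicative.\<close>
  define \<Omega> where "\<Omega> = {\<mu> \<in> borel_prob_measures ?X. (\<integral>T. p (T \<inter> S) \<partial>\<mu>) \<in> {..<I + \<tau> / 2}}"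
  have "openin (weak_star_topology ?X) \<Omega>"
    unfolding weak_star_topology_def
    by (rule topology_generated_by_Basis) (use cont in \<open>auto simp: \<Omega>_def intro!: exI[of _ "\<lambda>T. p (T \<inter> S)"] exI[of _ "{..<I + \<tau> / 2}"]\<close>)
  moreover have "?\<eta>' \<in> \<Omega>"
    using prob_space.prob_space_distr[OF P\<eta> incl] \<tau> integral_distr[OF incl pm]
    by (auto simp: \<Omega>_def borel_prob_measures_def I_def)
  \<comment> \<open>Chosen so that \<open>M\<close> times the proportion of bad points, at most
    \<open>(card P)^2 * \<delta>\<close>, stays below half of \<tau>; the added ones keep the
    denominator positive.\<close>
  moreover define \<delta> where "\<delta> = \<tau> / (2 * (M + 1) * (real (card P) ^ 2 + 1))"
  then have "0 < \<delta>" using \<tau> M0 by (auto intro!: divide_pos_pos mult_pos_pos add_nonneg_pos)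
  ultimately have "\<exists>d>0. \<exists>\<sigma>. (\<forall>g\<in>carrier G. \<sigma> g permutes {1..d}) \<and>
      (\<forall>g\<in>P. \<forall>h\<in>P. real (card {q \<in> {1..d}. \<sigma> g (\<sigma> h q) = \<sigma> (g \<otimes> h) q}) / real d \<ge> 1 - \<delta>) \<and>
      distr (uniform_count_measure {1..d}) (borel_of ?X) (Stab_map G \<sigma>) \<in> \<Omega>"
    using P(1,2) by (intro sofic[unfolded sofic_measure_def, rule_format]) auto
  then obtain d \<sigma> where d: "d > 0" and perm: "\<And>g. g \<in> carrier G \<Longrightarrow> \<sigma> g permutes {1..d}"
    and mult: "\<And>g g'. g \<in> P \<Longrightarrow> g' \<in> P \<Longrightarrow>
      real (card {q \<in> {1..d}. \<sigma> g (\<sigma> g' q) = \<sigma> (g \<otimes> g') q}) / real d \<ge> 1 - \<delta>"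
    and stab: "distr (uniform_count_measure {1..d}) (borel_of ?X) (Stab_map G \<sigma>) \<in> \<Omega>"
    by blast
  let ?U = "uniform_count_measure {1..d}"
  let ?PP = "\<Pi>\<^sub>M i\<in>{1..d}. \<kappa>"
  have PPP: "prob_space ?PP" by (intro prob_space_PiM \<kappa>)
  have stm: "Stab_map G \<sigma> \<in> ?U \<rightarrow>\<^sub>M borel_of ?X"
    by (rule measurableI) (auto simp: Stab_map_def topspace_subset_topology space_uniform_count_measure sets_uniform_count_measure)
  have "(\<integral>T. p (T \<inter> S) \<partial>distr ?U (borel_of ?X) (Stab_map G \<sigma>)) = (\<integral>q. p (Stab_map G \<sigma> q \<inter> S) \<partial>?U)"
    by (rule integral_distr[OF stm pm])
  also have "\<dots> = (\<Sum>q\<in>{1..d}. p (Stab_map G \<sigma> q \<inter> S)) / d"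
    by (simp add: integral_uniform_count_measure)
  finally have "(\<Sum>q\<in>{1..d}. p (Stab_map G \<sigma> q \<inter> S)) / d < I + \<tau> / 2"
    using stab by (simp add: \<Omega>_def)
  then have sum_p: "(\<Sum>q\<in>{1..d}. p (Stab_map G \<sigma> q \<inter> S)) \<le> d * (I + \<tau> / 2)"
    using d by (simp add: divide_less_eq mult.commute)
  define bad where "bad = {q \<in> {1..d}. \<not> (\<forall>g\<in>P. \<forall>g'\<in>P. \<sigma> g (\<sigma> g' q) = \<sigma> (g \<otimes> g') q)}"
  let ?N = "\<lambda>gg. {q \<in> {1..d}. \<sigma> (fst gg) (\<sigma> (snd gg) q) \<noteq> \<sigma> (fst gg \<otimes> snd gg) q}"
  \<comment> \<open>Union bound over the pairs in \<open>P \<times> P\<close>, one for each product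
    that may fail.\<close>
  have "bad \<subseteq> (\<Union>gg\<in>P \<times> P. ?N gg)"
  proof
    fix q assume "q \<in> bad"
    then obtain g g' where "q \<in> {1..d}" "g \<in> P" "g' \<in> P" "\<sigma> g (\<sigma> g' q) \<noteq> \<sigma> (g \<otimes> g') q"
      unfolding bad_def by blast
    then show "q \<in> (\<Union>gg\<in>P \<times> P. ?N gg)" by (intro UN_I[of "(g, g')"]) auto
  qed
  then have "card bad \<le> card (\<Union>gg\<in>P \<times> P. ?N gg)"
    by (rule card_mono[rotated]) (use P(1) in auto)
  also have "\<dots> \<le> (\<Sum>gg\<in>P \<times> P. card (?N gg))"
    using P(1) by (intro card_UN_le) simp
  finally have "card bad \<le> (\<Sum>gg\<in>P \<times> P. card (?N gg))" .
  then have "real (card bad) \<le> (\<Sum>gg\<in>P \<times> P. real (card {q \<in> {1..d}. \<sigma> (fst gg) (\<sigma> (snd gg) q) \<noteq> \<sigma> (fst gg \<otimes> snd gg) q}))"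
    by (simp only: of_nat_sum[symmetric] of_nat_le_iff)
  also have "\<dots> \<le> (\<Sum>gg\<in>P \<times> P. \<delta> * d)"
  proof (rule sum_mono)
    fix gg assume gg: "gg \<in> P \<times> P"
    let ?A = "{q \<in> {1..d}. \<sigma> (fst gg) (\<sigma> (snd gg) q) = \<sigma> (fst gg \<otimes> snd gg) q}"
    have "{q \<in> {1..d}. \<sigma> (fst gg) (\<sigma> (snd gg) q) \<noteq> \<sigma> (fst gg \<otimes> snd gg) q} = {1..d} - ?A" by auto
    moreover have "card ({1..d} - ?A) = d - card ?A" by (subst card_Diff_subset) auto
    moreover have "card ?A \<le> card {1..d}" by (rule card_mono) auto
    moreover have "real (card ?A) \<ge> (1 - \<delta>) * d" using mult[of "fst gg" "snd gg"] gg d by (auto simp: pos_le_divide_eq)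
    ultimately show "real (card {q \<in> {1..d}. \<sigma> (fst gg) (\<sigma> (snd gg) q) \<noteq> \<sigma> (fst gg \<otimes> snd gg) q}) \<le> \<delta> * d"
      by (simp add: of_nat_diff algebra_simps)
  qed
  also have "\<dots> = real (card P) ^ 2 * \<delta> * d" by (simp add: power2_eq_square card_cartesian_product)
  finally have "M * real (card bad) \<le> (M + 1) * (real (card P) ^ 2 * \<delta> * d)"
    using M0 by (intro mult_mono) auto
  also have "\<dots> \<le> d * (\<tau> / 2)"
  proof -
    have "(M + 1) * (real (card P) ^ 2 * \<delta>) \<le> (M + 1) * ((real (card P) ^ 2 + 1) * \<delta>)"
      using M0 \<open>0 < \<delta>\<close> by (intro mult_left_mono mult_right_mono) auto
    also have "\<dots> = \<tau> / 2"
    proof -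
      have "M + 1 \<noteq> 0" "real (card P) ^ 2 + 1 \<noteq> 0" using M0 by (auto simp: add_nonneg_eq_0_iff)
      moreover have "a * (b * (t / (2 * a * b))) = t / 2" if "a \<noteq> 0" "b \<noteq> 0" for a b t :: real
        using that by (simp add: field_simps)
      ultimately show ?thesis unfolding \<delta>_def by blast
    qed
    finally have "(M + 1) * (real (card P) ^ 2 * \<delta>) * d \<le> \<tau> / 2 * d" by (rule mult_right_mono) simp
    then show ?thesis by (simp add: mult_ac)
  qed
  finally have bad: "M * real (card bad) \<le> d * (\<tau> / 2)" .
  have good_bound: "(\<integral>x. h (Stab_map G \<sigma> q) (\<lambda>g. x (\<sigma> g q)) \<partial>?PP) \<le> p (Stab_map G \<sigma> q \<inter> S)"
    if q: "q \<in> {1..d}" "q \<notin> bad" for q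
  proof (cases "\<exists>H. subgroup H G \<and> H \<inter> S = Stab_map G \<sigma> q \<inter> S")
    case False
    then have "p (Stab_map G \<sigma> q \<inter> S) = M" by (simp only: p_def if_False)
    moreover have "(\<integral>x. h (Stab_map G \<sigma> q) (\<lambda>g. x (\<sigma> g q)) \<partial>?PP) \<le> M"
      by (rule prob_integral_bounds[OF PPP hM M0])
    ultimately show ?thesis by simp
  next
    case True
    let ?T = "Stab_map G \<sigma> q"
    obtain H where H: "subgroup H G" "H \<inter> S = ?T \<inter> S" using True by blast
    have into: "(\<lambda>j. \<sigma> j q) \<in> J \<rightarrow> {1..d}" 
    proof
      fix j assume "j \<in> J"
      then have "\<sigma> j permutes {1..d}" using J perm by blast
      then show "\<sigma> j q \<in> {1..d}" using q(1) by (simp only: permutes_in_image)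
    qed
    have m2: "(\<lambda>x. \<lambda>j\<in>J. x (\<sigma> j q)) \<in> ?PP \<rightarrow>\<^sub>M (\<Pi>\<^sub>M j\<in>J. \<kappa>)"
      using into by (intro measurable_restrict measurable_component_singleton) auto
    \<comment> \<open>Multiplicativity at q is applied to i and \<open>inv i \<otimes> j\<close>,
      whose product is j; injectivity of \<open>\<sigma> i\<close> then cancels i.\<close>
    have "\<sigma> i q = \<sigma> j q \<longleftrightarrow> i <# H = j <# H" if ij: "i \<in> J" "j \<in> J" for i j
    proof -
      have c: "i \<in> carrier G" "j \<in> carrier G" using ij J by auto
      have k: "inv i \<otimes> j \<in> S" by (rule JS[OF ij])
      then have "i \<in> P" "inv i \<otimes> j \<in> P" using ij P by auto
      then have "\<sigma> i (\<sigma> (inv i \<otimes> j) q) = \<sigma> (i \<otimes> (inv i \<otimes> j)) q"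
        using q unfolding bad_def by blast
      also have "i \<otimes> (inv i \<otimes> j) = j" using c by (simp add: m_assoc[symmetric])
      finally have s: "\<sigma> i (\<sigma> (inv i \<otimes> j) q) = \<sigma> j q" .
      have "i <# H = j <# H \<longleftrightarrow> inv i \<otimes> j \<in> ?T" using lcoset_eq_iff[OF H(1) c] H(2) k by blast
      also have "\<dots> \<longleftrightarrow> \<sigma> (inv i \<otimes> j) q = q" using c by (simp add: Stab_map_def)
      also have "\<dots> \<longleftrightarrow> \<sigma> i (\<sigma> (inv i \<otimes> j) q) = \<sigma> i q"
        by (simp only: inj_eq[OF permutes_inj[OF perm[OF c(1)]]])
      finally show ?thesis unfolding s by (simp only: eq_commute)
    qed
    then have "distr ?PP (\<Pi>\<^sub>M j\<in>J. \<kappa>) (\<lambda>x. \<lambda>j\<in>J. x (\<sigma> j q)) = law H"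
      unfolding law_def by (rule iid_pullback_cong[OF \<kappa> into cosets])
    then have "e H = (\<integral>y. h H y \<partial>distr ?PP (\<Pi>\<^sub>M j\<in>J. \<kappa>) (\<lambda>x. \<lambda>j\<in>J. x (\<sigma> j q)))" by (simp add: e_def)
    also have "\<dots> = (\<integral>x. h H (\<lambda>j\<in>J. x (\<sigma> j q)) \<partial>?PP)" by (rule integral_distr[OF m2 hmeas])
    also have "\<dots> = (\<integral>x. h ?T (\<lambda>g. x (\<sigma> g q)) \<partial>?PP)"
    proof (rule Bochner_Integration.integral_cong[OF refl])
      fix x
      have "h H (\<lambda>j\<in>J. x (\<sigma> j q)) = h (H \<inter> S) (\<lambda>j\<in>J. x (\<sigma> j q))" by (rule hT)
      also have "\<dots> = h (?T \<inter> S) (\<lambda>j\<in>J. x (\<sigma> j q))" by (simp only: H(2))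
      also have "\<dots> = h ?T (\<lambda>j\<in>J. x (\<sigma> j q))" by (rule hT[symmetric])
      also have "\<dots> = h ?T (\<lambda>g. x (\<sigma> g q))" by (rule hy) simp
      finally show "h H (\<lambda>j\<in>J. x (\<sigma> j q)) = h ?T (\<lambda>g. x (\<sigma> g q))" .
    qed
    finally have "(\<integral>x. h ?T (\<lambda>g. x (\<sigma> g q)) \<partial>?PP) = e H" by (rule sym)
    also have "e H = p (?T \<inter> S)" unfolding H(2)[symmetric] by (rule pH[OF H(1), symmetric])
    finally show ?thesis by simp
  qed
  show ?thesis
  proof (intro exI[of _ d] conjI exI[of _ \<sigma>] allI impI ballI)
    \<comment> \<open>The integrand is quantified after \<sigma> because the cost to be averaged is
      built from the codes along \<sigma>. At bad points only its upper bound \<open>M\<close> is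
      used.\<close>
    fix c assume c: "\<forall>q\<in>{1..d}. \<forall>x\<in>space ?PP. c q x \<le> M \<and>
        ((\<forall>g\<in>P. \<forall>g'\<in>P. \<sigma> g (\<sigma> g' q) = \<sigma> (g \<otimes> g') q) \<longrightarrow>
          c q x = h (Stab_map G \<sigma> q) (\<lambda>g. x (\<sigma> g q)))"
    have "(\<integral>x. c q x \<partial>?PP) \<le> p (Stab_map G \<sigma> q \<inter> S) + (if q \<in> bad then M else 0)" if q: "q \<in> {1..d}" for q
    proof (cases "q \<in> bad")
      case True
      have "(\<integral>x. c q x \<partial>?PP) \<le> M" using c q by (intro prob_integral_bounds[OF PPP _ M0]) auto
      then show ?thesis using True p0[of "Stab_map G \<sigma> q \<inter> S"] by simp
    next
      case False
      have "(\<integral>x. c q x \<partial>?PP) = (\<integral>x. h (Stab_map G \<sigma> q) (\<lambda>g. x (\<sigma> g q)) \<partial>?PP)"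
        by (rule Bochner_Integration.integral_cong[OF refl]) (use c q False in \<open>simp add: bad_def\<close>)
      then show ?thesis using good_bound[OF q False] False by simp
    qed
    then have "(\<Sum>q\<in>{1..d}. \<integral>x. c q x \<partial>?PP)
        \<le> (\<Sum>q\<in>{1..d}. p (Stab_map G \<sigma> q \<inter> S) + (if q \<in> bad then M else 0))" by (rule sum_mono)
    also have "\<dots> = (\<Sum>q\<in>{1..d}. p (Stab_map G \<sigma> q \<inter> S)) + (\<Sum>q\<in>{1..d}. if q \<in> bad then M else 0)"
      by (rule sum.distrib)
    also have "(\<Sum>q\<in>{1..d}. if q \<in> bad then M else 0) = M * card bad"
    proof -
      have "{q \<in> {1..d}. q \<in> bad} = bad" unfolding bad_def by blast
      then show ?thesis
        using sum.inter_filter[of "{1..d}" "\<lambda>_. M" "\<lambda>q. q \<in> bad"] by (simp add: mult.commute)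
    qed
    also have "(\<Sum>q\<in>{1..d}. p (Stab_map G \<sigma> q \<inter> S)) + M * card bad \<le> d * (I + \<tau> / 2) + d * (\<tau> / 2)"
      using sum_p bad by simp
    also have "\<dots> = d * ((\<integral>x. ?c x \<partial>?M) + \<tau>)" by (simp add: int_eq I_def algebra_simps)
    finally show "(\<Sum>q\<in>{1..d}. \<integral>x. c q x \<partial>?PP) \<le> d * ((\<integral>x. ?c x \<partial>?M) + \<tau>)" .
  qed (use d perm in auto)
qed

section \<open>Sliding block codes on sofic approximations\<close>

text \<open>A finite product of discrete countable spaces is discrete, so any \<open>u\<close> of
  the coded word is measurable.\<close>

lemma measurable_finite_code:
  fixes \<gamma> :: "'k \<Rightarrow> nat"
  assumes J: "finite J" and \<gamma>: "\<gamma> \<in> \<kappa> \<rightarrow>\<^sub>M count_space UNIV"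
    and f: "\<And>x. x \<in> space (\<Pi>\<^sub>M j\<in>J. \<kappa>) \<Longrightarrow> f x = u (\<lambda>j\<in>J. \<gamma> (x j))"
    and u: "\<And>t. u t \<in> space N"
  shows "f \<in> (\<Pi>\<^sub>M j\<in>J. \<kappa>) \<rightarrow>\<^sub>M N"
proof -
  have "(\<lambda>x. \<lambda>j\<in>J. \<gamma> (x j)) \<in> (\<Pi>\<^sub>M j\<in>J. \<kappa>) \<rightarrow>\<^sub>M (\<Pi>\<^sub>M j\<in>J. count_space (UNIV :: nat set))"
    using \<gamma> by (intro measurable_restrict) (auto intro: measurable_compose[OF measurable_component_singleton])
  also have "(\<Pi>\<^sub>M j\<in>J. count_space (UNIV :: nat set)) = count_space (J \<rightarrow>\<^sub>E UNIV)"
    by (rule count_space_PiM_finite) (use J in auto)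
  finally have "(\<lambda>x. u (\<lambda>j\<in>J. \<gamma> (x j))) \<in> (\<Pi>\<^sub>M j\<in>J. \<kappa>) \<rightarrow>\<^sub>M N"
    by (rule measurable_compose) (use u in \<open>simp add: measurable_count_space_eq1\<close>)
  then show ?thesis by (subst measurable_cong[OF f])
qed

text \<open>For \<open>T = H\<close> and \<open>c = \<gamma> \<circ> \<omega>\<close> this is the block code \<open>U\<close> with window \<open>E\<close> evaluated at \<open>g(H, \<omega>)\<close>; for
  \<open>T = Stab\<^sub>\<sigma>(q)\<close> and \<open>c(g) = \<gamma>(x(\<sigma> g q))\<close> it is, at most points \<open>q\<close>, the block code evaluated at \<open>\<sigma> g q\<close>.\<close>

definition shifted_code ::
    "('g, 'm) monoid_scheme \<Rightarrow> 'g set \<Rightarrow> ('g set \<times> ('g \<Rightarrow> nat) \<Rightarrow> nat) \<Rightarrow> 'g \<Rightarrow> 'g set \<Rightarrow> ('g \<Rightarrow> nat) \<Rightarrow> nat"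
  where "shifted_code G E U g T c =
    U ({e \<in> E. inv\<^bsub>G\<^esub> g \<otimes>\<^bsub>G\<^esub> e \<otimes>\<^bsub>G\<^esub> g \<in> T}, \<lambda>e\<in>E. c (e \<otimes>\<^bsub>G\<^esub> g))"

text \<open>The decoder is applied to the letters produced by the encoder and reads the same set T.
  This matches the true decoder on the image point because the conjugacy preserves the stabilizer
  almost surely.\<close>

definition decoded ::
    "('g, 'm) monoid_scheme \<Rightarrow> 'g set \<Rightarrow> ('g set \<times> ('g \<Rightarrow> nat) \<Rightarrow> nat) \<Rightarrow>
      'g set \<Rightarrow> ('g set \<times> ('g \<Rightarrow> nat) \<Rightarrow> nat) \<Rightarrow> 'g set \<Rightarrow> ('g \<Rightarrow> nat) \<Rightarrow> nat"
  where "decoded G E U F V T c = V (T \<inter> F, \<lambda>g\<in>F. shifted_code G E U g T c)"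

text \<open>Code length in nats spent at one point: its letter, and then its label \<open>a\<close>
  given the label guessed by the decoder.\<close>

definition code_cost where
  "code_cost G E U F V (r :: nat \<Rightarrow> real) (w :: nat \<Rightarrow> nat \<Rightarrow> real) T c a =
     - ln (r (shifted_code G E U \<one>\<^bsub>G\<^esub> T c)) - ln (w a (decoded G E U F V T c))"

text \<open>In the finite model the total cost is at least d times the entropy, by the coding bound;
  the cost is local, so soficity bounds its average by the mean over the tensor product. The lower
  bound \<open>l\<close> on the laws keeps the cost between 0 and \<open>- 2 * ln l\<close>, as the
  transfer requires.\<close>

lemma (in group) partition_entropy_le_code_cost:
  fixes \<kappa> :: "'k measure" and \<alpha> \<gamma> :: "'k \<Rightarrow> nat"
  assumes \<eta>: "\<eta> \<in> borel_prob_measures (Sub_topology G)" and sofic: "sofic_measure G \<eta>"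
    and \<kappa>: "prob_space \<kappa>"
    and \<alpha>: "\<alpha> \<in> \<kappa> \<rightarrow>\<^sub>M count_space UNIV" and \<alpha>n: "\<And>y. y \<in> space \<kappa> \<Longrightarrow> \<alpha> y < n"
    and \<gamma>: "\<gamma> \<in> \<kappa> \<rightarrow>\<^sub>M count_space UNIV"
    and E: "finite E" "E \<subseteq> carrier G" and F: "finite F" "F \<subseteq> carrier G"
    and U: "\<And>p. U p < m" and l: "0 < l"
    and r: "\<And>b. b < m \<Longrightarrow> l \<le> r b" "\<And>b. b < m \<Longrightarrow> r b \<le> 1" "(\<Sum>b<m. r b) = 1"
    and w: "\<And>a c. l \<le> w a c" "\<And>a c. w a c \<le> 1" "\<And>c. (\<Sum>a<n. w a c) \<le> 1"
  shows "partition_entropy \<kappa> \<alpha> \<le>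
    (\<integral>x. code_cost G E U F V r w (fst x) (\<lambda>g. \<gamma> (coord G x g)) (\<alpha> (coord G x \<one>))
      \<partial>Sub_tensor_measure G \<eta> \<kappa>)"
proof (rule field_le_epsilon)
  fix \<tau> :: real assume \<tau>: "0 < \<tau>"
  \<comment> \<open>The identity joins the window because the letter at the point itself is charged.
    \<open>J\<close> collects the group elements whose colours are read. \<open>S\<close> collects
    those whose membership in T is tested: by the decoder, by the translated encoder, and by
    comparisons of cosets. \<open>P\<close> is where \<sigma> must be multiplicative.\<close>
  define F1 where "F1 = insert \<one> F"
  define J where "J = insert \<one> ((\<lambda>(e, g). e \<otimes> g) ` (E \<times> F1))"
  define S where "S = F \<union> (\<lambda>(e, g). inv g \<otimes> e \<otimes> g) ` (E \<times> F1) \<union> (\<lambda>(i, j). inv i \<otimes> j) ` (J \<times> J)"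
  define P where "P = E \<union> F1 \<union> J \<union> S"
  have F1: "finite F1" "F1 \<subseteq> carrier G" using F by (auto simp: F1_def)
  have J: "finite J" "J \<subseteq> carrier G" using E F1 by (auto simp: J_def)
  have S: "finite S" "S \<subseteq> carrier G" using E F F1 J by (auto simp: S_def subset_eq)
  have P: "finite P" "P \<subseteq> carrier G" "J \<subseteq> P" "S \<subseteq> P" using E F1 J S by (auto simp: P_def)
  define h where "h T y = code_cost G E U F V r w T (\<lambda>g. \<gamma> (y g)) (\<alpha> (y \<one>))" for T y
  define M where "M = - ln l - ln l"
  have rU: "0 \<le> - ln (r (U p))" "- ln (r (U p)) \<le> - ln l" for p
    using r(1,2)[OF U[of p]] l by auto
  have wV: "0 \<le> - ln (w a c)" "- ln (w a c) \<le> - ln l" for a c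
    using w(1,2)[of _ _] l by (smt (verit) ln_le_zero_iff, smt (verit) ln_le_cancel_iff)
  have h0: "0 \<le> h T y" and hM: "h T y \<le> M" for T y
    using rU wV by (auto simp: h_def M_def code_cost_def shifted_code_def intro: add_nonneg_nonneg diff_mono)
      (smt (verit, best))+
  have JS: "inv i \<otimes> j \<in> S" if "i \<in> J" "j \<in> J" for i j using that by (auto simp: S_def)
  have sc_T: "shifted_code G E U g T c = shifted_code G E U g (T \<inter> S) c" if g: "g \<in> F1" for g T c
  proof -
    have "inv g \<otimes> e \<otimes> g \<in> S" if "e \<in> E" for e using that g by (auto simp: S_def)
    then have "{e \<in> E. inv g \<otimes> e \<otimes> g \<in> T} = {e \<in> E. inv g \<otimes> e \<otimes> g \<in> T \<inter> S}" by blast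
    then show ?thesis by (simp add: shifted_code_def)
  qed
  have sc_c: "shifted_code G E U g T c = shifted_code G E U g T c'"
    if g: "g \<in> F1" and c: "\<And>j. j \<in> J \<Longrightarrow> c j = c' j" for g T c c'
  proof -
    have "(\<lambda>e\<in>E. c (e \<otimes> g)) = (\<lambda>e\<in>E. c' (e \<otimes> g))"
      by (rule restrict_ext, rule c) (use g in \<open>auto simp: J_def\<close>)
    then show ?thesis by (simp add: shifted_code_def)
  qed
  have cost_T: "code_cost G E U F V r w T c a = code_cost G E U F V r w (T \<inter> S) c a" for T c a
  proof -
    have "T \<inter> F = T \<inter> S \<inter> F" by (auto simp: S_def)
    moreover have "(\<lambda>g\<in>F. shifted_code G E U g T c) = (\<lambda>g\<in>F. shifted_code G E U g (T \<inter> S) c)"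
      by (rule restrict_ext, rule sc_T) (simp add: F1_def)
    moreover have "shifted_code G E U \<one> T c = shifted_code G E U \<one> (T \<inter> S) c"
      by (rule sc_T) (simp add: F1_def)
    ultimately show ?thesis unfolding code_cost_def decoded_def by simp
  qed
  have cost_c: "code_cost G E U F V r w T c a = code_cost G E U F V r w T c' a"
    if c: "\<And>j. j \<in> J \<Longrightarrow> c j = c' j" for T c c' a
  proof -
    have "(\<lambda>g\<in>F. shifted_code G E U g T c) = (\<lambda>g\<in>F. shifted_code G E U g T c')"
      by (rule restrict_ext, rule sc_c) (auto simp: F1_def c)
    moreover have "shifted_code G E U \<one> T c = shifted_code G E U \<one> T c'"
      by (rule sc_c) (auto simp: F1_def c)
    ultimately show ?thesis unfolding code_cost_def decoded_def by simp
  qed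
  have hT: "h T y = h (T \<inter> S) y" for T y unfolding h_def by (rule cost_T)
  have J1: "\<one> \<in> J" by (simp add: J_def)
  have hy: "h T y = h T y'" if "\<And>j. j \<in> J \<Longrightarrow> y j = y' j" for T y y'
    unfolding h_def using that[OF J1] by (simp only:) (rule cost_c, simp add: that)
  have hmeas: "(\<lambda>y. h T y) \<in> borel_measurable (\<Pi>\<^sub>M j\<in>J. \<kappa>)" for T
  proof (rule measurable_finite_code[OF J(1)])
    \<comment> \<open>Both finite labels of a colour are packed into one number, from which the
      whole cost is computed.\<close>
    show "(\<lambda>y. prod_encode (\<gamma> y, \<alpha> y)) \<in> \<kappa> \<rightarrow>\<^sub>M count_space UNIV" using \<alpha> \<gamma> by measurable
    fix y
    show "h T y = (\<lambda>t. code_cost G E U F V r w T (\<lambda>g. fst (prod_decode (t g))) (snd (prod_decode (t \<one>))))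
        (\<lambda>j\<in>J. prod_encode (\<gamma> (y j), \<alpha> (y j)))"
      unfolding h_def using J1 by (simp, intro cost_c) simp
  qed simp
  have "\<exists>d>0. \<exists>\<sigma>. (\<forall>g\<in>carrier G. \<sigma> g permutes {1..d}) \<and>
    (\<forall>c. (\<forall>q\<in>{1..d}. \<forall>x\<in>space (\<Pi>\<^sub>M i\<in>{1..d}. \<kappa>). c q x \<le> M \<and>
        ((\<forall>g\<in>P. \<forall>g'\<in>P. \<sigma> g (\<sigma> g' q) = \<sigma> (g \<otimes> g') q) \<longrightarrow>
          c q x = h (Stab_map G \<sigma> q) (\<lambda>g. x (\<sigma> g q)))) \<longrightarrow>
      (\<Sum>q\<in>{1..d}. \<integral>x. c q x \<partial>(\<Pi>\<^sub>M i\<in>{1..d}. \<kappa>)) \<le>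
        real d * ((\<integral>x. h (fst x) (coord G x) \<partial>Sub_tensor_measure G \<eta> \<kappa>) + \<tau>))"
  proof (rule sofic_transfer[where h = h and J = J and S = S, OF \<eta> sofic \<kappa> h0 hM J S _ hT _ hmeas P \<tau>])
    show "inv i \<otimes> j \<in> S" if "i \<in> J" "j \<in> J" for i j using that by (rule JS)
    show "h T y = h T y'" if "\<And>j. j \<in> J \<Longrightarrow> y j = y' j" for T y y' using that by (rule hy)
  qed
  then obtain d \<sigma> where d: "d > 0" and all: "(\<forall>g\<in>carrier G. \<sigma> g permutes {1..d}) \<and>
    (\<forall>c. (\<forall>q\<in>{1..d}. \<forall>x\<in>space (\<Pi>\<^sub>M i\<in>{1..d}. \<kappa>). c q x \<le> M \<and>
        ((\<forall>g\<in>P. \<forall>g'\<in>P. \<sigma> g (\<sigma> g' q) = \<sigma> (g \<otimes> g') q) \<longrightarrow>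
          c q x = h (Stab_map G \<sigma> q) (\<lambda>g. x (\<sigma> g q)))) \<longrightarrow>
      (\<Sum>q\<in>{1..d}. \<integral>x. c q x \<partial>(\<Pi>\<^sub>M i\<in>{1..d}. \<kappa>)) \<le>
        real d * ((\<integral>x. h (fst x) (coord G x) \<partial>Sub_tensor_measure G \<eta> \<kappa>) + \<tau>))"
    by (elim exE conjE) (rule that; (intro conjI)?; assumption)
  note perm = conjunct1[OF all] and transfer = conjunct2[OF all]
  have \<sigma>I: "\<sigma> g q \<in> {1..d}" if "g \<in> carrier G" "q \<in> {1..d}" for g q
    using permutes_in_image[OF bspec[OF perm that(1)]] that(2) by (rule iffD2)
  \<comment> \<open>The codes along \<sigma>. The decoder \<open>\<Phi>\<close> must accept
    arbitrary words, not only encoded ones, since the coding bound sums over all of them.\<close>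
  define z where "z x q = U (Stab_map G \<sigma> q \<inter> E, \<lambda>e\<in>E. \<gamma> (x (\<sigma> e q)))" for x q
  define \<Phi> where "\<Phi> b q = V (Stab_map G \<sigma> q \<inter> F, \<lambda>g\<in>F. b (\<sigma> g q))" for b q
  define c where "c q x = - ln (r (z x q)) - ln (w (\<alpha> (x q)) (\<Phi> (restrict (z x) {1..d}) q))" for q x
  have "real (card {1..d}) * partition_entropy \<kappa> \<alpha> \<le> (\<Sum>q\<in>{1..d}. \<integral>x. c q x \<partial>(\<Pi>\<^sub>M i\<in>{1..d}. \<kappa>))"
    unfolding c_def
  proof (rule coding_bound_iid[OF \<kappa> _ \<alpha> \<alpha>n])
    fix q assume q: "q \<in> {1..d}"
    show "(\<lambda>x. z x q) \<in> (\<Pi>\<^sub>M i\<in>{1..d}. \<kappa>) \<rightarrow>\<^sub>M count_space UNIV"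
    proof (rule measurable_finite_code[OF _ \<gamma>])
      fix x
      have "(\<lambda>e\<in>E. \<gamma> (x (\<sigma> e q))) = (\<lambda>e\<in>E. (\<lambda>i\<in>{1..d}. \<gamma> (x i)) (\<sigma> e q))"
        by (rule restrict_ext) (use \<sigma>I[OF _ q] E in auto)
      then show "z x q = (\<lambda>t. U (Stab_map G \<sigma> q \<inter> E, \<lambda>e\<in>E. t (\<sigma> e q))) (\<lambda>i\<in>{1..d}. \<gamma> (x i))"
        by (simp add: z_def)
    qed auto
  qed (use l r w U in \<open>auto simp: z_def intro: less_le_trans\<close>)
  also have "\<dots> \<le> real d * ((\<integral>x. h (fst x) (coord G x) \<partial>Sub_tensor_measure G \<eta> \<kappa>) + \<tau>)"
  proof (rule transfer[THEN spec, THEN mp], intro ballI conjI impI)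
    fix q x assume q: "q \<in> {1..d}"
    show "c q x \<le> M" unfolding c_def M_def z_def
      by (intro diff_mono rU(2) wV(2)[unfolded neg_le_iff_le])
    assume good: "\<forall>g\<in>P. \<forall>g'\<in>P. \<sigma> g (\<sigma> g' q) = \<sigma> (g \<otimes> g') q"
    let ?T = "Stab_map G \<sigma> q"
    have inj: "\<sigma> g i = \<sigma> g j \<longleftrightarrow> i = j" if "g \<in> carrier G" for g i j
      using permutes_inj[OF bspec[OF perm that]] by (rule inj_eq)
    have "\<one> \<in> P" by (simp add: P_def F1_def)
    \<comment> \<open>The permutation \<open>\<sigma> \<one>\<close> need not be the identity, but
      multiplicativity at q and injectivity force it to fix q.\<close>
    then have "\<sigma> \<one> (\<sigma> \<one> q) = \<sigma> \<one> q"
      using good[rule_format, of \<one> \<one>] by simp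
    then have one: "\<sigma> \<one> q = q" using inj[of \<one>] by simp
    have zg: "z x (\<sigma> g q) = shifted_code G E U g ?T (\<lambda>g. \<gamma> (x (\<sigma> g q)))" if g: "g \<in> F1" for g
    proof -
      have gc: "g \<in> carrier G" "g \<in> P" using g F1 by (auto simp: P_def)
      have eg: "\<sigma> e (\<sigma> g q) = \<sigma> (e \<otimes> g) q" if "e \<in> E" for e
        using good[rule_format, of e g] that gc by (simp add: P_def)
      \<comment> \<open>On the window, the stabilizer of the moved point is the conjugate by g: with
        k = \<open>inv g \<otimes> e \<otimes> g\<close> one has
        \<open>g \<otimes> k = e \<otimes> g\<close>, and \<sigma> respects both products at
        q.\<close>
      have "\<sigma> e (\<sigma> g q) = \<sigma> g q \<longleftrightarrow> inv g \<otimes> e \<otimes> g \<in> ?T" if e: "e \<in> E" for e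
      proof -
        let ?k = "inv g \<otimes> e \<otimes> g"
        have ec: "e \<in> carrier G" using e E by blast
        have "?k \<in> S" using e g by (auto simp: S_def)
        then have k: "?k \<in> P" "?k \<in> carrier G" using P S by auto
        have "g \<otimes> ?k = e \<otimes> g" using ec gc by (simp add: m_assoc[symmetric])
        then have "\<sigma> g (\<sigma> ?k q) = \<sigma> e (\<sigma> g q)" using good[rule_format, OF gc(2) k(1)] eg[OF e] by simp
        then show ?thesis using inj[OF gc(1), of "\<sigma> ?k q" q] k(2) by (simp add: Stab_map_def)
      qed
      then have "Stab_map G \<sigma> (\<sigma> g q) \<inter> E = {e \<in> E. inv g \<otimes> e \<otimes> g \<in> ?T}"
        using E by (auto simp: Stab_map_def)
      moreover have "(\<lambda>e\<in>E. \<gamma> (x (\<sigma> e (\<sigma> g q)))) = (\<lambda>e\<in>E. \<gamma> (x (\<sigma> (e \<otimes> g) q)))"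
        by (rule restrict_ext) (simp add: eg)
      ultimately show ?thesis by (simp add: z_def shifted_code_def)
    qed
    have "(\<lambda>g\<in>F. restrict (z x) {1..d} (\<sigma> g q)) = (\<lambda>g\<in>F. shifted_code G E U g ?T (\<lambda>g. \<gamma> (x (\<sigma> g q))))"
    proof (rule restrict_ext)
      fix g assume "g \<in> F"
      then have "g \<in> F1" "\<sigma> g q \<in> {1..d}" using \<sigma>I[OF _ q] F by (auto simp: F1_def)
      then show "restrict (z x) {1..d} (\<sigma> g q) = shifted_code G E U g ?T (\<lambda>g. \<gamma> (x (\<sigma> g q)))"
        using zg by simp
    qed
    moreover have "z x q = shifted_code G E U \<one> ?T (\<lambda>g. \<gamma> (x (\<sigma> g q)))"
      using zg[of \<one>] one by (simp add: F1_def)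
    ultimately show "c q x = h ?T (\<lambda>g. x (\<sigma> g q))"
      by (simp add: c_def h_def code_cost_def decoded_def \<Phi>_def one)
  qed
  finally have "partition_entropy \<kappa> \<alpha> \<le> (\<integral>x. h (fst x) (coord G x) \<partial>Sub_tensor_measure G \<eta> \<kappa>) + \<tau>"
    using d by simp
  then show "partition_entropy \<kappa> \<alpha> \<le>
    (\<integral>x. code_cost G E U F V r w (fst x) (\<lambda>g. \<gamma> (coord G x g)) (\<alpha> (coord G x \<one>))
      \<partial>Sub_tensor_measure G \<eta> \<kappa>) + \<tau>" by (simp add: h_def)
qed

section \<open>Conjugacies relative to the factor\<close>

text \<open>In each fibre the coordinate at the identity is the product coordinate at the coset H,
  with law \<kappa>.\<close>

lemma (in group) measure_coord_one:
  assumes \<eta>: "\<eta> \<in> borel_prob_measures (Sub_topology G)" and \<kappa>: "prob_space \<kappa>" and Z: "Z \<in> sets \<kappa>"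
  shows "measure (Sub_tensor_measure G \<eta> \<kappa>) {x \<in> space (Sub_tensor G \<kappa>). coord G x \<one> \<in> Z} = measure \<kappa> Z"
proof -
  let ?B = "{x \<in> space (Sub_tensor G \<kappa>). coord G x \<one> \<in> Z}"
  interpret \<eta>: prob_space \<eta> using \<eta> by (simp add: borel_prob_measures_def)
  have B: "?B \<in> sets (Sub_tensor G \<kappa>)"
    using measurable_sets[OF measurable_coord[of \<one> G \<kappa>] Z] by (simp add: vimage_def Int_def conj_commute)
  have "emeasure (Sub_tensor_measure G \<eta> \<kappa>) ?B
      = (\<integral>\<^sup>+H. emeasure (\<Pi>\<^sub>M C\<in>lcosets H. \<kappa>) {\<omega> \<in> space (\<Pi>\<^sub>M C\<in>lcosets H. \<kappa>). (H, \<omega>) \<in> ?B} \<partial>\<eta>)"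
    by (rule emeasure_Sub_tensor_measure[OF \<eta> \<kappa> B])
  also have "\<dots> = (\<integral>\<^sup>+H. emeasure \<kappa> Z \<partial>\<eta>)"
  proof (rule nn_integral_cong)
    fix H assume "H \<in> space \<eta>"
    then have H: "subgroup H G" by (simp add: space_borel_prob_measure_Sub[OF \<eta>])
    have C: "\<one> <# H \<in> lcosets H" by (auto simp: LCOSETS_def)
    have "{\<omega> \<in> space (\<Pi>\<^sub>M C\<in>lcosets H. \<kappa>). (H, \<omega>) \<in> ?B}
        = (\<lambda>\<omega>. \<omega> (\<one> <# H)) -` Z \<inter> space (\<Pi>\<^sub>M C\<in>lcosets H. \<kappa>)"
      using H by (auto simp: space_Sub_tensor coord_def space_PiM)
    also have "emeasure (\<Pi>\<^sub>M C\<in>lcosets H. \<kappa>) \<dots> = emeasure (distr (\<Pi>\<^sub>M C\<in>lcosets H. \<kappa>) \<kappa> (\<lambda>\<omega>. \<omega> (\<one> <# H))) Z"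
      using C Z by (subst emeasure_distr) auto
    also have "distr (\<Pi>\<^sub>M C\<in>lcosets H. \<kappa>) \<kappa> (\<lambda>\<omega>. \<omega> (\<one> <# H)) = \<kappa>"
      using distr_PiM_component[of "lcosets H" "\<lambda>_. \<kappa>" "\<one> <# H"] \<kappa> C by simp
    finally show "emeasure (\<Pi>\<^sub>M C\<in>lcosets H. \<kappa>) {\<omega> \<in> space (\<Pi>\<^sub>M C\<in>lcosets H. \<kappa>). (H, \<omega>) \<in> ?B} = emeasure \<kappa> Z" .
  qed
  also have "\<dots> = emeasure \<kappa> Z" by (simp add: \<eta>.emeasure_space_1)
  finally show ?thesis by (simp add: measure_def)
qed

lemma (in group) measure_act_preimage:
  assumes C: "countable (carrier G)" and g: "g \<in> carrier G" and \<eta>: "conj_invariant_measure G \<eta>"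
    and \<kappa>: "prob_space \<kappa>" and B: "B \<in> sets (Sub_tensor G \<kappa>)"
  shows "{x \<in> space (Sub_tensor G \<kappa>). Sub_tensor_act G g x \<in> B} \<in> sets (Sub_tensor G \<kappa>)"
    and "measure (Sub_tensor_measure G \<eta> \<kappa>) {x \<in> space (Sub_tensor G \<kappa>). Sub_tensor_act G g x \<in> B}
      = measure (Sub_tensor_measure G \<eta> \<kappa>) B"
proof -
  let ?M = "Sub_tensor_measure G \<eta> \<kappa>"
  have act: "Sub_tensor_act G g \<in> Sub_tensor G \<kappa> \<rightarrow>\<^sub>M Sub_tensor G \<kappa>" by (rule measurable_act[OF C g])
  have eq: "{x \<in> space (Sub_tensor G \<kappa>). Sub_tensor_act G g x \<in> B}
      = Sub_tensor_act G g -` B \<inter> space (Sub_tensor G \<kappa>)" by auto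
  show "{x \<in> space (Sub_tensor G \<kappa>). Sub_tensor_act G g x \<in> B} \<in> sets (Sub_tensor G \<kappa>)"
    unfolding eq by (rule measurable_sets[OF act B])
  have actM: "Sub_tensor_act G g \<in> ?M \<rightarrow>\<^sub>M ?M" using act by (simp cong: measurable_cong_sets)
  have "measure ?M B = measure (distr ?M ?M (Sub_tensor_act G g)) B"
    by (simp add: distr_act_Sub_tensor_measure[OF C g \<eta> \<kappa>])
  also have "\<dots> = measure ?M (Sub_tensor_act G g -` B \<inter> space (Sub_tensor G \<kappa>))"
    using actM B by (simp add: measure_distr)
  finally show "measure ?M {x \<in> space (Sub_tensor G \<kappa>). Sub_tensor_act G g x \<in> B} = measure ?M B"
    by (simp add: eq)
qed

lemma measurable_if_mem:
  fixes f :: "'a \<Rightarrow> nat"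
  assumes X: "X \<in> sets M" and f: "f \<in> restrict_space M X \<rightarrow>\<^sub>M count_space UNIV"
  shows "(\<lambda>x. if x \<in> X then f x else 0) \<in> M \<rightarrow>\<^sub>M count_space UNIV"
proof (subst measurable_If_restrict_space_iff)
  have "{x \<in> space M. x \<in> X} = X" using sets.sets_into_space[OF X] by auto
  then show "{x \<in> space M. x \<in> X} \<in> sets M" using X by simp
qed (use f in simp)

text \<open>Fixing one direction as a locale allows the one-sided estimate to be instantiated again
  with the inverse map.\<close>

locale rel_conjugacy = group G for G (structure) +
  fixes \<eta> :: "'a set measure" and \<kappa> :: "'k measure" and \<nu> :: "'l measure"
    and X Y and \<phi> :: "'a set \<times> ('a set \<Rightarrow> 'k) \<Rightarrow> 'a set \<times> ('a set \<Rightarrow> 'l)"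
  assumes C: "countable (carrier G)"
    and \<eta>: "conj_invariant_measure G \<eta>" and \<kappa>: "prob_space \<kappa>" and \<nu>: "prob_space \<nu>"
    and X: "conull_invariant G (Sub_tensor_act G) (Sub_tensor_measure G \<eta> \<kappa>) X"
    and Y: "conull_invariant G (Sub_tensor_act G) (Sub_tensor_measure G \<eta> \<nu>) Y"
    and iso: "measure_space_iso (restrict_space (Sub_tensor_measure G \<eta> \<kappa>) X)
          (restrict_space (Sub_tensor_measure G \<eta> \<nu>) Y) \<phi>"
    and equiv: "\<And>g x. g \<in> carrier G \<Longrightarrow> x \<in> X \<Longrightarrow> \<phi> (Sub_tensor_act G g x) = Sub_tensor_act G g (\<phi> x)"
    and rel: "AE x in restrict_space (Sub_tensor_measure G \<eta> \<kappa>) X. fst (\<phi> x) = fst x"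
begin

abbreviation "M\<kappa> \<equiv> Sub_tensor_measure G \<eta> \<kappa>"
abbreviation "M\<nu> \<equiv> Sub_tensor_measure G \<eta> \<nu>"
abbreviation "\<psi> \<equiv> the_inv_into X \<phi>"

lemma \<eta>': "\<eta> \<in> borel_prob_measures (Sub_topology G)"
  using \<eta> by (simp add: conj_invariant_measure_def)

lemma sets_X: "X \<in> sets M\<kappa>" and sets_Y: "Y \<in> sets M\<nu>"
  using X Y by (auto simp: conull_invariant_def)

lemma X_subset: "X \<subseteq> space (Sub_tensor G \<kappa>)" and Y_subset: "Y \<subseteq> space (Sub_tensor G \<nu>)"
  using sets.sets_into_space[OF sets_X] sets.sets_into_space[OF sets_Y] by simp_all

lemma AE_X: "AE x in M\<kappa>. x \<in> X" and AE_Y: "AE y in M\<nu>. y \<in> Y"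
proof -
  have "space M\<kappa> - X \<in> null_sets M\<kappa>" "space M\<nu> - Y \<in> null_sets M\<nu>"
    using X Y by (auto simp: conull_invariant_def null_sets_def)
  then show "AE x in M\<kappa>. x \<in> X" "AE y in M\<nu>. y \<in> Y"
    by (auto intro: AE_I')
qed

lemma space_restrict: "space (restrict_space M\<kappa> X) = X" "space (restrict_space M\<nu> Y) = Y"
  using X_subset Y_subset by (auto simp: space_restrict_space)

lemma bij: "bij_betw \<phi> X Y"
  and \<phi>_meas: "\<phi> \<in> restrict_space M\<kappa> X \<rightarrow>\<^sub>M restrict_space M\<nu> Y"
  and \<psi>_meas: "\<psi> \<in> restrict_space M\<nu> Y \<rightarrow>\<^sub>M restrict_space M\<kappa> X"
  and \<phi>_distr: "distr (restrict_space M\<kappa> X) (restrict_space M\<nu> Y) \<phi> = restrict_space M\<nu> Y"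
  using iso unfolding measure_space_iso_def space_restrict by auto

lemma \<phi>_in_Y: "x \<in> X \<Longrightarrow> \<phi> x \<in> Y"
  using bij by (rule bij_betwE[rule_format])

lemma \<psi>_\<phi>: "x \<in> X \<Longrightarrow> \<psi> (\<phi> x) = x"
  using bij by (simp add: bij_betw_def the_inv_into_f_f)

lemma \<phi>_\<psi>: "y \<in> Y \<Longrightarrow> \<phi> (\<psi> y) = y"
  using bij by (simp add: bij_betw_def f_the_inv_into_f)

lemma act_in_X: "g \<in> carrier G \<Longrightarrow> x \<in> X \<Longrightarrow> Sub_tensor_act G g x \<in> X"
proof -
  assume g: "g \<in> carrier G" and x: "x \<in> X"
  have "Sub_tensor_act G g ` X = X" using X g by (simp add: conull_invariant_def)
  from imageI[OF x, of "Sub_tensor_act G g", unfolded this] show ?thesis .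
qed

lemma \<phi>_preimage:
  assumes B: "B \<in> sets (Sub_tensor G \<nu>)"
  shows "{x \<in> X. \<phi> x \<in> B} \<in> sets M\<kappa>" and "measure M\<kappa> {x \<in> X. \<phi> x \<in> B} = measure M\<nu> B"
proof -
  have BY: "B \<inter> Y \<in> sets (restrict_space M\<nu> Y)"
    using B sets_Y by (auto simp: sets_restrict_space)
  have eq: "{x \<in> X. \<phi> x \<in> B} = \<phi> -` (B \<inter> Y) \<inter> space (restrict_space M\<kappa> X)"
    using \<phi>_in_Y by (auto simp: space_restrict)
  have "{x \<in> X. \<phi> x \<in> B} \<in> sets (restrict_space M\<kappa> X)"
    unfolding eq by (rule measurable_sets[OF \<phi>_meas BY])
  then show "{x \<in> X. \<phi> x \<in> B} \<in> sets M\<kappa>"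
    using sets_X by (auto simp: sets_restrict_space)
  have "measure M\<kappa> {x \<in> X. \<phi> x \<in> B} = measure (restrict_space M\<kappa> X) {x \<in> X. \<phi> x \<in> B}"
    using sets_X by (subst measure_restrict_space) auto
  also have "\<dots> = measure (distr (restrict_space M\<kappa> X) (restrict_space M\<nu> Y) \<phi>) (B \<inter> Y)"
    unfolding eq by (rule measure_distr[OF \<phi>_meas BY, symmetric])
  also have "\<dots> = measure M\<nu> (B \<inter> Y)"
    unfolding \<phi>_distr using sets_Y by (subst measure_restrict_space) auto
  also have "\<dots> = measure M\<nu> B"
    by (rule measure_eq_AE) (use AE_Y B sets_Y in auto)
  finally show "measure M\<kappa> {x \<in> X. \<phi> x \<in> B} = measure M\<nu> B" .
qed

lemma AE_fst: "AE x in M\<kappa>. x \<in> X \<and> fst (\<phi> x) = fst x"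
proof -
  have "AE x in M\<kappa>. x \<in> X \<longrightarrow> fst (\<phi> x) = fst x"
    using rel sets_X by (subst (asm) AE_restrict_space_iff) auto
  then show ?thesis using AE_X by eventually_elim auto
qed

text \<open>The delicate point is that the inverse also preserves the stabilizer almost surely: the
  statement is transported along the push-forward, which requires its event to be
  measurable.\<close>

lemma flip: "rel_conjugacy G \<eta> \<nu> \<kappa> Y X \<psi>"
proof (intro rel_conjugacy.intro rel_conjugacy_axioms.intro)
  have inv: "the_inv_into Y \<psi> y = \<phi> y" if "y \<in> X" for y
    using that bij \<psi>_\<phi> \<phi>_in_Y \<phi>_\<psi>
    by (intro the_inv_into_f_eq) (auto simp: bij_betw_def intro: inj_on_the_inv_into inj_on_inverseI[of _ \<phi>])
  have bij': "bij_betw \<psi> Y X" by (rule bij_betw_the_inv_into[OF bij])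
  show "measure_space_iso (restrict_space M\<nu> Y) (restrict_space M\<kappa> X) \<psi>"
    unfolding measure_space_iso_def space_restrict
  proof (intro conjI bij' \<psi>_meas)
    show "the_inv_into Y \<psi> \<in> restrict_space M\<kappa> X \<rightarrow>\<^sub>M restrict_space M\<nu> Y"
      using \<phi>_meas by (rule measurable_cong[THEN iffD1, rotated]) (simp add: inv space_restrict)
    have "distr (restrict_space M\<nu> Y) (restrict_space M\<kappa> X) \<psi>
        = distr (distr (restrict_space M\<kappa> X) (restrict_space M\<nu> Y) \<phi>) (restrict_space M\<kappa> X) \<psi>"
      by (simp add: \<phi>_distr)
    also have "\<dots> = distr (restrict_space M\<kappa> X) (restrict_space M\<kappa> X) (\<psi> \<circ> \<phi>)"
      by (rule distr_distr[OF \<psi>_meas \<phi>_meas])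
    also have "\<dots> = distr (restrict_space M\<kappa> X) (restrict_space M\<kappa> X) (\<lambda>x. x)"
      by (rule distr_cong) (simp_all add: \<psi>_\<phi> space_restrict)
    finally show "distr (restrict_space M\<nu> Y) (restrict_space M\<kappa> X) \<psi> = restrict_space M\<kappa> X" by simp
  qed
  fix g y assume g: "g \<in> carrier G" and y: "y \<in> Y"
  have x: "\<psi> y \<in> X" using bij_betwE[OF bij'] y by blast
  have "\<phi> (Sub_tensor_act G g (\<psi> y)) = Sub_tensor_act G g y" using equiv[OF g x] \<phi>_\<psi>[OF y] by simp
  then show "\<psi> (Sub_tensor_act G g y) = Sub_tensor_act G g (\<psi> y)"
    using \<psi>_\<phi>[OF act_in_X[OF g x]] by simp
next
  let ?N = "restrict_space M\<nu> Y"
  have f1: "fst \<in> restrict_space M\<kappa> X \<rightarrow>\<^sub>M borel_of (Sub_topology G)"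
    and f2: "fst \<in> ?N \<rightarrow>\<^sub>M borel_of (Sub_topology G)"
    by (intro measurable_restrict_space1; simp cong: measurable_cong_sets)+
  note [measurable] = f2 measurable_compose[OF \<psi>_meas f1]
  \<comment> \<open>Equality of two subgroups is a countable conjunction of membership
    conditions.\<close>
  have "{y \<in> space ?N. \<forall>g\<in>carrier G. (g \<in> fst (\<psi> y)) = (g \<in> fst y)} \<in> sets ?N"
    by (rule sets.sets_Collect_countable_All'[OF _ C]) measurable
  also have "{y \<in> space ?N. \<forall>g\<in>carrier G. (g \<in> fst (\<psi> y)) = (g \<in> fst y)} = {y \<in> space ?N. fst (\<psi> y) = fst y}"
  proof -
    have "fst (\<psi> y) \<subseteq> carrier G" "fst y \<subseteq> carrier G" if "y \<in> Y" for y
    proof -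
      have "\<psi> y \<in> X" using measurable_space[OF \<psi>_meas, of y] that by (simp add: space_restrict)
      then show "fst (\<psi> y) \<subseteq> carrier G" "fst y \<subseteq> carrier G"
        using that X_subset Y_subset subgroup_fst_Sub_tensor subgroup.subset by blast+
    qed
    then show ?thesis by (auto simp: space_restrict) blast+
  qed
  finally have m: "{y \<in> space ?N. fst (\<psi> y) = fst y} \<in> sets ?N" .
  have "AE x in restrict_space M\<kappa> X. fst (\<psi> (\<phi> x)) = fst (\<phi> x)"
    using rel AE_space by eventually_elim (simp add: \<psi>_\<phi> space_restrict)
  then have "AE y in distr (restrict_space M\<kappa> X) ?N \<phi>. fst (\<psi> y) = fst y"
    by (subst AE_distr_iff[OF \<phi>_meas m])
  then show "AE y in restrict_space M\<nu> Y. fst (\<psi> y) = fst y" by (simp only: \<phi>_distr)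
qed (rule group_axioms C \<eta> \<kappa> \<nu> X Y)+

end

section \<open>The entropy estimate\<close>

text \<open>Mixing with the uniform distribution keeps the logarithms bounded.\<close>

definition mix :: "real \<Rightarrow> nat \<Rightarrow> real \<Rightarrow> real" where
  "mix \<epsilon> n p = (1 - \<epsilon>) * p + \<epsilon> / real n"

lemma mix_bounds:
  assumes "0 < \<epsilon>" "\<epsilon> < 1" "0 < n" "0 \<le> p" "p \<le> 1"
  shows "\<epsilon> / real n \<le> mix \<epsilon> n p" "(1 - \<epsilon>) * p \<le> mix \<epsilon> n p" "mix \<epsilon> n p \<le> 1" "0 < mix \<epsilon> n p"
proof -
  have "\<epsilon> / real n \<le> \<epsilon>" using assms by (simp add: divide_le_eq mult_le_cancel_left1)
  moreover have "(1 - \<epsilon>) * p \<le> 1 - \<epsilon>" "0 \<le> (1 - \<epsilon>) * p" using assms by (simp_all add: mult_left_le)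
  moreover have "0 < \<epsilon> / real n" using assms by simp
  ultimately show "\<epsilon> / real n \<le> mix \<epsilon> n p" "(1 - \<epsilon>) * p \<le> mix \<epsilon> n p" "mix \<epsilon> n p \<le> 1" "0 < mix \<epsilon> n p"
    unfolding mix_def by linarith+
qed

lemma sum_mix: "0 < n \<Longrightarrow> (\<Sum>k<n. mix \<epsilon> n (f k)) = (1 - \<epsilon>) * (\<Sum>k<n. f k) + \<epsilon>"
  by (simp add: mix_def sum.distrib sum_distrib_left)

lemma cell_measure_bounds: "prob_space \<mu> \<Longrightarrow> 0 \<le> cell_measure \<mu> \<alpha> k \<and> cell_measure \<mu> \<alpha> k \<le> 1"
  using cell_measure_le_1 by (auto simp: cell_measure_def)

lemma sum_cell_measure:
  assumes "prob_space \<mu>" "\<alpha> \<in> \<mu> \<rightarrow>\<^sub>M count_space UNIV" "\<And>x. x \<in> space \<mu> \<Longrightarrow> \<alpha> x < n"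
  shows "(\<Sum>k<n. cell_measure \<mu> \<alpha> k) = 1"
  using integral_comp_partition[OF assms, of "\<lambda>_. 1"] assms(1) by (simp add: prob_space.prob_space)

text \<open>The mixture is at least \<open>1 - \<epsilon>\<close> times the true law, so coding with
  it costs at most \<open>- ln (1 - \<epsilon>)\<close> more than the entropy.\<close>

lemma cross_entropy_mix:
  assumes \<mu>: "prob_space \<mu>" and \<alpha>: "\<alpha> \<in> \<mu> \<rightarrow>\<^sub>M count_space UNIV"
    and n: "\<And>x. x \<in> space \<mu> \<Longrightarrow> \<alpha> x < n" "0 < n" and \<epsilon>: "0 < \<epsilon>" "\<epsilon> < 1"
  shows "(\<integral>x. - ln (mix \<epsilon> n (cell_measure \<mu> \<alpha> (\<alpha> x))) \<partial>\<mu>) \<le> - ln (1 - \<epsilon>) + partition_entropy \<mu> \<alpha>"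
proof -
  interpret prob_space \<mu> by (rule \<mu>)
  let ?p = "\<lambda>x. cell_measure \<mu> \<alpha> (\<alpha> x)"
  have int: "integrable \<mu> (\<lambda>x. f (\<alpha> x) :: real)" for f
    by (rule integrable_comp_partition[OF \<mu> \<alpha> n(1)])
  have pos: "AE x in \<mu>. 0 < ?p x"
    by (rule AE_cell_measure_pos[OF \<mu> \<alpha>]) (rule n(1))
  have "(\<integral>x. - ln (mix \<epsilon> n (?p x)) \<partial>\<mu>) \<le> (\<integral>x. - ln (1 - \<epsilon>) + - ln (?p x) \<partial>\<mu>)"
  proof (rule integral_mono_AE)
    show "integrable \<mu> (\<lambda>x. - ln (mix \<epsilon> n (?p x)))" by (rule int)
    show "integrable \<mu> (\<lambda>x. - ln (1 - \<epsilon>) + - ln (?p x))"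
      using int[of "\<lambda>k. - ln (1 - \<epsilon>) + - ln (cell_measure \<mu> \<alpha> k)"] .
    show "AE x in \<mu>. - ln (mix \<epsilon> n (?p x)) \<le> - ln (1 - \<epsilon>) + - ln (?p x)"
      using pos
    proof eventually_elim
      case (elim x)
      have b: "(1 - \<epsilon>) * ?p x \<le> mix \<epsilon> n (?p x)"
        using mix_bounds(2)[OF \<epsilon> n(2)] cell_measure_bounds[OF \<mu>] by blast
      have "ln (1 - \<epsilon>) + ln (?p x) = ln ((1 - \<epsilon>) * ?p x)" using \<epsilon> elim by (simp add: ln_mult)
      also have "\<dots> \<le> ln (mix \<epsilon> n (?p x))" using b \<epsilon> elim by (intro ln_mono) auto
      finally show ?case by simp
    qed
  qed
  also have "\<dots> = - ln (1 - \<epsilon>) + partition_entropy \<mu> \<alpha>"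
    unfolding partition_entropy_def
    by (subst Bochner_Integration.integral_add)
       (use int[of "\<lambda>k. - ln (cell_measure \<mu> \<alpha> k)"] in \<open>auto simp: prob_space\<close>)
  finally show ?thesis .
qed

context rel_conjugacy
begin

text \<open>The label at the identity, viewed through the inverse conjugacy as a function on the
  other system, is approximated by a local function. Its alphabet becomes the partition \<beta>, so
  \<beta> is dictated by the decoder. The error set is pulled back without change of
  measure.\<close>

lemma decoder_exists:
  fixes \<alpha> :: "'k \<Rightarrow> nat"
  assumes \<alpha>: "\<alpha> \<in> \<kappa> \<rightarrow>\<^sub>M count_space UNIV" and \<alpha>n: "\<And>y. y \<in> space \<kappa> \<Longrightarrow> \<alpha> y < Suc n" and e: "0 < e"
  obtains F and \<beta> :: "'l \<Rightarrow> nat" and m V D where "finite F" "F \<subseteq> carrier G"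
    "\<beta> \<in> \<nu> \<rightarrow>\<^sub>M count_space UNIV" "\<And>y. y \<in> space \<nu> \<Longrightarrow> \<beta> y < Suc m"
    "D \<in> sets M\<kappa>" "measure M\<kappa> D < e"
    "\<And>x. x \<in> X \<Longrightarrow> x \<notin> D \<Longrightarrow> V (local_view F \<beta> (fst (\<phi> x)) (coord G (\<phi> x))) = \<alpha> (coord G x \<one>)"
proof -
  \<comment> \<open>The default 0 off the conull set respects the bound
    \<open>Suc n\<close>.\<close>
  define v where "v y = (if y \<in> Y then \<alpha> (coord G (\<psi> y) \<one>) else 0)" for y
  have "(\<lambda>x. \<alpha> (coord G x \<one>)) \<in> Sub_tensor G \<kappa> \<rightarrow>\<^sub>M count_space UNIV"
    by (rule measurable_compose[OF measurable_coord \<alpha>]) simp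
  then have "(\<lambda>x. \<alpha> (coord G x \<one>)) \<in> restrict_space M\<kappa> X \<rightarrow>\<^sub>M count_space UNIV"
    by (intro measurable_restrict_space1) (simp cong: measurable_cong_sets)
  then have "(\<lambda>y. \<alpha> (coord G (\<psi> y) \<one>)) \<in> restrict_space M\<nu> Y \<rightarrow>\<^sub>M count_space UNIV"
    by (rule measurable_compose[OF \<psi>_meas])
  then have "v \<in> M\<nu> \<rightarrow>\<^sub>M count_space UNIV"
    unfolding v_def by (rule measurable_if_mem[OF sets_Y])
  then have v: "v \<in> Sub_tensor G \<nu> \<rightarrow>\<^sub>M count_space UNIV" by (simp cong: measurable_cong_sets)
  have "v y < Suc n" for y
  proof (cases "y \<in> Y")
    case True
    then have "\<psi> y \<in> X" using measurable_space[OF \<psi>_meas, of y] by (simp add: space_restrict)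
    then show ?thesis using True \<alpha>n coord_in_space[of "\<psi> y" G \<kappa> \<one>] X_subset by (auto simp: v_def)
  qed (simp add: v_def)
  then obtain w where w: "local_fun G \<nu> w" "measure M\<nu> {y \<in> space (Sub_tensor G \<nu>). v y \<noteq> w y} < e"
    using local_fun_approximation[OF C \<eta>' \<nu> v _ e, of n] by blast
  obtain F \<beta> m V where F: "finite F" "F \<subseteq> carrier G" "\<beta> \<in> \<nu> \<rightarrow>\<^sub>M count_space UNIV"
    "\<And>y. y \<in> space \<nu> \<Longrightarrow> \<beta> y < (m :: nat)"
    and V: "\<And>y. y \<in> space (Sub_tensor G \<nu>) \<Longrightarrow> w y = V (local_view F \<beta> (fst y) (coord G y))"
    using w(1) unfolding local_fun_def by metis
  let ?B = "{y \<in> space (Sub_tensor G \<nu>). v y \<noteq> w y}"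
  have B: "?B \<in> sets (Sub_tensor G \<nu>)" by (rule sets_neq_nat[OF v measurable_local_fun[OF w(1)]])
  show thesis
  proof (rule that[OF F(1-3)])
    \<comment> \<open>Weakened to a successor, so that the default letter 0 of
      \<open>image_symbol\<close> visibly belongs to the alphabet.\<close>
    show "\<beta> y < Suc m" if "y \<in> space \<nu>" for y using F(4)[OF that] by simp
    show "{x \<in> X. \<phi> x \<in> ?B} \<in> sets M\<kappa>" by (rule \<phi>_preimage(1)[OF B])
    show "measure M\<kappa> {x \<in> X. \<phi> x \<in> ?B} < e" using w(2) by (simp only: \<phi>_preimage(2)[OF B])
    fix x assume x: "x \<in> X" "x \<notin> {x \<in> X. \<phi> x \<in> ?B}"
    have y: "\<phi> x \<in> Y" "\<phi> x \<in> space (Sub_tensor G \<nu>)" using \<phi>_in_Y[OF x(1)] Y_subset by auto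
    then have "v (\<phi> x) = w (\<phi> x)" using x by blast
    then show "V (local_view F \<beta> (fst (\<phi> x)) (coord G (\<phi> x))) = \<alpha> (coord G x \<one>)"
      using V[OF y(2)] y(1) \<psi>_\<phi>[OF x(1)] by (simp add: v_def)
  qed
qed

text \<open>The letter of the exact, infinite-window code that the encoder will approximate,
  extended by 0 off the conull set.\<close>

definition image_symbol :: "('l \<Rightarrow> nat) \<Rightarrow> 'a set \<times> ('a set \<Rightarrow> 'k) \<Rightarrow> nat" where
  "image_symbol \<beta> x = (if x \<in> X then \<beta> (coord G (\<phi> x) \<one>) else 0)"

lemma measurable_image_symbol:
  assumes \<beta>: "\<beta> \<in> \<nu> \<rightarrow>\<^sub>M count_space UNIV"
  shows "image_symbol \<beta> \<in> M\<kappa> \<rightarrow>\<^sub>M count_space UNIV"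
proof -
  have "(\<lambda>x. \<beta> (coord G x \<one>)) \<in> Sub_tensor G \<nu> \<rightarrow>\<^sub>M count_space UNIV"
    by (rule measurable_compose[OF measurable_coord \<beta>]) simp
  then have "(\<lambda>x. \<beta> (coord G x \<one>)) \<in> restrict_space M\<nu> Y \<rightarrow>\<^sub>M count_space UNIV"
    by (intro measurable_restrict_space1) (simp cong: measurable_cong_sets)
  then have "(\<lambda>x. \<beta> (coord G (\<phi> x) \<one>)) \<in> restrict_space M\<kappa> X \<rightarrow>\<^sub>M count_space UNIV"
    by (rule measurable_compose[OF \<phi>_meas])
  then show ?thesis unfolding image_symbol_def[abs_def] by (rule measurable_if_mem[OF sets_X])
qed

lemma image_symbol_bound:
  assumes "\<And>y. y \<in> space \<nu> \<Longrightarrow> \<beta> y < Suc m"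
  shows "image_symbol \<beta> x < Suc m"
  using assms coord_in_space[of "\<phi> x" G \<nu> \<one>] \<phi>_in_Y[of x] Y_subset
  by (auto simp: image_symbol_def)

text \<open>By equivariance a single function, evaluated along the orbit of x, produces all letters
  of the image of x. One approximation of it therefore approximates every letter.\<close>

lemma image_symbol_act:
  assumes x: "x \<in> X" and g: "g \<in> carrier G"
  shows "image_symbol \<beta> (Sub_tensor_act G g x) = \<beta> (coord G (\<phi> x) g)"
proof -
  have "subgroup (fst (\<phi> x)) G" using \<phi>_in_Y[OF x] Y_subset subgroup_fst_Sub_tensor by blast
  then show ?thesis
    using act_in_X[OF g x] equiv[OF g x] g by (simp add: image_symbol_def coord_act)
qed

text \<open>The conjugacy preserves measure and a single coordinate has law \<nu>. Hence the ideal
  letter costs at most the entropy of \<nu>, up to mixing.\<close>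

lemma cell_measure_image_symbol:
  assumes \<beta>: "\<beta> \<in> \<nu> \<rightarrow>\<^sub>M count_space UNIV"
  shows "cell_measure M\<kappa> (image_symbol \<beta>) k = cell_measure \<nu> \<beta> k"
proof -
  let ?Z = "{y \<in> space \<nu>. \<beta> y = k}"
  let ?B = "{y \<in> space (Sub_tensor G \<nu>). coord G y \<one> \<in> ?Z}"
  note [measurable] = \<beta> measurable_image_symbol[OF \<beta>]
  have Z: "?Z \<in> sets \<nu>" by measurable
  have B: "?B \<in> sets (Sub_tensor G \<nu>)"
    using measurable_sets[OF measurable_coord[of \<one> G \<nu>] Z] by (simp add: vimage_def Int_def conj_commute)
  have "measure M\<kappa> {x \<in> space M\<kappa>. image_symbol \<beta> x = k} = measure M\<kappa> {x \<in> X. \<phi> x \<in> ?B}"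
  proof (rule measure_eq_AE)
    show "AE x in M\<kappa>. x \<in> {x \<in> space M\<kappa>. image_symbol \<beta> x = k} \<longleftrightarrow> x \<in> {x \<in> X. \<phi> x \<in> ?B}"
      using AE_X
    proof eventually_elim
      case (elim x)
      have "\<phi> x \<in> space (Sub_tensor G \<nu>)" using \<phi>_in_Y[OF elim] Y_subset by blast
      then show ?case using elim X_subset coord_in_space[of "\<phi> x" G \<nu> \<one>] by (auto simp: image_symbol_def)
    qed
    show "{x \<in> space M\<kappa>. image_symbol \<beta> x = k} \<in> sets M\<kappa>" by measurable
  qed (rule \<phi>_preimage(1)[OF B])
  also have "\<dots> = measure \<nu> ?Z"
    unfolding \<phi>_preimage(2)[OF B] by (rule measure_coord_one[OF \<eta>' \<nu> Z])
  finally show ?thesis by (simp add: cell_measure_def)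
qed

text \<open>With \<open>\<Delta>\<close> the assumed entropy gap, four losses of at most a fifth of
  it occur: mixing in the law of the letters, errors of the encoder at the point, mixing in the law
  of the label, and wrong guesses of the decoder.\<close>

lemma Shannon_entropy_le:
  assumes sofic: "sofic_measure G \<eta>" and S\<kappa>: "standard_prob_space \<kappa>" and S\<nu>: "standard_prob_space \<nu>"
  shows "Shannon_entropy \<kappa> \<le> Shannon_entropy \<nu>"
proof (rule ccontr)
  assume "\<not> ?thesis"
  then have lt: "Shannon_entropy \<nu> < Shannon_entropy \<kappa>" by simp
  obtain \<alpha> n' where \<alpha>: "\<alpha> \<in> \<kappa> \<rightarrow>\<^sub>M count_space UNIV" and \<alpha>n': "\<And>x. x \<in> space \<kappa> \<Longrightarrow> \<alpha> x < (n' :: nat)"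
    and big: "Shannon_entropy \<nu> < ennreal (partition_entropy \<kappa> \<alpha>)"
    using Shannon_less_partition_entropy[OF S\<kappa> lt] by metis
  define n where "n = Suc n'"
  have n: "0 < n" and \<alpha>n: "\<And>x. x \<in> space \<kappa> \<Longrightarrow> \<alpha> x < n" using \<alpha>n' by (auto simp: n_def less_Suc_eq)
  obtain hn where hn: "Shannon_entropy \<nu> = ennreal hn" "0 \<le> hn"
    using lt by (cases "Shannon_entropy \<nu>") auto
  define \<Delta> where "\<Delta> = partition_entropy \<kappa> \<alpha> - hn"
  have \<Delta>: "0 < \<Delta>" using big hn by (auto simp: \<Delta>_def ennreal_less_iff)
  \<comment> \<open>Solves \<open>- ln (1 - \<epsilon>) = \<Delta> / 5\<close>.\<close>
  define \<epsilon> where "\<epsilon> = 1 - exp (- \<Delta> / 5)"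
  have \<epsilon>: "0 < \<epsilon>" "\<epsilon> < 1" and l\<epsilon>: "- ln (1 - \<epsilon>) = \<Delta> / 5" using \<Delta> by (auto simp: \<epsilon>_def)
  \<comment> \<open>A smoothed identity channel: the guess is almost surely trusted, but every label
    keeps positive mass.\<close>
  define w where "w a c = mix \<epsilon> n (if a = c then 1 else 0)" for a c :: nat
  have w: "\<epsilon> / n \<le> w a c" "w a c \<le> 1" "0 < w a c" for a c
    using mix_bounds[OF \<epsilon> n] by (auto simp: w_def)
  have w1: "(\<Sum>a<n. w a c) \<le> 1" for c
  proof -
    \<comment> \<open>An inequality, because a decoded value \<open>c\<close> may lie outside the
      range of labels.\<close>
    have "(\<Sum>a<n. if a = c then 1 else 0 :: real) \<le> 1" by simp
    then have "(1 - \<epsilon>) * (\<Sum>a<n. if a = c then 1 else 0) \<le> (1 - \<epsilon>) * 1" using \<epsilon> by (intro mult_left_mono) auto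
    then show ?thesis unfolding w_def sum_mix[OF n] by simp
  qed
  have waa: "- ln (w a a) \<le> \<Delta> / 5" for a
  proof -
    have "1 - \<epsilon> \<le> w a a" using mix_bounds(2)[OF \<epsilon> n, of 1] by (simp add: w_def)
    then have "ln (1 - \<epsilon>) \<le> ln (w a a)" using \<epsilon> by (intro ln_mono) auto
    then show ?thesis using l\<epsilon> by simp
  qed
  define Lw where "Lw = - ln (\<epsilon> / n)"
  have Lw: "- ln (w a c) \<le> Lw" for a c
    unfolding Lw_def using w[of a c] \<epsilon> n by (simp only: neg_le_iff_le) (intro ln_mono, auto)
  have Lw0: "0 \<le> Lw"
  proof -
    have "0 \<le> - ln (w 0 0)" using w[of 0 0] by simp
    then show ?thesis using Lw[of 0 0] by simp
  qed
  \<comment> \<open>\<open>Lw\<close> bounds the price of a wrong guess, so \<open>e1\<close> is the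
    admissible error probability. Half of it goes to the decoder, half to wrong letters in its
    window.\<close>
  define e1 where "e1 = \<Delta> / (5 * (Lw + 1))"
  have e1: "0 < e1" "Lw * e1 \<le> \<Delta> / 5" using \<Delta> Lw0 by (auto simp: e1_def field_simps)
  have half_pos: "0 < e1 / 2" using e1(1) by simp
  obtain F \<beta> m' V D where F: "finite F" "F \<subseteq> carrier G"
    and \<beta>: "\<beta> \<in> \<nu> \<rightarrow>\<^sub>M count_space UNIV" and \<beta>m': "\<And>y. y \<in> space \<nu> \<Longrightarrow> \<beta> y < Suc m'"
    and D: "D \<in> sets M\<kappa>" "measure M\<kappa> D < e1 / 2"
    and dec: "\<And>x. x \<in> X \<Longrightarrow> x \<notin> D \<Longrightarrow> V (local_view F \<beta> (fst (\<phi> x)) (coord G (\<phi> x))) = \<alpha> (coord G x \<one>)"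
    by (rule decoder_exists[OF \<alpha> _ half_pos, of n'])
      ((rule \<alpha>n[unfolded n_def], assumption), (rule that; assumption))
  define m where "m = Suc m'"
  have m: "0 < m" and \<beta>m: "\<And>y. y \<in> space \<nu> \<Longrightarrow> \<beta> y < m" using \<beta>m' by (auto simp: m_def)
  define r where "r b = mix \<epsilon> m (cell_measure \<nu> \<beta> b)" for b
  have r: "\<epsilon> / m \<le> r b" "r b \<le> 1" "0 < r b" for b
    using mix_bounds[OF \<epsilon> m, of "cell_measure \<nu> \<beta> b"] cell_measure_bounds[OF \<nu>, of \<beta> b]
    by (simp_all add: r_def)
  have r1: "(\<Sum>b<m. r b) = 1"
  proof -
    have "(\<Sum>b<m. cell_measure \<nu> \<beta> b) = 1" by (rule sum_cell_measure[OF \<nu> \<beta>]) (rule \<beta>m)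
    then show ?thesis unfolding r_def sum_mix[OF m] by simp
  qed
  define Lr where "Lr = - ln (\<epsilon> / m)"
  have Lr: "- ln (r b) \<le> Lr" for b
    unfolding Lr_def using r[of b] \<epsilon> m by (simp only: neg_le_iff_le) (intro ln_mono, auto)
  have r0: "0 \<le> - ln (r b)" for b using r[of b] by simp
  have Lr0: "0 \<le> Lr" using r0[of 0] Lr[of 0] by simp
  \<comment> \<open>The first bound keeps the sum of the encoder errors over \<open>F\<close> below
    \<open>e1 / 2\<close>, the second keeps the price of a wrong letter at the point below
    \<open>\<Delta> / 5\<close>.\<close>
  define e2 where "e2 = min (e1 / (2 * (real (card F) + 1))) (\<Delta> / (5 * (Lr + 1)))"
  have e2: "0 < e2" "Lr * e2 \<le> \<Delta> / 5" "real (card F) * e2 \<le> e1 / 2"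
  proof -
    show "0 < e2" using e1(1) \<Delta> Lr0 by (auto simp: e2_def add_nonneg_pos)
    have "Lr * e2 \<le> Lr * (\<Delta> / (5 * (Lr + 1)))" using Lr0 by (intro mult_left_mono) (auto simp: e2_def)
    also have "\<dots> \<le> \<Delta> / 5" using \<Delta> Lr0 by (auto simp: field_simps)
    finally show "Lr * e2 \<le> \<Delta> / 5" .
    have "real (card F) * e2 \<le> real (card F) * (e1 / (2 * (real (card F) + 1)))"
      by (intro mult_left_mono) (auto simp: e2_def)
    also have "\<dots> \<le> e1 / 2" using e1(1) by (auto simp: field_simps)
    finally show "real (card F) * e2 \<le> e1 / 2" .
  qed
  let ?s = "image_symbol \<beta>"
  let ?\<Omega> = "space (Sub_tensor G \<kappa>)"
  interpret M\<kappa>: prob_space M\<kappa> by (rule prob_space_Sub_tensor_measure[OF \<eta>' \<kappa>])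
  have s\<kappa>: "?s \<in> M\<kappa> \<rightarrow>\<^sub>M count_space UNIV" by (rule measurable_image_symbol[OF \<beta>])
  then have s: "?s \<in> Sub_tensor G \<kappa> \<rightarrow>\<^sub>M count_space UNIV" by (simp cong: measurable_cong_sets)
  have sm: "?s x < m" for x unfolding m_def by (rule image_symbol_bound[OF \<beta>m'])
  obtain u where u: "local_fun G \<kappa> u" "\<And>x. u x < m" "measure M\<kappa> {x \<in> ?\<Omega>. ?s x \<noteq> u x} < e2"
    using local_fun_approximation[OF C \<eta>' \<kappa> s sm[unfolded m_def] e2(1)] unfolding m_def by blast
  obtain E \<gamma> k U' where E: "finite E" "E \<subseteq> carrier G" and \<gamma>: "\<gamma> \<in> \<kappa> \<rightarrow>\<^sub>M count_space UNIV"
    "\<And>y. y \<in> space \<kappa> \<Longrightarrow> \<gamma> y < (k :: nat)"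
    and U': "\<And>x. x \<in> ?\<Omega> \<Longrightarrow> u x = U' (local_view E \<gamma> (fst x) (coord G x))"
    using u(1) unfolding local_fun_def by metis
  \<comment> \<open>Truncation keeps the code below \<open>m\<close> also on views that never occur;
    on actual views nothing changes, since \<open>u\<close> is already below
    \<open>m\<close>.\<close>
  define U where "U p = min (U' p) m'" for p
  have U: "U p < m" for p by (auto simp: U_def m_def)
  have code: "shifted_code G E U g (fst x) (\<lambda>g. \<gamma> (coord G x g)) = u (Sub_tensor_act G g x)"
    if x: "x \<in> ?\<Omega>" and g: "g \<in> carrier G" for x g
  proof -
    have H: "subgroup (fst x) G" by (rule subgroup_fst_Sub_tensor[OF x])
    have "conj_subgroup G g (fst x) \<inter> E = {e \<in> E. inv g \<otimes> e \<otimes> g \<in> fst x}"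
      using E(2) by (auto simp: mem_conj_subgroup_iff[OF H g])
    moreover have "(\<lambda>e\<in>E. \<gamma> (coord G (Sub_tensor_act G g x) e)) = (\<lambda>e\<in>E. \<gamma> (coord G x (e \<otimes> g)))"
      by (rule restrict_ext) (use E(2) in \<open>auto simp: coord_act[OF H g]\<close>)
    ultimately have "u (Sub_tensor_act G g x) = U' ({e \<in> E. inv g \<otimes> e \<otimes> g \<in> fst x}, \<lambda>e\<in>E. \<gamma> (coord G x (e \<otimes> g)))"
      using U'[OF act_in_space[OF g x]] by (simp add: local_view_def)
    then show ?thesis using u(2)[of "Sub_tensor_act G g x"] by (simp add: shifted_code_def U_def m_def)
  qed
  \<comment> \<open>The event that the encoder errs at the translate by g; by invariance its measure
    does not depend on g.\<close>
  define B where "B g = {x \<in> ?\<Omega>. Sub_tensor_act G g x \<in> {x \<in> ?\<Omega>. ?s x \<noteq> u x}}" for g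
  have B0: "{x \<in> ?\<Omega>. ?s x \<noteq> u x} \<in> sets (Sub_tensor G \<kappa>)"
    by (rule sets_neq_nat[OF s measurable_local_fun[OF u(1)]])
  have B: "B g \<in> sets M\<kappa>" "measure M\<kappa> (B g) < e2" if "g \<in> carrier G" for g
    using measure_act_preimage[OF C that \<eta> \<kappa> B0] u(3) unfolding B_def by simp_all
  have agree: "shifted_code G E U g (fst x) (\<lambda>g. \<gamma> (coord G x g)) = \<beta> (coord G (\<phi> x) g)"
    if x: "x \<in> X" and g: "g \<in> carrier G" and nB: "x \<notin> B g" for x g
  proof -
    have x': "x \<in> ?\<Omega>" using x X_subset by blast
    have "?s (Sub_tensor_act G g x) = u (Sub_tensor_act G g x)"
      using nB x' act_in_space[OF g x'] unfolding B_def by blast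
    then show ?thesis using code[OF x' g] image_symbol_act[OF x g] by simp
  qed
  define D' where "D' = D \<union> (\<Union>g\<in>F. B g)"
  have D': "D' \<in> sets M\<kappa>"
    unfolding D'_def using D(1) B(1) F by (intro sets.Un sets.finite_UN) auto
  have "measure M\<kappa> D' \<le> measure M\<kappa> D + measure M\<kappa> (\<Union>g\<in>F. B g)"
    unfolding D'_def by (rule measure_subadditive) (use D(1) B(1) F in \<open>auto intro!: sets.finite_UN simp: M\<kappa>.emeasure_eq_measure\<close>)
  also have "measure M\<kappa> (\<Union>g\<in>F. B g) \<le> (\<Sum>g\<in>F. measure M\<kappa> (B g))"
    by (rule M\<kappa>.finite_measure_subadditive_finite) (use B(1) F in auto)
  also have "\<dots> \<le> (\<Sum>g\<in>F. e2)" by (rule sum_mono) (use B(2) F in \<open>auto intro: less_imp_le\<close>)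
  also have "\<dots> \<le> e1 / 2" using e2(3) by simp
  finally have mD': "measure M\<kappa> D' \<le> e1" using D(2) by simp
  let ?cost = "\<lambda>x. code_cost G E U F V r w (fst x) (\<lambda>g. \<gamma> (coord G x g)) (\<alpha> (coord G x \<one>))"
  \<comment> \<open>The ideal letter price and the price of a correct guess, with surcharges on the
    event of a wrong letter at the point and on the event \<open>D'\<close> outside which the
    decoder receives correct letters and guesses correctly.\<close>
  let ?b = "\<lambda>x. - ln (r (?s x)) + Lr * indicator (B \<one>) x + \<Delta> / 5 + Lw * indicator D' x"
  have "partition_entropy \<kappa> \<alpha> \<le> (\<integral>x. ?cost x \<partial>M\<kappa>)"
    by (rule partition_entropy_le_code_cost[OF \<eta>' sofic \<kappa> \<alpha> \<alpha>n \<gamma>(1) E F U, where l = "min (\<epsilon> / m) (\<epsilon> / n)"])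
       (use r w r1 w1 \<epsilon> m n in \<open>auto intro: order_trans[OF min.cobounded1] order_trans[OF min.cobounded2]\<close>)
  also have "\<dots> \<le> (\<integral>x. ?b x \<partial>M\<kappa>)"
  proof (rule integral_mono_AE')
    show "integrable M\<kappa> ?b"
      using integrable_comp_partition[OF M\<kappa>.prob_space_axioms s\<kappa> sm, of "\<lambda>b. - ln (r b)"] D' B(1)[of \<one>]
      by (intro Bochner_Integration.integrable_add integrable_mult_right integrable_real_indicator)
         (auto simp: M\<kappa>.emeasure_eq_measure)
    show "AE x in M\<kappa>. 0 \<le> ?b x"
      by (intro AE_I2 add_nonneg_nonneg mult_nonneg_nonneg r0 Lr0 Lw0) (use \<Delta> in auto)
    show "AE x in M\<kappa>. ?cost x \<le> ?b x"
      using AE_fst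
    proof eventually_elim
      case (elim x)
      then have x: "x \<in> X" and fx: "fst (\<phi> x) = fst x" by auto
      have "- ln (r (shifted_code G E U \<one> (fst x) (\<lambda>g. \<gamma> (coord G x g)))) \<le> - ln (r (?s x)) + Lr * indicator (B \<one>) x"
      proof (cases "x \<in> B \<one>")
        case True
        then show ?thesis
          using Lr[of "shifted_code G E U \<one> (fst x) (\<lambda>g. \<gamma> (coord G x g))"] r0[of "?s x"] by simp
      next
        case False
        then show ?thesis using agree[OF x one_closed] x by (simp add: image_symbol_def)
      qed
      moreover have "- ln (w (\<alpha> (coord G x \<one>)) (decoded G E U F V (fst x) (\<lambda>g. \<gamma> (coord G x g))))
          \<le> \<Delta> / 5 + Lw * indicator D' x"
      proof (cases "x \<in> D'")
        case True
        then show ?thesis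
          using Lw[of "\<alpha> (coord G x \<one>)" "decoded G E U F V (fst x) (\<lambda>g. \<gamma> (coord G x g))"] \<Delta> by simp
      next
        case False
        have "(\<lambda>g\<in>F. shifted_code G E U g (fst x) (\<lambda>g. \<gamma> (coord G x g))) = (\<lambda>g\<in>F. \<beta> (coord G (\<phi> x) g))"
          by (rule restrict_ext, rule agree[OF x]) (use False F in \<open>auto simp: D'_def\<close>)
        then have "decoded G E U F V (fst x) (\<lambda>g. \<gamma> (coord G x g)) = V (local_view F \<beta> (fst (\<phi> x)) (coord G (\<phi> x)))"
          by (simp add: decoded_def local_view_def fx)
        also have "\<dots> = \<alpha> (coord G x \<one>)" by (rule dec[OF x]) (use False in \<open>simp add: D'_def\<close>)
        finally show ?thesis using False waa by simp
      qed
      ultimately show ?case unfolding code_cost_def by linarith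
    qed
  qed
  also have "\<dots> = (\<integral>x. - ln (r (?s x)) \<partial>M\<kappa>) + Lr * measure M\<kappa> (B \<one>) + \<Delta> / 5 + Lw * measure M\<kappa> D'"
  proof -
    have i1: "integrable M\<kappa> (\<lambda>x. - ln (r (?s x)))"
      by (rule integrable_comp_partition[OF M\<kappa>.prob_space_axioms s\<kappa> sm])
    have i2: "integrable M\<kappa> (\<lambda>x. Lr * indicator (B \<one>) x :: real)" "integrable M\<kappa> (\<lambda>x. Lw * indicator D' x :: real)"
      using D' B(1)[of \<one>] by (auto intro!: integrable_mult_right integrable_real_indicator simp: M\<kappa>.emeasure_eq_measure)
    have i3: "integrable M\<kappa> (\<lambda>x. - ln (r (?s x)) + Lr * indicator (B \<one>) x)"
      by (rule Bochner_Integration.integrable_add[OF i1 i2(1)])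
    have i4: "integrable M\<kappa> (\<lambda>x. - ln (r (?s x)) + Lr * indicator (B \<one>) x + \<Delta> / 5)"
      by (rule Bochner_Integration.integrable_add[OF i3]) simp
    have s1: "B \<one> \<inter> ?\<Omega> = B \<one>" "D' \<inter> ?\<Omega> = D'"
      using sets.sets_into_space[OF D'] sets.sets_into_space[OF B(1)[OF one_closed]] by auto
    have "measure M\<kappa> ?\<Omega> = 1" using M\<kappa>.prob_space by simp
    then show ?thesis
      unfolding Bochner_Integration.integral_add[OF i4 i2(2)]
        Bochner_Integration.integral_add[OF i3 M\<kappa>.integrable_const]
        Bochner_Integration.integral_add[OF i1 i2(1)] by (simp add: s1)
  qed
  also have "(\<integral>x. - ln (r (?s x)) \<partial>M\<kappa>) = (\<integral>y. - ln (r (\<beta> y)) \<partial>\<nu>)"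
  proof -
    have "(\<integral>x. - ln (r (?s x)) \<partial>M\<kappa>) = (\<Sum>b<m. - ln (r b) * cell_measure M\<kappa> ?s b)"
      by (rule integral_comp_partition[OF M\<kappa>.prob_space_axioms s\<kappa> sm])
    also have "\<dots> = (\<Sum>b<m. - ln (r b) * cell_measure \<nu> \<beta> b)"
      by (simp only: cell_measure_image_symbol[OF \<beta>])
    also have "\<dots> = (\<integral>y. - ln (r (\<beta> y)) \<partial>\<nu>)"
      by (rule integral_comp_partition[OF \<nu> \<beta>, symmetric]) (rule \<beta>m)
    finally show ?thesis .
  qed
  also have "\<dots> \<le> \<Delta> / 5 + partition_entropy \<nu> \<beta>"
    unfolding r_def l\<epsilon>[symmetric] by (rule cross_entropy_mix[OF \<nu> \<beta> _ m \<epsilon>]) (rule \<beta>m)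
  finally have "partition_entropy \<kappa> \<alpha> \<le>
      \<Delta> / 5 + partition_entropy \<nu> \<beta> + Lr * measure M\<kappa> (B \<one>) + \<Delta> / 5 + Lw * measure M\<kappa> D'" by simp
  moreover have "Lr * measure M\<kappa> (B \<one>) \<le> Lr * e2"
    by (rule mult_left_mono[OF less_imp_le[OF B(2)[OF one_closed]] Lr0])
  moreover have "Lw * measure M\<kappa> D' \<le> Lw * e1" by (rule mult_left_mono[OF mD' Lw0])
  moreover have "partition_entropy \<nu> \<beta> \<le> hn"
  proof -
    have "ennreal (partition_entropy \<nu> \<beta>) \<le> Shannon_entropy \<nu>"
      by (rule partition_entropy_le_Shannon[OF \<nu> \<beta> _ S\<nu>]) (rule \<beta>m)
    then show ?thesis using hn by simp
  qed
  \<comment> \<open>The losses add up to four fifths of the gap, which leaves a strict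
    contradiction.\<close>
  moreover have False if "a \<le> D / 5 + b + c + D / 5 + d" "c \<le> e" "d \<le> f" "b \<le> h"
    "f \<le> D / 5" "e \<le> D / 5" "0 < D" "D = a - h" for a b c d e f h D :: real
    using that by argo
  ultimately show False using e1(2) e2(2) \<Delta> \<Delta>_def by blast
qed

end

theorem theorem13p2:
  fixes G :: "('g, 'm) monoid_scheme"
    and \<eta> :: "'g set measure"
    and \<kappa> :: "'k measure"
    and \<nu> :: "'l measure"
  assumes "group G" and "countable (carrier G)"
    and "conj_invariant_measure G \<eta>" and "sofic_measure G \<eta>"
    and "standard_prob_space \<kappa>" and "standard_prob_space \<nu>"
    and "conjugate_rel_Sub G \<eta> \<kappa> \<nu>"
  shows "Shannon_entropy \<kappa> = Shannon_entropy \<nu>"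
proof -
  obtain X Y \<phi> where *:
    "conull_invariant G (Sub_tensor_act G) (Sub_tensor_measure G \<eta> \<kappa>) X"
    "conull_invariant G (Sub_tensor_act G) (Sub_tensor_measure G \<eta> \<nu>) Y"
    "measure_space_iso (restrict_space (Sub_tensor_measure G \<eta> \<kappa>) X)
       (restrict_space (Sub_tensor_measure G \<eta> \<nu>) Y) \<phi>"
    "\<forall>g\<in>carrier G. \<forall>x\<in>X. \<phi> (Sub_tensor_act G g x) = Sub_tensor_act G g (\<phi> x)"
    "AE x in restrict_space (Sub_tensor_measure G \<eta> \<kappa>) X. fst (\<phi> x) = fst x"
    using assms(7) unfolding conjugate_rel_Sub_def by (elim exE conjE) (rule that; assumption)
  have "prob_space \<kappa>" "prob_space \<nu>" using assms(5,6) by (auto simp: standard_prob_space_def)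
  then have c: "rel_conjugacy G \<eta> \<kappa> \<nu> X Y \<phi>"
    using assms(1-3) * by (intro rel_conjugacy.intro rel_conjugacy_axioms.intro) auto
  show ?thesis
    using rel_conjugacy.Shannon_entropy_le[OF c assms(4-6)]
      rel_conjugacy.Shannon_entropy_le[OF rel_conjugacy.flip[OF c] assms(4,6,5)] by (rule antisym)
qed

end
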